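(* Let $W$ be an irreducible Coxeter group with reflection arrangement $\mathcal A$, not of type $E_6$, $E_7$ or $E_8$. Then the Hessian rank condition holds for $\mathcal A$: for any $j\in\{1,\dots,\ell\}$ there is an $i\in\{1,\dots,\ell\}$ such that $m_i+m_j=w_\ell$ and $\mathrm{Hess}(p_i)(\eta_j)\notin F\,\Omega^1_S$.
   Context: $W\subset\mathrm{GL}(V)$, $V=V_{\mathbb R}\otimes_{\mathbb R}\mathbb{C}$, $\dim V=\ell$, is a finite irreducible group generated by reflections defined over $\mathbb{R}$. Let $x_1,\dots,x_\ell$ be coordinates on $V$, orthonormal with respect to a $W$-invariant Euclidean inner product on $V_{\mathbb R}$, and $S=\mathbb{C}[V]=\mathbb{C}[x_1,\dots,x_\ell]$. Let $R=S^W=\mathbb{C}[p_1,\dots,p_\ell]$ with $p_1,\dots,p_\ell$ homogeneous basic invariants of degrees $\deg p_i=w_i=m_i+1$, $m_1\le\dots\le m_\ell$; thus $w_\ell$ is the Coxeter number. $F\subset S$ is the ideal generated by $p_1,\dots,p_\ell$. $\Omega^1_S=\bigoplus_iS\,dx_i$. $\eta_j=\sum_k\partial_{x_k}(p_j)\,\partial_{x_k}$ is the vector field dual to $dp_j$. For $p\in R$ and a vector field $\delta$ on $V$, $\mathrm{Hess}(p)(\delta)=\sum_{i=1}^\ell\delta(\partial_{x_i}(p))\,dx_i$. *)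

theory Defs
  imports
    "HOL-Analysis.Analysis"
    "HOL-Library.Poly_Mapping"
    "HOL-Algebra.Generated_Groups"
    "HOL-Algebra.Multiplicative_Group"
begin

section \<open>Real reflection groups\<close>

text \<open>
  The real form of V is \<^typ>\<open>real^'n\<close> with the standard inner product: this is what the choice of
  coordinates that are orthonormal for a W-invariant inner product amounts to. The rank
  \<open>\<ell>\<close> is \<open>CARD('n)\<close>. The group W is a set of real matrices, acting on V, which is
  \<^typ>\<open>complex^'n\<close>, through complexification.
\<close>

definition GL :: "(real^'n^'n) monoid" where
  "GL = \<lparr>carrier = {A. invertible A}, mult = (**), one = mat 1\<rparr>"

definition reflection_matrix :: "real^'n \<Rightarrow> real^'n^'n" where
  "reflection_matrix a = matrix (\<lambda>x. x - (2 * (x \<bullet> a) / (a \<bullet> a)) *\<^sub>R a)"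

definition reflections :: "(real^'n^'n) set \<Rightarrow> (real^'n^'n) set" where
  "reflections W = {s \<in> W. \<exists>a. a \<noteq> 0 \<and> s = reflection_matrix a}"

definition complexify :: "real^'n^'n \<Rightarrow> complex^'n^'n" where
  "complexify A = map_matrix of_real A"

definition irreducible_action :: "(real^'n^'n) set \<Rightarrow> bool" where
  "irreducible_action W \<longleftrightarrow>
    (\<forall>U :: (complex^'n) set. vec.subspace U \<and> (\<forall>A\<in>W. \<forall>u\<in>U. complexify A *v u \<in> U)
       \<longrightarrow> U = {0} \<or> U = UNIV)"

text \<open>
  The condition \<open>W \<noteq> {mat 1}\<close> only excludes the trivial group on a line, which acts irreducibly
  and is generated by the empty set of reflections, but has an empty Coxeter graph and is not an
  irreducible Coxeter group.
\<close>
definition irreducible_reflection_group :: "(real^'n^'n) set \<Rightarrow> bool" where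
  "irreducible_reflection_group W \<longleftrightarrow>
     subgroup W GL \<and> finite W \<and> W = generate GL (reflections W) \<and>
     irreducible_action W \<and> W \<noteq> {mat 1}"


section \<open>Coxeter type\<close>

text \<open>The normalised root system of W: the two unit normals of each reflecting hyperplane.\<close>
definition roots :: "(real^'n^'n) set \<Rightarrow> (real^'n) set" where
  "roots W = {a. norm a = 1 \<and> reflection_matrix a \<in> W}"

definition simple_system :: "(real^'n^'n) set \<Rightarrow> (real^'n) set \<Rightarrow> bool" where
  "simple_system W D \<longleftrightarrow>
     D \<subseteq> roots W \<and> independent D \<and>
     (\<forall>b\<in>roots W. \<exists>c. (\<forall>a\<in>D. c a \<ge> 0) \<and>
        (b = (\<Sum>a\<in>D. c a *\<^sub>R a) \<or> b = - (\<Sum>a\<in>D. c a *\<^sub>R a)))"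

text \<open>
  That W has the Coxeter matrix \<open>M\<close>, with rows and columns indexed by \<open>1, \<dots>, r\<close>, means: for a suitably
  numbered simple system, the product of the i-th and j-th simple reflections has order \<open>M i j\<close>.
\<close>
definition has_coxeter_matrix :: "(real^'n^'n) set \<Rightarrow> nat \<Rightarrow> (nat \<Rightarrow> nat \<Rightarrow> nat) \<Rightarrow> bool" where
  "has_coxeter_matrix W r M \<longleftrightarrow>
     (\<exists>a. inj_on a {1..r} \<and> simple_system W (a ` {1..r}) \<and>
        (\<forall>i\<in>{1..r}. \<forall>j\<in>{1..r}.
           group.ord GL (reflection_matrix (a i) ** reflection_matrix (a j)) = M i j))"

text \<open>
  The Coxeter graph of type \<open>E\<^sub>r\<close> for \<open>r = 6, 7, 8\<close>, in Bourbaki's numbering: the chain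
  1 - 3 - 4 - 5 - ... - r, with the additional vertex 2 joined to 4. All edges have label 3.
\<close>
definition E_edges :: "nat \<Rightarrow> nat set set" where
  "E_edges r = {{1, 3}, {2, 4}} \<union> {{k, k + 1} | k. 3 \<le> k \<and> k < r}"

definition type_E :: "nat \<Rightarrow> (real^'n^'n) set \<Rightarrow> bool" where
  "type_E r W \<longleftrightarrow>
     has_coxeter_matrix W r (\<lambda>i j. if i = j then 1 else if {i, j} \<in> E_edges r then 3 else 2)"


section \<open>Polynomials\<close>

text \<open>
  Complex polynomials in variables indexed by \<open>'v\<close>; a monomial is a finitely supported exponent
  function. The ring S is \<open>'n cpoly\<close>, with one variable for each coordinate of V.
\<close>
type_synonym 'v cpoly = "('v \<Rightarrow>\<^sub>0 nat) \<Rightarrow>\<^sub>0 complex"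

definition Const :: "complex \<Rightarrow> 'v cpoly" where
  "Const c = Poly_Mapping.single 0 c"

definition Var :: "'v \<Rightarrow> 'v cpoly" where
  "Var v = Poly_Mapping.single (Poly_Mapping.single v 1) 1"

definition monom_degree :: "('v \<Rightarrow>\<^sub>0 nat) \<Rightarrow> nat" where
  "monom_degree e = (\<Sum>v\<in>Poly_Mapping.keys e. Poly_Mapping.lookup e v)"

definition homogeneous :: "nat \<Rightarrow> 'v cpoly \<Rightarrow> bool" where
  "homogeneous d f \<longleftrightarrow> (\<forall>e\<in>Poly_Mapping.keys f. monom_degree e = d)"

definition substitute :: "('v \<Rightarrow> 'u cpoly) \<Rightarrow> 'v cpoly \<Rightarrow> 'u cpoly" where
  "substitute q f = (\<Sum>e\<in>Poly_Mapping.keys f. Const (Poly_Mapping.lookup f e) *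
                      (\<Prod>v\<in>Poly_Mapping.keys e. q v ^ Poly_Mapping.lookup e v))"

definition partial :: "'v \<Rightarrow> 'v cpoly \<Rightarrow> 'v cpoly" where
  "partial v f = (\<Sum>e\<in>Poly_Mapping.keys f. Poly_Mapping.single (e - Poly_Mapping.single v 1)
                                (of_nat (Poly_Mapping.lookup e v) * Poly_Mapping.lookup f e))"


section \<open>Invariants\<close>

text \<open>
  The polynomial \<open>x \<mapsto> f (A x)\<close>. This is the action of the inverse of A on f, which makes no
  difference for invariance under a group.
\<close>
definition compose_matrix :: "'n cpoly \<Rightarrow> real^'n^'n \<Rightarrow> 'n::finite cpoly" where
  "compose_matrix f A = substitute (\<lambda>i. \<Sum>j\<in>UNIV. Const (complex_of_real (A $ i $ j)) * Var j) f"

definition invariants :: "(real^'n^'n) set \<Rightarrow> 'n::finite cpoly set" where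
  "invariants W = {f. \<forall>A\<in>W. compose_matrix f A = f}"

definition cpolys_in :: "'v set \<Rightarrow> 'v cpoly set" where
  "cpolys_in I = {Q. \<forall>e\<in>Poly_Mapping.keys Q. Poly_Mapping.keys e \<subseteq> I}"

text \<open>
  The conditions on \<open>substitute p\<close> say that the invariant ring is generated by
  \<open>p 1, \<dots>, p \<ell>\<close> and that these are algebraically independent, so that it is the polynomial
  ring in them; \<open>w i\<close> is the degree of \<open>p i\<close>.
\<close>
definition basic_invariants ::
    "(real^'n^'n) set \<Rightarrow> (nat \<Rightarrow> 'n::finite cpoly) \<Rightarrow> (nat \<Rightarrow> nat) \<Rightarrow> bool" where
  "basic_invariants W p w \<longleftrightarrow>
     (\<forall>i\<in>{1..CARD('n)}. homogeneous (w i) (p i)) \<and>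
     substitute p ` cpolys_in {1..CARD('n)} = invariants W \<and>
     inj_on (substitute p) (cpolys_in {1..CARD('n)})"

definition ideal_generated :: "nat \<Rightarrow> (nat \<Rightarrow> 'v cpoly) \<Rightarrow> 'v cpoly set" where
  "ideal_generated l p = {\<Sum>i=1..l. q i * p i | q. True}"


section \<open>One-forms and vector fields\<close>

text \<open>
  The 1-form with \<open>i\<close>-th coefficient \<open>c $ i\<close> with respect to the \<open>dx\<^sub>i\<close>, and likewise the vector
  field with these coefficients with respect to the partial derivatives, is represented by its
  coefficient vector \<open>c :: 'n cpoly ^ 'n\<close>.
\<close>

definition apply_field :: "'n cpoly ^ 'n \<Rightarrow> 'n::finite cpoly \<Rightarrow> 'n cpoly" where
  "apply_field \<delta> f = (\<Sum>k\<in>UNIV. \<delta> $ k * partial k f)"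

definition dual_field :: "'n::finite cpoly \<Rightarrow> 'n cpoly ^ 'n" where
  "dual_field f = (\<chi> k. partial k f)"

definition Hess :: "'n::finite cpoly \<Rightarrow> 'n cpoly ^ 'n \<Rightarrow> 'n cpoly ^ 'n" where
  "Hess f \<delta> = (\<chi> i. apply_field \<delta> (partial i f))"

text \<open>The submodule \<open>J \<Omega>\<close> of the free module \<open>\<Omega>\<close> of 1-forms, for an ideal \<open>J\<close>.\<close>
definition ideal_times_forms :: "'n cpoly set \<Rightarrow> ('n::finite cpoly ^ 'n) set" where
  "ideal_times_forms J =
     {\<Sum>k<N. f k *s \<omega> k | (N::nat) f (\<omega> :: nat \<Rightarrow> 'n cpoly ^ 'n). \<forall>k<N. f k \<in> J}"

end

theory Submission
  imports Defs "HOL-Computational_Algebra.Fundamental_Theorem_Algebra"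
begin

text \<open>
  Let \<open>c\<close> be a Coxeter element. Bipartiteness of the Coxeter graph and a Perron-Frobenius vector give an
  eigenvector \<open>v\<close> of \<open>c\<close>, with eigenvalue \<open>\<mu>\<close>, whose stabilizer in \<open>W\<close> is trivial. Hence the order of \<open>\<mu>\<close> is
  the order \<open>h\<close> of \<open>c\<close>, and the gradients of the basic invariants at \<open>v\<close> are linearly independent, because
  symmetrization produces invariants with arbitrary gradient at \<open>v\<close>. By equivariance the entry
  \<open>\<nabla>p\<^sub>i(v) \<bullet> \<nabla>p\<^sub>j(v)\<close> of their Gram matrix is zero unless \<open>h\<close> divides \<open>m\<^sub>i + m\<^sub>j\<close>, so a nonzero term
  in the expansion of its determinant pairs the exponents such that each pair has sum at least \<open>h\<close>. On the
  other hand twice the sum of the exponents is at most the number of roots, because the Jacobian has only simple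
  zeros on a generic line, and there are at most \<open>\<ell> h\<close> roots, because each orbit of \<open>c\<close> on them contains a
  positive root that \<open>c\<close> makes negative. So all pairs have sum exactly \<open>h\<close>, which is then the largest degree.

  For a pair \<open>i, j\<close>, the components of \<open>Hess(p\<^sub>i)(\<eta>\<^sub>j)\<close> have degree \<open>h - 1\<close>, and all \<open>p\<^sub>k\<close> of degree less
  than \<open>h\<close> are zero at \<open>v\<close>. If the form were in \<open>F \<Omega>\<close>, it would be zero at \<open>v\<close>; but contracted with \<open>v\<close> it
  gives \<open>m\<^sub>i \<nabla>p\<^sub>i(v) \<bullet> \<nabla>p\<^sub>j(v)\<close> by Euler's formula.
\<close>

subsection \<open>Evaluation and substitution\<close>

text \<open>The eigenvector is \<open>v = x + \<beta> y\<close> with \<open>x\<close>,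
  \<open>y\<close> real: each pairs with the simple roots of one colour class as the
  Perron-Frobenius vector does and is orthogonal to the other class, and the bipartite Coxeter
  element preserves their span. Since \<open>\<beta>\<close> is not real, an element fixing
  \<open>v\<close> fixes \<open>x\<close> and \<open>y\<close>, hence \<open>x + y\<close>, which
  lies in the open fundamental chamber; this is why the stabilizer is trivial. The Gram matrix is
  bilinear, not Hermitian: only then do the powers of \<open>\<mu>\<close> combine to
  \<open>\<mu> ^ (m i + m j)\<close>. Its diagonal may vanish and exponents may repeat (type D of
  even rank), so degrees alone do not tell which \<open>i\<close> serves a given \<open>j\<close>; a
  nonzero term of the determinant selects one. Neither the sum of the exponents nor the number of
  roots is computed. Each is bounded only on the side needed, and the chain
  \<open>\<ell> h \<le> 2 \<Sum> m \<le> |roots| \<le> \<ell> h\<close> closes by itself.\<close>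

definition ins :: "(complex \<Rightarrow> 'r::comm_ring_1) \<Rightarrow> ('v \<Rightarrow> 'r) \<Rightarrow> 'v cpoly \<Rightarrow> 'r" where
  "ins \<phi> q f = (\<Sum>e\<in>Poly_Mapping.keys f. \<phi> (Poly_Mapping.lookup f e) *
     (\<Prod>v\<in>Poly_Mapping.keys e. q v ^ Poly_Mapping.lookup e v))"

text \<open>With \<open>\<phi>\<close> abstract the ring laws are proved once:
  \<open>\<phi> = Const\<close> gives \<open>substitute\<close>, the identity gives the value
  \<open>ev\<close> at a point.\<close>

definition coeff_hom :: "(complex \<Rightarrow> 'r::comm_ring_1) \<Rightarrow> bool" where
  "coeff_hom \<phi> \<longleftrightarrow> \<phi> 0 = 0 \<and> \<phi> 1 = 1 \<and> (\<forall>a b. \<phi> (a + b) = \<phi> a + \<phi> b) \<and> (\<forall>a b. \<phi> (a * b) = \<phi> a * \<phi> b)"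

lemma poly_mapping_add_induct [case_names zero single add]:
  assumes "P 0" and "\<And>k v. P (Poly_Mapping.single k v)" and "\<And>f g. P f \<Longrightarrow> P g \<Longrightarrow> P (f + g)"
  shows "P (f :: 'a \<Rightarrow>\<^sub>0 'b::comm_monoid_add)"
proof (induction f rule: update_induct)
  case const
  then show ?case using assms(1) .
next
  case (update f a b)
  have "Poly_Mapping.update a b f = f + Poly_Mapping.single a b"
    using update(1) by (intro poly_mapping_eqI)
      (auto simp: lookup_update lookup_add lookup_single when_def in_keys_iff)
  then show ?case using assms update by metis
qed

lemma single_exponent_eq_prod:
  "Poly_Mapping.single e (1::complex) = (\<Prod>v\<in>Poly_Mapping.keys e. Var v ^ Poly_Mapping.lookup e v)"
proof -
  have pow: "Var v ^ n = Poly_Mapping.single (Poly_Mapping.single v n) (1::complex)" for v :: 'a and n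
    by (induction n) (simp_all add: Var_def mult_single flip: single_add)
  have prod: "(\<Prod>v\<in>A. Poly_Mapping.single (g v) (1::complex)) = Poly_Mapping.single (\<Sum>v\<in>A. g v) 1"
    if "finite A" for A and g :: "'a \<Rightarrow> 'a \<Rightarrow>\<^sub>0 nat"
    using that by (induction A) (auto simp: mult_single)
  have "e = (\<Sum>v\<in>Poly_Mapping.keys e. Poly_Mapping.single v (Poly_Mapping.lookup e v))"
    by (intro poly_mapping_eqI)
      (auto simp: lookup_sum lookup_single when_def in_keys_iff sum.delta)
  then show ?thesis unfolding pow by (subst prod) auto
qed

lemma cpoly_induct [case_names Const Var add mult]:
  assumes Const: "\<And>c. P (Const c)" and Var: "\<And>v. P (Var v)"
    and add: "\<And>f g. P f \<Longrightarrow> P g \<Longrightarrow> P (f + g)" and mult: "\<And>f g. P f \<Longrightarrow> P g \<Longrightarrow> P (f * g)"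
  shows "P (f :: 'v cpoly)"
proof -
  have one: "P 1" using Const[of 1] by (simp add: Const_def)
  have pow: "P (Var v ^ n)" for v n by (induction n) (auto simp: one intro: mult Var)
  have prod: "P (\<Prod>v\<in>A. Var v ^ n v)" for A n
    by (induction A rule: infinite_finite_induct) (auto simp: one intro: mult pow)
  show ?thesis
  proof (induction f rule: poly_mapping_add_induct)
    case zero
    then show ?case using Const[of 0] by (simp add: Const_def)
  next
    case (single e c)
    have "Poly_Mapping.single e c = Const c * Poly_Mapping.single e 1"
      by (simp add: Const_def mult_single)
    then show ?case unfolding single_exponent_eq_prod by (metis Const mult prod)
  qed (rule add)
qed

lemma ins_superset:
  assumes "finite K" "Poly_Mapping.keys f \<subseteq> K" "\<phi> 0 = 0"
  shows "ins \<phi> q f = (\<Sum>e\<in>K. \<phi> (Poly_Mapping.lookup f e) *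
     (\<Prod>v\<in>Poly_Mapping.keys e. q v ^ Poly_Mapping.lookup e v))"
  unfolding ins_def using assms
  by (intro sum.mono_neutral_left) (auto simp: in_keys_iff)

lemma ins_add:
  assumes "coeff_hom \<phi>"
  shows "ins \<phi> q (f + g) = ins \<phi> q f + ins \<phi> q g"
proof -
  let ?K = "Poly_Mapping.keys f \<union> Poly_Mapping.keys g"
  have "Poly_Mapping.keys (f + g) \<subseteq> ?K" by (rule keys_add)
  then show ?thesis
    using assms by (simp add: ins_superset[of ?K] coeff_hom_def lookup_add sum.distrib distrib_right)
qed

lemma ins_single:
  assumes "coeff_hom \<phi>"
  shows "ins \<phi> q (Poly_Mapping.single e c) =
    \<phi> c * (\<Prod>v\<in>Poly_Mapping.keys e. q v ^ Poly_Mapping.lookup e v)"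
  using assms by (subst ins_superset[of "{e}"]) (auto simp: coeff_hom_def)

lemma prod_power_add:
  fixes q :: "'v \<Rightarrow> 'r::comm_ring_1"
  shows "(\<Prod>v\<in>Poly_Mapping.keys (e + e'). q v ^ Poly_Mapping.lookup (e + e') v) =
    (\<Prod>v\<in>Poly_Mapping.keys e. q v ^ Poly_Mapping.lookup e v) *
    (\<Prod>v\<in>Poly_Mapping.keys e'. q v ^ Poly_Mapping.lookup e' v)"
proof -
  let ?K = "Poly_Mapping.keys e \<union> Poly_Mapping.keys e'"
  have *: "(\<Prod>v\<in>Poly_Mapping.keys a. q v ^ Poly_Mapping.lookup a v) = (\<Prod>v\<in>?K. q v ^ Poly_Mapping.lookup a v)"
    if "Poly_Mapping.keys a \<subseteq> ?K" for a :: "'v \<Rightarrow>\<^sub>0 nat"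
    using that by (intro prod.mono_neutral_left) (auto simp: in_keys_iff)
  have "Poly_Mapping.keys (e + e') \<subseteq> ?K" by (rule keys_add)
  then show ?thesis by (simp only: *[of e] *[of e'] *[of "e + e'"] Un_upper1 Un_upper2)
      (simp add: lookup_add power_add prod.distrib)
qed

lemma ins_mult:
  assumes h: "coeff_hom \<phi>"
  shows "ins \<phi> q (f * g) = ins \<phi> q f * ins \<phi> q g"
proof (induction f rule: poly_mapping_add_induct)
  case zero
  then show ?case by (simp add: ins_def)
next
  case (add f1 f2)
  then show ?case by (simp add: ins_add[OF h] distrib_right)
next
  case (single e c)
  show ?case
  proof (induction g rule: poly_mapping_add_induct)
    case zero
    then show ?case by (simp add: ins_def)
  next
    case (add f1 f2)
    then show ?case by (simp add: ins_add[OF h] distrib_left)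
  next
    case (single e' c')
    then show ?case using h
      by (simp add: mult_single ins_single[OF h] prod_power_add coeff_hom_def algebra_simps)
  qed
qed

lemma ins_Const: "coeff_hom \<phi> \<Longrightarrow> ins \<phi> q (Const c) = \<phi> c"
  by (simp add: Const_def ins_single)

lemma ins_Var: "coeff_hom \<phi> \<Longrightarrow> ins \<phi> q (Var v) = q v"
  by (simp add: Var_def ins_single) (simp add: coeff_hom_def)

definition ev :: "'v cpoly \<Rightarrow> ('v \<Rightarrow> complex) \<Rightarrow> complex" where
  "ev f x = ins (\<lambda>c. c) x f"

lemma Const_0 [simp]: "Const 0 = 0" and Const_1 [simp]: "Const 1 = 1"
  by (simp_all add: Const_def)

lemma Const_add: "Const (a + b) = Const a + Const b"
  by (simp add: Const_def single_add)

lemma Const_mult: "Const (a * b) = Const a * Const b"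
  by (simp add: Const_def mult_single)

lemma Const_diff: "Const (a - b) = Const a - Const b"
  by (simp add: Const_def single_diff)

lemma Const_uminus: "Const (- a) = - Const a"
  using Const_diff[of 0 a] by simp

lemma Const_sum: "Const (sum f I) = (\<Sum>i\<in>I. Const (f i))"
  by (induction I rule: infinite_finite_induct) (auto simp: Const_add)

lemma coeff_hom_Const: "coeff_hom Const"
  by (simp add: coeff_hom_def Const_add Const_mult)

lemma coeff_hom_id: "coeff_hom (\<lambda>c. c)"
  by (simp add: coeff_hom_def)

lemma substitute_eq_ins: "substitute = ins Const"
  by (intro ext) (simp add: substitute_def ins_def)

lemma substitute_Const [simp]: "substitute q (Const c) = Const c"
  and substitute_Var [simp]: "substitute q (Var v) = q v"
  and substitute_add [simp]: "substitute q (f + g) = substitute q f + substitute q g"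
  and substitute_mult [simp]: "substitute q (f * g) = substitute q f * substitute q g"
  by (simp_all add: substitute_eq_ins ins_Const ins_Var ins_add ins_mult coeff_hom_Const)

lemma ev_Const [simp]: "ev (Const c) x = c"
  and ev_Var [simp]: "ev (Var v) x = x v"
  and ev_add [simp]: "ev (f + g) x = ev f x + ev g x"
  and ev_mult [simp]: "ev (f * g) x = ev f x * ev g x"
  by (simp_all add: ev_def ins_Const ins_Var ins_add ins_mult coeff_hom_id)

lemma ev_0 [simp]: "ev 0 x = 0" and ev_1 [simp]: "ev 1 x = 1"
  using ev_Const[of 0 x] ev_Const[of 1 x] by simp_all

lemma ev_numeral [simp]: "ev (numeral n) x = numeral n"
  using ev_Const[of "numeral n" x] by (simp add: Const_def)

lemma ev_uminus [simp]: "ev (- f) x = - ev f x"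
  using ev_add[of f "- f" x] by (simp add: eq_neg_iff_add_eq_0 add.commute)

lemma ev_diff [simp]: "ev (f - g) x = ev f x - ev g x"
  using ev_add[of f "- g" x] by simp

lemma ev_sum [simp]: "ev (sum f A) x = (\<Sum>a\<in>A. ev (f a) x)"
  by (induction A rule: infinite_finite_induct) auto

lemma substitute_sum [simp]: "substitute q (sum f A) = (\<Sum>a\<in>A. substitute q (f a))"
proof -
  have "substitute q 0 = 0" using substitute_Const[of q 0] by simp
  then show ?thesis by (induction A rule: infinite_finite_induct) auto
qed

lemma ev_substitute: "ev (substitute q f) x = ev f (\<lambda>v. ev (q v) x)"
  by (induction f rule: cpoly_induct) auto


subsection \<open>Partial derivatives\<close>

lemma partial_superset:
  assumes "finite K" "Poly_Mapping.keys f \<subseteq> K"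
  shows "partial v f = (\<Sum>e\<in>K. Poly_Mapping.single (e - Poly_Mapping.single v 1)
                                (of_nat (Poly_Mapping.lookup e v) * Poly_Mapping.lookup f e))"
  unfolding partial_def using assms
  by (intro sum.mono_neutral_left) (auto simp: in_keys_iff)

lemma partial_add [simp]: "partial v (f + g) = partial v f + partial v g"
proof -
  let ?K = "Poly_Mapping.keys f \<union> Poly_Mapping.keys g"
  have "Poly_Mapping.keys (f + g) \<subseteq> ?K" by (rule keys_add)
  then show ?thesis
    by (simp add: partial_superset[of ?K] lookup_add sum.distrib distrib_left single_add)
qed

lemma partial_single: "partial v (Poly_Mapping.single e c) =
    Poly_Mapping.single (e - Poly_Mapping.single v 1) (of_nat (Poly_Mapping.lookup e v) * c)"
  by (subst partial_superset[of "{e}"]) auto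

lemma partial_0 [simp]: "partial v 0 = 0"
  by (simp add: partial_def)

lemma partial_Const [simp]: "partial v (Const c) = 0"
  by (simp add: Const_def partial_single)

lemma partial_Var [simp]: "partial v (Var u) = (if u = v then 1 else 0)"
  by (simp add: Var_def partial_single lookup_single)

text \<open>Subtraction of exponents is truncated, hence the positivity assumption. In the product
  rule the terms with exponent 0 carry the coefficient 0.\<close>

lemma exponent_diff_add:
  assumes "Poly_Mapping.lookup e v > 0"
  shows "e + e' - Poly_Mapping.single v 1 = (e - Poly_Mapping.single v 1) + (e' :: 'v \<Rightarrow>\<^sub>0 nat)"
  using assms by (intro poly_mapping_eqI) (auto simp: lookup_add lookup_minus lookup_single when_def)

lemma partial_mult [simp]: "partial v (f * g) = partial v f * g + f * partial v g"
proof (induction f rule: poly_mapping_add_induct)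
  case zero
  then show ?case by simp
next
  case (add f1 f2)
  then show ?case by (simp add: algebra_simps)
next
  case (single e c)
  show ?case
  proof (induction g rule: poly_mapping_add_induct)
    case zero
    then show ?case by simp
  next
    case (add f1 f2)
    then show ?case by (simp add: algebra_simps)
  next
    case (single e' c')
    let ?d = "Poly_Mapping.single v (1::nat)"
    have 1: "Poly_Mapping.single (e - ?d) (of_nat (Poly_Mapping.lookup e v) * c) * Poly_Mapping.single e' c' =
      Poly_Mapping.single (e + e' - ?d) (of_nat (Poly_Mapping.lookup e v) * (c * c'))"
      using exponent_diff_add[of e v e']
      by (cases "Poly_Mapping.lookup e v = 0") (simp_all add: mult_single mult.assoc)
    have 2: "Poly_Mapping.single e c * Poly_Mapping.single (e' - ?d) (of_nat (Poly_Mapping.lookup e' v) * c') =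
      Poly_Mapping.single (e + e' - ?d) (of_nat (Poly_Mapping.lookup e' v) * (c * c'))"
      using exponent_diff_add[of e' v e]
      by (cases "Poly_Mapping.lookup e' v = 0") (simp_all add: mult_single add.commute mult.left_commute)
    show ?case
      unfolding partial_single mult_single[of e c e'] 1 2
      by (simp add: lookup_add distrib_right flip: single_add)
  qed
qed

lemma partial_sum [simp]: "partial v (sum f A) = (\<Sum>a\<in>A. partial v (f a))"
  by (induction A rule: infinite_finite_induct) auto

lemma partial_1 [simp]: "partial v 1 = 0"
  using partial_Const[of v 1] by simp

lemma partial_numeral [simp]: "partial v (numeral n) = 0"
  using partial_Const[of v "numeral n"] by (simp add: Const_def)

lemma partial_uminus [simp]: "partial v (- f) = - partial v f"
  using partial_add[of v f "- f"] by (simp add: eq_neg_iff_add_eq_0 add.commute)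

lemma partial_diff [simp]: "partial v (f - g) = partial v f - partial v g"
  using partial_add[of v f "- g"] by simp

lemma partial_commute: "partial u (partial v f) = partial v (partial u f)"
  by (induction f rule: cpoly_induct) (auto simp: algebra_simps)

text \<open>Ties the formal partial derivatives to limits along complex lines, on which Euler's
  formula and the first-order estimates near a zero of the Jacobian rest.\<close>

lemma has_field_derivative_ev_line:
  fixes f :: "'n::finite cpoly"
  shows "((\<lambda>t. ev f (\<lambda>i. x i + t * y i)) has_field_derivative
     (\<Sum>i\<in>UNIV. ev (partial i f) (\<lambda>i. x i + t * y i) * y i)) (at t)"
proof (induction f rule: cpoly_induct)
  case (Var v)
  have "(\<Sum>i\<in>UNIV. ev (if v = i then 1 else 0) (\<lambda>i. x i + t * y i) * y i) = y v"
    by (simp add: if_distrib[of "\<lambda>f. ev f _"] if_distrib[of "\<lambda>c. c * _"] sum.delta cong: if_cong)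
  then show ?case by (auto intro!: derivative_eq_intros)
next
  case (mult f g)
  let ?z = "\<lambda>i. x i + t * y i"
  have "(\<Sum>i\<in>UNIV. ev (partial i (f * g)) ?z * y i) =
      (\<Sum>i\<in>UNIV. ev (partial i f) ?z * y i) * ev g ?z + (\<Sum>i\<in>UNIV. ev (partial i g) ?z * y i) * ev f ?z"
    unfolding sum_distrib_right sum.distrib[symmetric] by (intro sum.cong) (simp_all add: algebra_simps)
  with DERIV_mult[OF mult] show ?case by (simp only: ev_mult)
next
  case (add f g)
  then show ?case by (auto intro!: derivative_eq_intros simp: distrib_right sum.distrib)
qed auto

lemma ex_poly_ev_line: "\<exists>P. \<forall>t. poly P t = ev f (\<lambda>i. x i + t * y i)"
proof (induction f rule: cpoly_induct)
  case (Const c)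
  show ?case by (rule exI[of _ "[:c:]"]) auto
next
  case (Var v)
  show ?case by (rule exI[of _ "[:x v, y v:]"]) auto
next
  case (add f g)
  then obtain P Q where "\<forall>t. poly P t = ev f (\<lambda>i. x i + t * y i)" "\<forall>t. poly Q t = ev g (\<lambda>i. x i + t * y i)" by blast
  then show ?case by (intro exI[of _ "P + Q"]) simp
next
  case (mult f g)
  then obtain P Q where "\<forall>t. poly P t = ev f (\<lambda>i. x i + t * y i)" "\<forall>t. poly Q t = ev g (\<lambda>i. x i + t * y i)" by blast
  then show ?case by (intro exI[of _ "P * Q"]) simp
qed


subsection \<open>Homogeneous polynomials\<close>

lemma monom_degree_superset:
  assumes "finite K" "Poly_Mapping.keys e \<subseteq> K"
  shows "monom_degree e = (\<Sum>v\<in>K. Poly_Mapping.lookup e v)"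
  unfolding monom_degree_def using assms
  by (intro sum.mono_neutral_left) (auto simp: in_keys_iff)

lemma ev_homogeneous:
  assumes "homogeneous d f"
  shows "ev f (\<lambda>i. t * x i) = t ^ d * ev f x"
proof -
  have "(\<Prod>v\<in>Poly_Mapping.keys e. (t * x v) ^ Poly_Mapping.lookup e v) =
     t ^ d * (\<Prod>v\<in>Poly_Mapping.keys e. x v ^ Poly_Mapping.lookup e v)"
    if "e \<in> Poly_Mapping.keys f" for e
    using assms that by (auto simp: homogeneous_def monom_degree_def power_mult_distrib prod.distrib power_sum)
  then show ?thesis by (simp add: ev_def ins_def sum_distrib_left mult_ac)
qed

text \<open>The truncated \<open>d - 1\<close> does no harm at \<open>d = 0\<close>: the derivative
  then has no monomials.\<close>

lemma homogeneous_partial: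
  assumes "homogeneous d f"
  shows "homogeneous (d - 1) (partial v f)"
  unfolding homogeneous_def
proof
  fix e assume "e \<in> Poly_Mapping.keys (partial v f)"
  then have "Poly_Mapping.lookup (partial v f) e \<noteq> 0" by (simp add: in_keys_iff)
  then obtain e0 where e0: "e0 \<in> Poly_Mapping.keys f" "e = e0 - Poly_Mapping.single v 1"
      "Poly_Mapping.lookup e0 v \<noteq> 0"
    unfolding partial_def lookup_sum
    by (auto elim!: sum.not_neutral_contains_not_neutral simp: lookup_single when_def split: if_splits)
  let ?K = "Poly_Mapping.keys e0"
  have v: "v \<in> ?K" using e0(3) by (simp add: in_keys_iff)
  have "Poly_Mapping.keys e \<subseteq> ?K"
    by (auto simp: e0(2) in_keys_iff lookup_minus)
  then have "monom_degree e = (\<Sum>u\<in>?K. Poly_Mapping.lookup e u)"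
    by (intro monom_degree_superset) auto
  also have "\<dots> = Poly_Mapping.lookup e v + (\<Sum>u\<in>?K - {v}. Poly_Mapping.lookup e u)"
    using v by (simp add: sum.remove)
  also have "(\<Sum>u\<in>?K - {v}. Poly_Mapping.lookup e u) = (\<Sum>u\<in>?K - {v}. Poly_Mapping.lookup e0 u)"
    by (intro sum.cong) (auto simp: e0(2) lookup_minus lookup_single)
  also have "Poly_Mapping.lookup e v = Poly_Mapping.lookup e0 v - 1"
    by (simp add: e0(2) lookup_minus)
  also have "Poly_Mapping.lookup e0 v - 1 + (\<Sum>u\<in>?K - {v}. Poly_Mapping.lookup e0 u) =
     (\<Sum>u\<in>?K. Poly_Mapping.lookup e0 u) - 1"
    using v e0(3) by (simp add: sum.remove)
  also have "(\<Sum>u\<in>?K. Poly_Mapping.lookup e0 u) = d"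
    using assms e0(1) by (simp add: homogeneous_def monom_degree_def)
  finally show "monom_degree e = d - 1" .
qed

text \<open>Both sides are the derivative of \<open>f (t x) = t ^ d * f x\<close> at
  \<open>t = 1\<close>.\<close>

lemma euler_homogeneous:
  fixes f :: "'n::finite cpoly"
  assumes "homogeneous d f"
  shows "(\<Sum>i\<in>UNIV. x i * ev (partial i f) x) = of_nat d * ev f x"
proof -
  have "((\<lambda>t. ev f (\<lambda>i. 0 + t * x i)) has_field_derivative
     (\<Sum>i\<in>UNIV. ev (partial i f) (\<lambda>i. 0 + 1 * x i) * x i)) (at 1)"
    by (rule has_field_derivative_ev_line)
  moreover have "((\<lambda>t. t ^ d * ev f x) has_field_derivative of_nat d * ev f x) (at 1)"
    by (auto intro!: derivative_eq_intros)
  ultimately show ?thesis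
    by (simp add: ev_homogeneous[OF assms] DERIV_unique mult.commute)
qed


subsection \<open>Order of vanishing at a point\<close>

text \<open>All partial derivatives of order less than \<open>k\<close> are zero at
  \<open>u\<close>, that is, \<open>f\<close> lies in the \<open>k\<close>-th power of the maximal
  ideal of \<open>u\<close>. The recursion avoids Taylor expansions.\<close>

primrec vanishes :: "nat \<Rightarrow> 'n cpoly \<Rightarrow> ('n \<Rightarrow> complex) \<Rightarrow> bool" where
  "vanishes 0 f u \<longleftrightarrow> True"
| "vanishes (Suc k) f u \<longleftrightarrow> ev f u = 0 \<and> (\<forall>i. vanishes k (partial i f) u)"

lemma vanishes_Suc: "vanishes (Suc k) f u \<Longrightarrow> vanishes k f u"
  by (induction k arbitrary: f) auto

lemma vanishes_0 [simp]: "vanishes k 0 u"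
  by (induction k) auto

lemma vanishes_add: "vanishes k f u \<Longrightarrow> vanishes k g u \<Longrightarrow> vanishes k (f + g) u"
  by (induction k arbitrary: f g) auto

lemma vanishes_sum: "(\<And>a. a \<in> A \<Longrightarrow> vanishes k (f a) u) \<Longrightarrow> vanishes k (sum f A) u"
  by (induction A rule: infinite_finite_induct) (auto intro: vanishes_add)

lemma vanishes_mult: "vanishes j f u \<Longrightarrow> vanishes k g u \<Longrightarrow> vanishes (j + k) (f * g) u"
proof (induction "j + k" arbitrary: j k f g)
  case 0
  then show ?case by simp
next
  case (Suc n)
  have "ev (f * g) u = 0" using Suc by (cases j; cases k) auto
  \<comment> \<open>This Leibniz term loses one order of \<open>f\<close>; if \<open>f\<close> has
    none to lose (\<open>j = 0\<close>), one order of \<open>g\<close> is given up instead, so that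
    the total is again \<open>n\<close>.\<close>
  moreover have "vanishes n (partial i f * g) u" for i
  proof (cases j)
    case 0
    obtain k' where k: "k = Suc k'" using Suc 0 by (cases k) auto
    then show ?thesis
      using Suc(1)[of 0 k' "partial i f" g] Suc(2,4) 0 vanishes_Suc by auto
  next
    case (Suc j')
    then show ?thesis using Suc.hyps(1)[of j' k "partial i f" g] Suc.hyps(2) Suc.prems by auto
  qed
  moreover have "vanishes n (f * partial i g) u" for i
  proof (cases k)
    case 0
    obtain j' where k: "j = Suc j'" using Suc 0 by (cases j) auto
    then show ?thesis
      using Suc(1)[of j' 0 f "partial i g"] Suc(2,3) 0 vanishes_Suc by auto
  next
    case (Suc k')
    then show ?thesis using Suc.hyps(1)[of j k' f "partial i g"] Suc.hyps(2) Suc.prems by auto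
  qed
  ultimately show ?case unfolding Suc(2)[symmetric] by (auto intro: vanishes_add)
qed

lemma vanishes_mult_left: "vanishes k g u \<Longrightarrow> vanishes k (f * g) u"
  using vanishes_mult[of 0 f u k g] by simp

lemma vanishes_mult_right: "vanishes k g u \<Longrightarrow> vanishes k (g * f) u"
  using vanishes_mult[of k g u 0 f] by simp

lemma vanishes_power3: "ev f u = 0 \<Longrightarrow> vanishes 3 (f * f * f) u"
  using vanishes_mult[of 2 "f * f" u 1 f] vanishes_mult[of 1 f u 1 f]
  by (simp add: numeral_2_eq_2 numeral_3_eq_3)

text \<open>Cubes of linear functions that separate \<open>v\<close> from the points of
  \<open>B\<close> multiply to some \<open>e\<close> with value 1 at \<open>v\<close>. Then
  \<open>1 + (e - 1)^3\<close> is 1 to third order at \<open>v\<close> and is divisible by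
  \<open>e\<close>. Order 3 keeps second derivatives, which \<open>jac_simple_zero\<close>
  needs.\<close>

lemma ex_bump:
  fixes v :: "'n::finite \<Rightarrow> complex"
  assumes "finite B" "v \<notin> B"
  shows "\<exists>E. vanishes 3 (E - 1) v \<and> (\<forall>u\<in>B. vanishes 3 E u)"
proof -
  have "\<exists>e. ev e v = 1 \<and> (\<forall>u\<in>B. vanishes 3 e u)"
    using assms
  proof (induction B)
    case empty
    show ?case by (rule exI[of _ 1]) auto
  next
    case (insert u B)
    then obtain e where e: "ev e v = 1" "\<forall>u\<in>B. vanishes 3 e u" by auto
    from insert have "u \<noteq> v" by auto
    then obtain i where i: "u i \<noteq> v i" by (auto simp: fun_eq_iff)
    define l where "l = Const (1 / (v i - u i)) * (Var i - Const (u i))"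
    have "ev l u = 0" "ev l v = 1" using i by (auto simp: l_def)
    then show ?case using e
      by (intro exI[of _ "e * (l * l * l)"])
        (auto intro: vanishes_power3 vanishes_mult_left vanishes_mult_right)
  qed
  then obtain e where e: "ev e v = 1" "\<And>u. u \<in> B \<Longrightarrow> vanishes 3 e u" by blast
  define a where "a = e - 1"
  have "vanishes 3 (a * a * a) v" using e by (intro vanishes_power3) (simp add: a_def)
  moreover have "vanishes 3 (1 + a * a * a) u" if "u \<in> B" for u
  proof -
    have "1 + a * a * a = e * (a * a - a + 1)" by (simp add: a_def algebra_simps)
    then show ?thesis using vanishes_mult_right[OF e(2)[OF that]] by simp
  qed
  ultimately show ?thesis by (intro exI[of _ "1 + a * a * a"]) auto
qed

lemma tendsto_vanishes_quotient:
  fixes f :: "'n::finite cpoly"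
  assumes "vanishes 2 f x"
  shows "((\<lambda>t. ev f (\<lambda>i. x i + t * y i) / t) \<longlongrightarrow> 0) (at 0)"
proof -
  have "((\<lambda>t. ev f (\<lambda>i. x i + t * y i)) has_field_derivative 0) (at 0)"
    using has_field_derivative_ev_line[of f x y 0] assms by (simp add: numeral_2_eq_2)
  then show ?thesis using assms by (simp add: has_field_derivative_iff numeral_2_eq_2)
qed


subsection \<open>Finite real reflection groups\<close>

lemma reflection_matrix_mult:
  "reflection_matrix a *v x = x - (2 * (x \<bullet> a) / (a \<bullet> a)) *\<^sub>R a"
proof -
  have "linear (\<lambda>x. x - (2 * (x \<bullet> a) / (a \<bullet> a)) *\<^sub>R a)"
    by (rule linearI) (auto simp: inner_add_left algebra_simps add_divide_distrib)
  then show ?thesis unfolding reflection_matrix_def by (simp add: matrix_works)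
qed

lemma reflection_matrix_scale: "c \<noteq> 0 \<Longrightarrow> reflection_matrix (c *\<^sub>R a) = reflection_matrix a"
  unfolding matrix_eq reflection_matrix_mult by (auto simp: field_simps)

lemma reflection_matrix_unit:
  "norm a = 1 \<Longrightarrow> reflection_matrix a *v x = x - (2 * (x \<bullet> a)) *\<^sub>R a"
  by (simp add: reflection_matrix_mult flip: power2_norm_eq_inner)

lemma inner_reflection_matrix:
  assumes "norm a = 1"
  shows "(reflection_matrix a *v x) \<bullet> (reflection_matrix a *v y) = x \<bullet> y"
  using assms by (simp add: reflection_matrix_unit inner_diff_left inner_diff_right inner_commute
      algebra_simps norm_eq_1)

lemma reflection_matrix_involution:
  assumes "norm a = 1"
  shows "reflection_matrix a ** reflection_matrix a = mat 1"
proof -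
  have "(x - (2 * (x \<bullet> a)) *\<^sub>R a) \<bullet> a = - (x \<bullet> a)" for x
    using assms by (simp add: inner_diff_left norm_eq_1)
  then show ?thesis unfolding matrix_eq matrix_vector_mul_assoc[symmetric]
    using assms by (simp add: reflection_matrix_unit)
qed

lemma group_GL: "group (GL :: (real^'n^'n) monoid)"
proof (rule groupI)
  fix A B C :: "real^'n^'n"
  show "A \<in> carrier GL \<Longrightarrow> B \<in> carrier GL \<Longrightarrow> A \<otimes>\<^bsub>GL\<^esub> B \<in> carrier GL"
    by (simp add: GL_def invertible_mult)
  show "\<one>\<^bsub>GL\<^esub> \<in> carrier (GL :: (real^'n^'n) monoid)"
    unfolding GL_def invertible_def by (auto intro: exI[of _ "mat 1"])
  show "A \<in> carrier GL \<Longrightarrow> \<exists>B\<in>carrier GL. B \<otimes>\<^bsub>GL\<^esub> A = \<one>\<^bsub>GL\<^esub>"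
    by (auto simp: GL_def invertible_def)
qed (auto simp: GL_def matrix_mul_assoc)

definition rprod :: "(real^'n) list \<Rightarrow> real^'n^'n" where
  "rprod as = foldr (\<lambda>a M. reflection_matrix a ** M) as (mat 1)"

lemma rprod_Nil [simp]: "rprod [] = mat 1"
  and rprod_Cons [simp]: "rprod (a # as) = reflection_matrix a ** rprod as"
  by (simp_all add: rprod_def)

lemma rprod_append [simp]: "rprod (as @ bs) = rprod as ** rprod bs"
  by (induction as) (simp_all add: matrix_mul_assoc)

lemma rprod_rev: "\<forall>a\<in>set as. norm a = 1 \<Longrightarrow> rprod (rev as) ** rprod as = mat 1"
proof (induction as)
  case (Cons a as)
  have "rprod (rev (a # as)) ** rprod (a # as) =
     rprod (rev as) ** (reflection_matrix a ** reflection_matrix a) ** rprod as"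
    by (simp add: matrix_mul_assoc)
  then show ?case using Cons by (simp add: reflection_matrix_involution)
qed auto

locale refl_group =
  fixes W :: "(real^'n^'n) set"
  assumes subgroup: "subgroup W GL" and finite_W: "finite W" and generated: "W = generate GL (reflections W)"
begin

lemma one_W: "mat 1 \<in> W"
  using subgroup.one_closed[OF subgroup] by (simp add: GL_def)

lemma mult_W: "A \<in> W \<Longrightarrow> B \<in> W \<Longrightarrow> A ** B \<in> W"
  using subgroup.m_closed[OF subgroup] by (simp add: GL_def)

lemma inverse_W:
  assumes "A \<in> W"
  obtains B where "B \<in> W" "B ** A = mat 1" "A ** B = mat 1"
proof -
  have "inv\<^bsub>GL\<^esub> A \<in> W" using subgroup.m_inv_closed[OF subgroup assms] .
  moreover have "A \<in> carrier GL" using subgroup.mem_carrier[OF subgroup assms] .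
  then have "inv\<^bsub>GL\<^esub> A \<otimes>\<^bsub>GL\<^esub> A = \<one>\<^bsub>GL\<^esub>" "A \<otimes>\<^bsub>GL\<^esub> inv\<^bsub>GL\<^esub> A = \<one>\<^bsub>GL\<^esub>"
    using group.l_inv[OF group_GL] group.r_inv[OF group_GL] by blast+
  ultimately show thesis using that[of "inv\<^bsub>GL\<^esub> A"] by (simp add: GL_def)
qed

lemma root_norm: "a \<in> roots W \<Longrightarrow> norm a = 1"
  and root_reflection: "a \<in> roots W \<Longrightarrow> reflection_matrix a \<in> W"
  by (auto simp: roots_def)

lemma root_mult: "a \<in> roots W \<Longrightarrow> reflection_matrix a *v x = x - (2 * (x \<bullet> a)) *\<^sub>R a"
  by (simp add: reflection_matrix_unit root_norm)

lemma root_inner: "a \<in> roots W \<Longrightarrow> a \<bullet> a = 1"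
  using root_norm norm_eq_1 by blast

lemma root_nonzero: "a \<in> roots W \<Longrightarrow> a \<noteq> 0"
  using root_norm by fastforce

lemma root_uminus: "a \<in> roots W \<Longrightarrow> - a \<in> roots W"
  using reflection_matrix_scale[of "-1" a] by (simp add: roots_def)

lemma rprod_W: "set as \<subseteq> roots W \<Longrightarrow> rprod as \<in> W"
  by (induction as) (auto intro: one_W mult_W root_reflection)

lemma W_rprod:
  assumes "A \<in> W"
  obtains as where "set as \<subseteq> roots W" "A = rprod as"
proof -
  have refl: "\<exists>a\<in>roots W. s = reflection_matrix a" if "s \<in> reflections W" for s
  proof -
    from that obtain a where a: "s \<in> W" "a \<noteq> 0" "s = reflection_matrix a"
      by (auto simp: reflections_def)
    let ?b = "(1 / norm a) *\<^sub>R a"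
    have "s = reflection_matrix ?b" using a reflection_matrix_scale[of "1 / norm a" a] by simp
    then show ?thesis using a by (intro bexI[of _ ?b]) (auto simp: roots_def)
  qed
  have "A \<in> generate GL (reflections W)" using assms generated by simp
  then have "\<exists>as. set as \<subseteq> roots W \<and> A = rprod as"
  proof (induction rule: generate.induct)
    case one
    show ?case by (rule exI[of _ "[]"]) (simp add: GL_def)
  next
    case (incl h)
    then obtain a where "a \<in> roots W" "h = reflection_matrix a" using refl by auto
    then show ?case by (intro exI[of _ "[a]"]) auto
  next
    case (inv h)
    then obtain a where a: "a \<in> roots W" "h = reflection_matrix a" using refl by auto
    have "h \<in> carrier GL" using inv subgroup.mem_carrier[OF subgroup] by (auto simp: reflections_def)
    moreover have "h \<otimes>\<^bsub>GL\<^esub> h = \<one>\<^bsub>GL\<^esub>"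
      using a by (simp add: GL_def reflection_matrix_involution root_norm)
    ultimately have "inv\<^bsub>GL\<^esub> h = h" using group.inv_equality[OF group_GL] by blast
    then show ?case using a by (intro exI[of _ "[a]"]) auto
  next
    case (eng h1 h2)
    then obtain as bs where "set as \<subseteq> roots W" "h1 = rprod as" "set bs \<subseteq> roots W" "h2 = rprod bs" by blast
    then show ?case by (intro exI[of _ "as @ bs"]) (auto simp: GL_def)
  qed
  then show thesis using that by blast
qed

lemma W_orthogonal:
  assumes "A \<in> W"
  shows "(A *v x) \<bullet> (A *v y) = x \<bullet> y"
proof -
  obtain as where "set as \<subseteq> roots W" "A = rprod as" using W_rprod[OF assms] .
  then show ?thesis
    by (induction as arbitrary: A) (auto simp: inner_reflection_matrix root_norm simp flip: matrix_vector_mul_assoc)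
qed

text \<open>The conjugation formula, written without an inverse so that words can be rewritten with
  it.\<close>

lemma root_reflection_conjugate:
  assumes "A \<in> W" "a \<in> roots W"
  shows "reflection_matrix (A *v a) ** A = A ** reflection_matrix a"
proof -
  have "norm (A *v a) = 1" using W_orthogonal[OF assms(1), of a a] root_inner[OF assms(2)] by (simp add: norm_eq_1)
  then show ?thesis
    unfolding matrix_eq matrix_vector_mul_assoc[symmetric]
    by (simp add: reflection_matrix_unit root_norm assms W_orthogonal matrix_vector_mult_diff_distrib
        matrix_vector_mult_scaleR)
qed

lemma root_image:
  assumes "A \<in> W" "a \<in> roots W"
  shows "A *v a \<in> roots W"
proof -
  obtain B where B: "B \<in> W" "B ** A = mat 1" "A ** B = mat 1" using inverse_W[OF assms(1)] .
  have "reflection_matrix (A *v a) = reflection_matrix (A *v a) ** (A ** B)" by (simp add: B)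
  also have "\<dots> = A ** reflection_matrix a ** B"
    by (simp add: matrix_mul_assoc root_reflection_conjugate assms)
  finally have "reflection_matrix (A *v a) \<in> W" using assms B by (auto intro: mult_W root_reflection)
  moreover have "norm (A *v a) = 1"
    using W_orthogonal[OF assms(1), of a a] root_inner[OF assms(2)] by (simp add: norm_eq_1)
  ultimately show ?thesis by (simp add: roots_def)
qed

lemma proportional_roots:
  assumes "a \<in> roots W" "b \<in> roots W" "b = c *\<^sub>R a"
  shows "b = a \<or> b = - a"
proof -
  have "\<bar>c\<bar> = 1" using assms root_norm[of a] root_norm[of b] by simp
  then show ?thesis using assms by (auto simp: abs_if split: if_splits)
qed

lemma same_reflection:
  assumes "a \<in> roots W" "b \<in> roots W" "reflection_matrix a = reflection_matrix b"
  shows "b = a \<or> b = - a"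
proof -
  have "reflection_matrix a *v b = reflection_matrix b *v b" by (simp only: assms(3))
  then have "(2 * (b \<bullet> a)) *\<^sub>R a = 2 *\<^sub>R b" using assms(1,2) by (simp add: root_mult root_inner)
  then have "(1 / 2) *\<^sub>R (2 *\<^sub>R b) = (1 / 2) *\<^sub>R ((2 * (b \<bullet> a)) *\<^sub>R a)" by (simp only:)
  then have "b = (b \<bullet> a) *\<^sub>R a" by simp
  then show ?thesis using proportional_roots assms by blast
qed

text \<open>Each of the finitely many reflections in \<open>W\<close> has only two unit
  normals.\<close>

lemma finite_roots: "finite (roots W)"
proof -
  have "finite {a \<in> roots W. reflection_matrix a = s}" for s
  proof (cases "\<exists>a0\<in>roots W. reflection_matrix a0 = s")
    case True
    then obtain a0 where "a0 \<in> roots W" "reflection_matrix a0 = s" by blast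
    then have "{a \<in> roots W. reflection_matrix a = s} \<subseteq> {a0, - a0}" using same_reflection[of a0] by (simp add: subset_iff)
    then show ?thesis using finite_subset by blast
  next
    case False
    then have "{a \<in> roots W. reflection_matrix a = s} = {}" by blast
    then show ?thesis by (simp only: finite.emptyI)
  qed
  then have "finite (\<Union>s\<in>W. {a \<in> roots W. reflection_matrix a = s})" using finite_W by blast
  moreover have "roots W \<subseteq> (\<Union>s\<in>W. {a \<in> roots W. reflection_matrix a = s})" using root_reflection by blast
  ultimately show ?thesis using finite_subset by blast
qed

end


subsection \<open>Simple roots\<close>

definition cone_of :: "'a::real_vector set \<Rightarrow> 'a set" where
  "cone_of D = {\<Sum>d\<in>D. c d *\<^sub>R d | c. \<forall>d\<in>D. (c d :: real) \<ge> 0}"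

lemma cone_of_add: "x \<in> cone_of D \<Longrightarrow> y \<in> cone_of D \<Longrightarrow> x + y \<in> cone_of D"
  unfolding cone_of_def
proof safe
  fix c c' assume "\<forall>d\<in>D. (c d::real) \<ge> 0" "\<forall>d\<in>D. (c' d::real) \<ge> 0"
  then show "\<exists>c''. (\<Sum>d\<in>D. c d *\<^sub>R d) + (\<Sum>d\<in>D. c' d *\<^sub>R d) = (\<Sum>d\<in>D. c'' d *\<^sub>R d) \<and> (\<forall>d\<in>D. 0 \<le> c'' d)"
    by (intro exI[of _ "\<lambda>d. c d + c' d"]) (auto simp: scaleR_add_left sum.distrib)
qed

lemma cone_of_scale: "x \<in> cone_of D \<Longrightarrow> t \<ge> 0 \<Longrightarrow> t *\<^sub>R x \<in> cone_of D"
  unfolding cone_of_def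
proof safe
  fix c assume "\<forall>d\<in>D. (c d::real) \<ge> 0" "t \<ge> 0"
  then show "\<exists>c'. t *\<^sub>R (\<Sum>d\<in>D. c d *\<^sub>R d) = (\<Sum>d\<in>D. c' d *\<^sub>R d) \<and> (\<forall>d\<in>D. 0 \<le> c' d)"
    by (intro exI[of _ "\<lambda>d. t * c d"]) (auto simp: scaleR_sum_right)
qed

lemma cone_of_sum:
  "(\<And>i. i \<in> I \<Longrightarrow> f i \<in> cone_of D) \<Longrightarrow> sum f I \<in> cone_of D"
proof (induction I rule: infinite_finite_induct)
  case (insert i I)
  then show ?case by (auto intro: cone_of_add)
qed (auto simp: cone_of_def intro!: exI[of _ "\<lambda>_. 0"])

lemma cone_of_base: "finite D \<Longrightarrow> a \<in> D \<Longrightarrow> a \<in> cone_of D"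
  unfolding cone_of_def
  by (auto intro!: exI[of _ "\<lambda>d. if d = a then 1 else 0"] simp: if_distrib[of "\<lambda>c. c *\<^sub>R _"] cong: if_cong)

lemma cone_of_trans: "C \<subseteq> cone_of D \<Longrightarrow> cone_of C \<subseteq> cone_of D"
proof
  fix x assume C: "C \<subseteq> cone_of D" and "x \<in> cone_of C"
  then obtain c where "\<forall>d\<in>C. c d \<ge> 0" "x = (\<Sum>d\<in>C. c d *\<^sub>R d)" by (auto simp: cone_of_def)
  then show "x \<in> cone_of D" using C by (auto intro!: cone_of_sum cone_of_scale)
qed

context refl_group
begin

definition pos :: "real^'n \<Rightarrow> (real^'n) set" where
  "pos z = {a \<in> roots W. a \<bullet> z > 0}"

end

text \<open>Positivity is measured by a generic vector \<open>z\<close>, which may be chosen to suit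
  the application. Independence is stated through coefficients because expansions in
  \<open>D\<close> are compared that way.\<close>

locale simple_roots = refl_group W for W :: "(real^'n^'n) set" +
  fixes z :: "real^'n" and D :: "(real^'n) set"
  assumes generic: "a \<in> roots W \<Longrightarrow> a \<bullet> z \<noteq> 0"
    and D_pos: "D \<subseteq> pos z"
    and pos_cone: "pos z \<subseteq> cone_of D"
    and obtuse: "a \<in> D \<Longrightarrow> b \<in> D \<Longrightarrow> a \<noteq> b \<Longrightarrow> a \<bullet> b \<le> 0"
    and indep: "(\<Sum>d\<in>D. c d *\<^sub>R d) = 0 \<Longrightarrow> d \<in> D \<Longrightarrow> c d = 0"

context refl_group
begin

text \<open>\<open>D\<close> is a smallest set of positive roots whose cone contains all positive
  roots. Minimality forces obtuse angles, and vectors with obtuse angles in an open half-space are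
  independent.\<close>

lemma ex_simple_roots:
  assumes generic: "\<And>a. a \<in> roots W \<Longrightarrow> a \<bullet> z \<noteq> 0"
  obtains D where "simple_roots W z D"
proof -
  have fin: "finite (pos z)" unfolding pos_def using finite_roots by auto
  define D where "D = (ARG_MIN card D. D \<subseteq> pos z \<and> pos z \<subseteq> cone_of D)"
  have "pos z \<subseteq> pos z \<and> pos z \<subseteq> cone_of (pos z)" using cone_of_base[OF fin] by auto
  then have D: "D \<subseteq> pos z" "pos z \<subseteq> cone_of D"
    and min: "\<And>D'. D' \<subseteq> pos z \<Longrightarrow> pos z \<subseteq> cone_of D' \<Longrightarrow> card D \<le> card D'"
    using arg_min_nat_lemma[of "\<lambda>D. D \<subseteq> pos z \<and> pos z \<subseteq> cone_of D" "pos z" card] unfolding D_def by blast+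
  have finD: "finite D" using D fin finite_subset by blast
  have Dz: "d \<bullet> z > 0" if "d \<in> D" for d using D that by (auto simp: pos_def)
  have Droot: "d \<in> roots W" if "d \<in> D" for d using D that by (auto simp: pos_def)
  \<comment> \<open>Pairing with \<open>z\<close> shows \<open>c b < 1\<close>; so \<open>b\<close>
    can be solved for in terms of the other elements, and \<open>D - {b}\<close> would be a smaller
    choice.\<close>
  have irredundant: False
    if b: "b \<in> D" "b = (\<Sum>d\<in>D. c d *\<^sub>R d)" and a: "a \<in> D" "a \<noteq> b" "c a > 0" and c: "\<forall>d\<in>D. c d \<ge> 0" for a b c
  proof -
    have eq: "(1 - c b) *\<^sub>R b = (\<Sum>d\<in>D-{b}. c d *\<^sub>R d)"
      using b finD by (subst (asm) sum.remove[of D b]) (auto simp: algebra_simps)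
    have "(\<Sum>d\<in>D-{b}. c d *\<^sub>R d) \<bullet> z > 0"
      unfolding inner_sum_left using finD a c Dz
      by (intro sum_pos2[of _ a]) (auto intro: mult_nonneg_nonneg less_imp_le)
    then have "(1 - c b) * (b \<bullet> z) > 0" by (simp flip: eq)
    then have cb: "1 - c b > 0" using Dz[OF b(1)] zero_less_mult_pos2 by blast
    have "(\<Sum>d\<in>D-{b}. c d *\<^sub>R d) \<in> cone_of (D - {b})" using c by (auto simp: cone_of_def)
    then have "(1 / (1 - c b)) *\<^sub>R ((1 - c b) *\<^sub>R b) \<in> cone_of (D - {b})"
      unfolding eq using cb by (intro cone_of_scale) auto
    then have "b \<in> cone_of (D - {b})" using cb by simp
    then have "D \<subseteq> cone_of (D - {b})" using cone_of_base[of "D - {b}"] finD by auto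
    then have "cone_of D \<subseteq> cone_of (D - {b})" by (rule cone_of_trans)
    then have "card D \<le> card (D - {b})" using D by (intro min) auto
    then show False using b finD card_gt_0_iff[of D] by (auto simp: card_Diff_singleton)
  qed
  have obt: "a \<bullet> b \<le> 0" if ab: "a \<in> D" "b \<in> D" "a \<noteq> b" for a b
  proof (rule ccontr)
    assume "\<not> a \<bullet> b \<le> 0"
    then have pos: "a \<bullet> b > 0" by simp
    \<comment> \<open>One of \<open>r\<close> and \<open>- r\<close> is positive. Expanding it in
      \<open>D\<close>, either \<open>b = r + 2 (a \<bullet> b) a\<close> makes \<open>b\<close>
      redundant, or \<open>2 (a \<bullet> b) a = - r + b\<close> makes \<open>a\<close>
      redundant.\<close>
    define r where "r = reflection_matrix a *v b"
    have r: "r = b - (2 * (a \<bullet> b)) *\<^sub>R a" using Droot ab by (simp add: r_def root_mult inner_commute)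
    have "r \<in> roots W" unfolding r_def using Droot ab by (intro root_image root_reflection) auto
    then consider "r \<in> pos z" | "- r \<in> pos z" using generic[of r] root_uminus[of r] by (force simp: pos_def)
    then show False
    proof cases
      case 1
      then obtain c where c: "\<forall>d\<in>D. c d \<ge> 0" "r = (\<Sum>d\<in>D. c d *\<^sub>R d)" using D by (auto simp: cone_of_def)
      have "b = r + (\<Sum>d\<in>D. (if d = a then 2 * (a \<bullet> b) else 0) *\<^sub>R d)"
        using ab finD by (simp add: r if_distrib[of "\<lambda>c. c *\<^sub>R _"] cong: if_cong)
      also have "\<dots> = (\<Sum>d\<in>D. (c d + (if d = a then 2 * (a \<bullet> b) else 0)) *\<^sub>R d)"
        by (simp add: c scaleR_add_left sum.distrib)
      finally show False using ab pos c
        by (intro irredundant[of b "\<lambda>d. c d + (if d = a then 2 * (a \<bullet> b) else 0)" a]) (auto intro: add_nonneg_pos)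
    next
      case 2
      then obtain c where c: "\<forall>d\<in>D. c d \<ge> 0" "- r = (\<Sum>d\<in>D. c d *\<^sub>R d)" using D by (auto simp: cone_of_def)
      have "a = (1 / (2 * (a \<bullet> b))) *\<^sub>R (- r + b)" using pos by (simp add: r)
      also have "- r + b = - r + (\<Sum>d\<in>D. (if d = b then 1 else 0) *\<^sub>R d)"
        using ab finD by (simp add: if_distrib[of "\<lambda>c. c *\<^sub>R _"] cong: if_cong)
      also have "\<dots> = (\<Sum>d\<in>D. (c d + (if d = b then 1 else 0)) *\<^sub>R d)"
        by (simp add: c scaleR_add_left sum.distrib)
      also have "(1 / (2 * (a \<bullet> b))) *\<^sub>R \<dots> = (\<Sum>d\<in>D. ((1 / (2 * (a \<bullet> b))) * (c d + (if d = b then 1 else 0))) *\<^sub>R d)"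
        by (simp add: scaleR_sum_right)
      finally show False using ab pos c
        by (intro irredundant[of a "\<lambda>d. (1 / (2 * (a \<bullet> b))) * (c d + (if d = b then 1 else 0))" b])
          (auto intro!: mult_pos_pos mult_nonneg_nonneg add_nonneg_pos simp del: times_divide_eq_left)
    qed
  qed
  \<comment> \<open>Splitting by sign writes one vector \<open>v\<close> as a combination over
    \<open>P\<close> and over \<open>N\<close>. Obtuseness gives
    \<open>v \<bullet> v \<le> 0\<close>, so \<open>v = 0\<close>, and pairing with \<open>z\<close>
    then leaves no term in either set.\<close>
  have ind: "c d = 0" if sum0: "(\<Sum>d\<in>D. c d *\<^sub>R d) = 0" and d: "d \<in> D" for c d
  proof -
    define P where "P = {d\<in>D. c d > 0}"
    define N where "N = {d\<in>D. c d < 0}"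
    define v where "v = (\<Sum>d\<in>P. c d *\<^sub>R d)"
    have fin: "finite P" "finite N" using finD by (auto simp: P_def N_def)
    have "(\<Sum>d\<in>D. c d *\<^sub>R d) = (\<Sum>d\<in>P \<union> N. c d *\<^sub>R d)"
      using finD by (intro sum.mono_neutral_right) (auto simp: P_def N_def)
    also have "\<dots> = v + (\<Sum>d\<in>N. c d *\<^sub>R d)"
      unfolding v_def using fin by (intro sum.union_disjoint) (auto simp: P_def N_def)
    finally have vN: "v = - (\<Sum>d\<in>N. c d *\<^sub>R d)" using sum0 by (simp add: eq_neg_iff_add_eq_0)
    have "v \<bullet> v = - (\<Sum>d\<in>P. \<Sum>e\<in>N. c d * c e * (d \<bullet> e))"
      by (subst (2) vN, unfold v_def inner_minus_right inner_sum_left)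
        (simp add: inner_sum_right sum_distrib_left mult.assoc mult.left_commute)
    also have "\<dots> \<le> 0"
    proof -
      have "(\<Sum>d\<in>P. \<Sum>e\<in>N. c d * c e * (d \<bullet> e)) \<ge> 0"
        by (intro sum_nonneg) (auto simp: P_def N_def mult_pos_neg less_imp_le intro!: mult_nonpos_nonpos obt)
      then show ?thesis by simp
    qed
    finally have "v = 0" by (metis antisym inner_eq_zero_iff inner_ge_zero)
    have "P = {}"
    proof (rule ccontr)
      assume "P \<noteq> {}"
      then have "v \<bullet> z > 0" unfolding v_def inner_sum_left using fin Dz by (intro sum_pos) (auto simp: P_def)
      with \<open>v = 0\<close> show False by simp
    qed
    moreover have "N = {}"
    proof (rule ccontr)
      assume "N \<noteq> {}"
      then have "(\<Sum>d\<in>N. - (c d * (d \<bullet> z))) > 0" using fin Dz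
        by (intro sum_pos) (auto simp: N_def mult_neg_pos)
      then have "v \<bullet> z > 0" by (subst vN) (simp add: inner_sum_left sum_negf)
      with \<open>v = 0\<close> show False by simp
    qed
    ultimately have "\<not> c d > 0" "\<not> c d < 0" using d unfolding P_def N_def by blast+
    then show ?thesis by linarith
  qed
  show thesis
    by (rule that[of D]) (unfold_locales, use generic D obt ind in auto)
qed

end

section \<open>Positive roots, exchange, and trivial stabilizers of regular vectors\<close>

context simple_roots
begin

lemma finite_D: "finite D"
  using D_pos finite_roots by (auto simp: pos_def intro: finite_subset)

lemma D_roots: "a \<in> D \<Longrightarrow> a \<in> roots W"
  using D_pos by (auto simp: pos_def)

lemma pos_roots: "a \<in> pos z \<Longrightarrow> a \<in> roots W"
  by (auto simp: pos_def)

lemma pos_or_neg: "a \<in> roots W \<Longrightarrow> a \<in> pos z \<or> - a \<in> pos z"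
  using generic[of a] root_uminus[of a] by (force simp: pos_def)

lemma not_pos_neg: "a \<in> pos z \<Longrightarrow> - a \<notin> pos z"
  by (auto simp: pos_def)

lemma pos_combination:
  assumes "b \<in> pos z"
  obtains c where "\<forall>d\<in>D. c d \<ge> 0" "b = (\<Sum>d\<in>D. c d *\<^sub>R d)"
  using assms pos_cone unfolding cone_of_def by blast

text \<open>The reflection changes only the coefficient at \<open>a\<close>. If the image were
  negative, all other coefficients of \<open>b\<close> would be zero, making \<open>b\<close>
  proportional to \<open>a\<close>.\<close>

lemma reflection_pos:
  assumes a: "a \<in> D" and b: "b \<in> pos z" "b \<noteq> a"
  shows "reflection_matrix a *v b \<in> pos z"
proof (rule ccontr)
  define r where "r = reflection_matrix a *v b"
  assume "reflection_matrix a *v b \<notin> pos z"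
  moreover have "r \<in> roots W" unfolding r_def
    using a b by (intro root_image root_reflection D_roots pos_roots)
  ultimately have "- r \<in> pos z" using pos_or_neg[of r] by (auto simp: r_def)
  then obtain e where e: "\<forall>d\<in>D. e d \<ge> 0" "- r = (\<Sum>d\<in>D. e d *\<^sub>R d)" by (rule pos_combination)
  obtain c where c: "\<forall>d\<in>D. c d \<ge> 0" "b = (\<Sum>d\<in>D. c d *\<^sub>R d)" using b by (blast elim: pos_combination)
  define f where "f d = e d + c d - (if d = a then 2 * (b \<bullet> a) else 0)" for d
  have "(\<Sum>d\<in>D. f d *\<^sub>R d) = - r + b - (\<Sum>d\<in>D. (if d = a then 2 * (b \<bullet> a) else 0) *\<^sub>R d)"
    by (simp add: f_def e c scaleR_diff_left scaleR_add_left sum.distrib sum_subtractf)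
  also have "\<dots> = 0"
    using a finite_D by (simp add: r_def root_mult D_roots if_distrib[of "\<lambda>c. c *\<^sub>R _"] cong: if_cong)
  finally have f0: "f d = 0" if "d \<in> D" for d using indep that by blast
  then have "c d = 0" if "d \<in> D - {a}" for d
  proof -
    have "e d + c d = 0" using f0[of d] that by (simp add: f_def)
    moreover have "e d \<ge> 0" "c d \<ge> 0" using e(1) c(1) that by auto
    ultimately show ?thesis by linarith
  qed
  then have "b = c a *\<^sub>R a" using a finite_D by (simp add: c(2) sum.remove)
  then have "b = a \<or> b = - a" using a b by (intro proportional_roots) (auto simp: D_roots pos_roots)
  then show False using a b D_pos not_pos_neg by auto
qed

text \<open>Since \<open>b \<bullet> b > 0\<close> and the coefficients of \<open>b\<close> are
  nonnegative, some simple \<open>a\<close> has \<open>b \<bullet> a > 0\<close>; reflecting in it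
  gives a positive root of smaller height \<open>b \<bullet> z\<close>.\<close>

lemma pos_conjugate_simple:
  "b \<in> pos z \<Longrightarrow> \<exists>as a. set as \<subseteq> D \<and> a \<in> D \<and> b = rprod as *v a"
proof (induction "card {g \<in> pos z. g \<bullet> z < b \<bullet> z}" arbitrary: b rule: less_induct)
  case less
  show ?case
  proof (cases "b \<in> D")
    case True
    then show ?thesis by (intro exI[of _ "[]"] exI[of _ b]) auto
  next
    case False
    obtain c where c: "\<forall>d\<in>D. c d \<ge> 0" "b = (\<Sum>d\<in>D. c d *\<^sub>R d)" using less by (blast elim: pos_combination)
    have "0 < b \<bullet> b" using less.prems pos_roots root_inner by simp
    also have "b \<bullet> b = (\<Sum>d\<in>D. c d * (b \<bullet> d))" by (subst c(2)) (simp add: inner_sum_right inner_sum_left inner_commute)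
    finally obtain a where a: "a \<in> D" "c a * (b \<bullet> a) > 0" by (meson not_less sum_nonpos)
    then have ba: "b \<bullet> a > 0" using c(1) by (metis not_less mult_nonneg_nonpos)
    define g where "g = reflection_matrix a *v b"
    have g: "g \<in> pos z" unfolding g_def using a False less.prems by (intro reflection_pos) auto
    have "a \<bullet> z > 0" using a D_pos by (auto simp: pos_def)
    then have gz: "g \<bullet> z < b \<bullet> z" using ba by (simp add: g_def root_mult D_roots a inner_diff_left)
    have "{h \<in> pos z. h \<bullet> z < g \<bullet> z} \<subset> {h \<in> pos z. h \<bullet> z < b \<bullet> z}" using gz g by auto
    moreover have "finite {h \<in> pos z. h \<bullet> z < b \<bullet> z}" using finite_roots by (auto simp: pos_def)
    ultimately have "card {h \<in> pos z. h \<bullet> z < g \<bullet> z} < card {h \<in> pos z. h \<bullet> z < b \<bullet> z}" by (rule psubset_card_mono[rotated])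
    then obtain as d where as: "set as \<subseteq> D" "d \<in> D" "g = rprod as *v d" using less.hyps g by blast
    have "b = reflection_matrix a *v g"
      unfolding g_def matrix_vector_mul_assoc using a by (simp add: reflection_matrix_involution root_norm D_roots)
    then show ?thesis using as a by (intro exI[of _ "a # as"] exI[of _ d]) (auto simp: matrix_vector_mul_assoc)
  qed
qed

lemma rprod_D_W: "set as \<subseteq> D \<Longrightarrow> rprod as \<in> W"
  using D_roots by (intro rprod_W) auto

lemma root_reflection_simple:
  assumes "b \<in> roots W"
  shows "\<exists>as. set as \<subseteq> D \<and> reflection_matrix b = rprod as"
proof -
  have pos: "\<exists>as. set as \<subseteq> D \<and> reflection_matrix b = rprod as" if b: "b \<in> pos z" for b
  proof -
    obtain as a where as: "set as \<subseteq> D" "a \<in> D" "b = rprod as *v a" using pos_conjugate_simple[OF b] by blast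
    have norms: "\<forall>a\<in>set (rev as). norm a = 1" using as D_roots root_norm by auto
    have inv: "rprod as ** rprod (rev as) = mat 1" using rprod_rev[OF norms] by simp
    have "reflection_matrix b = reflection_matrix b ** (rprod as ** rprod (rev as))" by (simp add: inv)
    also have "\<dots> = rprod as ** reflection_matrix a ** rprod (rev as)"
      using as by (simp add: matrix_mul_assoc root_reflection_conjugate rprod_D_W D_roots)
    finally show ?thesis using as by (intro exI[of _ "as @ [a] @ rev as"]) (auto simp: matrix_mul_assoc)
  qed
  show ?thesis
    using pos_or_neg[OF assms] pos[of b] pos[of "- b"] reflection_matrix_scale[of "-1" b] by auto
qed

lemma W_simple_rprod:
  assumes "A \<in> W"
  obtains as where "set as \<subseteq> D" "A = rprod as"
proof -
  obtain bs where "set bs \<subseteq> roots W" "A = rprod bs" using W_rprod[OF assms] .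
  then have "\<exists>as. set as \<subseteq> D \<and> A = rprod as"
  proof (induction bs arbitrary: A)
    case Nil
    then show ?case by (intro exI[of _ "[]"]) auto
  next
    case (Cons b bs)
    then obtain as where as: "set as \<subseteq> D" "rprod bs = rprod as" by auto
    obtain cs where "set cs \<subseteq> D" "reflection_matrix b = rprod cs" using root_reflection_simple[of b] Cons by auto
    then show ?case using as Cons by (intro exI[of _ "cs @ as"]) auto
  qed
  then show thesis using that by blast
qed

text \<open>Read from the right, the letter at which the image of \<open>a\<close> first turns
  negative must be that image itself, because a simple reflection makes no other positive root
  negative.\<close>

lemma exchange:
  assumes "set bs \<subseteq> D" "a \<in> pos z" "rprod bs *v a \<notin> pos z"
  shows "\<exists>us b vs. bs = us @ b # vs \<and> rprod vs *v a = b"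
  using assms
proof (induction bs)
  case (Cons b bs)
  show ?case
  proof (cases "rprod bs *v a \<in> pos z")
    case True
    then have "rprod bs *v a = b"
      using Cons.prems reflection_pos[of b "rprod bs *v a"] by (auto simp: matrix_vector_mul_assoc)
    then show ?thesis by (intro exI[of _ "[]"]) auto
  next
    case False
    then obtain us b' vs where "bs = us @ b' # vs" "rprod vs *v a = b'" using Cons by auto
    then show ?thesis by (intro exI[of _ "b # us"]) auto
  qed
qed auto

text \<open>The last letter \<open>a\<close> of a nonempty word is positive, so the rest of the word
  makes it negative. By \<open>exchange\<close> a letter \<open>b\<close> satisfies
  \<open>s_b vs = vs s_a\<close>; both letters cancel, and induction on the length applies.\<close>

lemma preserves_pos_trivial:
  assumes "A \<in> W" "\<And>b. b \<in> pos z \<Longrightarrow> A *v b \<in> pos z"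
  shows "A = mat 1"
proof -
  have "rprod as = mat 1" if "set as \<subseteq> D" "\<forall>b\<in>pos z. rprod as *v b \<in> pos z" for as
    using that
  proof (induction "length as" arbitrary: as rule: less_induct)
    case less
    show ?case
    proof (cases as rule: rev_cases)
      case (snoc bs a)
      have a: "a \<in> D" and bs: "set bs \<subseteq> D" using less.prems snoc by auto
      have "rprod as *v a = - (rprod bs *v a)"
      proof -
        have "reflection_matrix a *v a = - a" using a by (simp add: root_mult D_roots root_inner scaleR_2)
        then show ?thesis by (simp add: snoc matrix_vector_mul_assoc[symmetric] vec.neg)
      qed
      moreover have "rprod as *v a \<in> pos z" using less.prems a D_pos by auto
      ultimately have "rprod bs *v a \<notin> pos z" using not_pos_neg by fastforce
      then obtain us b vs where e: "bs = us @ b # vs" "rprod vs *v a = b"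
        using exchange[OF bs] a D_pos by blast
      have vs: "rprod vs \<in> W" using bs e by (intro rprod_D_W) auto
      have "rprod as = rprod us ** ((reflection_matrix b ** rprod vs) ** reflection_matrix a)"
        by (simp add: snoc e(1) matrix_mul_assoc)
      also have "reflection_matrix b ** rprod vs = rprod vs ** reflection_matrix a"
        using root_reflection_conjugate[OF vs D_roots[OF a]] e(2) by simp
      also have "rprod us ** (rprod vs ** reflection_matrix a ** reflection_matrix a) = rprod (us @ vs)"
        using a by (simp add: reflection_matrix_involution D_roots root_norm flip: matrix_mul_assoc)
      finally have eq: "rprod as = rprod (us @ vs)" .
      have "rprod (us @ vs) = mat 1"
      proof (rule less.hyps)
        show "length (us @ vs) < length as" by (simp add: snoc e)
        show "set (us @ vs) \<subseteq> D" using bs e by auto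
        show "\<forall>b\<in>pos z. rprod (us @ vs) *v b \<in> pos z" using less.prems unfolding eq by blast
      qed
      then show ?thesis using eq by simp
    qed auto
  qed
  moreover obtain as where "set as \<subseteq> D" "A = rprod as" using W_simple_rprod[OF assms(1)] .
  ultimately show ?thesis using assms by blast
qed

lemma stabilizer_trivial:
  assumes "A \<in> W" "A *v z = z"
  shows "A = mat 1"
proof (rule preserves_pos_trivial[OF assms(1)])
  fix b assume "b \<in> pos z"
  then show "A *v b \<in> pos z"
    using W_orthogonal[OF assms(1), of b z] assms by (auto simp: pos_def root_image)
qed

end

text \<open>The simple roots are chosen relative to \<open>z\<close> itself, so an element fixing
  \<open>z\<close> preserves the positive roots.\<close>

lemma (in refl_group) regular_stabilizer_trivial:
  assumes "\<And>a. a \<in> roots W \<Longrightarrow> a \<bullet> z \<noteq> 0" "A \<in> W" "A *v z = z"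
  shows "A = mat 1"
proof -
  obtain D where "simple_roots W z D" using ex_simple_roots[OF assms(1)] .
  then interpret simple_roots W z D .
  show ?thesis using stabilizer_trivial assms by blast
qed


subsection \<open>Irreducibility\<close>

definition cvec :: "real^'n \<Rightarrow> complex^'n" where
  "cvec x = (\<chi> i. complex_of_real (x $ i))"

lemma complexify_cvec: "complexify A *v cvec x = cvec (A *v x)"
  by (simp add: vec_eq_iff complexify_def cvec_def matrix_vector_mult_def)

lemma complexify_mult: "complexify (A ** B) = complexify A ** complexify B"
  by (simp add: vec_eq_iff complexify_def matrix_matrix_mult_def)

lemma complexify_one: "complexify (mat 1) = mat 1"
  by (simp add: vec_eq_iff complexify_def mat_def)

lemma cvec_eq_iff: "cvec x = cvec y \<longleftrightarrow> x = y"
  by (simp add: vec_eq_iff cvec_def)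

text \<open>1 and a nonreal \<open>\<beta>\<close> are linearly independent over the reals. This
  separates real from imaginary parts in fixed-point equations.\<close>

lemma cvec_split: "cvec x + \<beta> *s cvec y = cvec x' + \<beta> *s cvec y' \<longleftrightarrow> x = x' \<and> y = y'" if "Im \<beta> \<noteq> 0"
proof -
  have "x $ i = x' $ i \<and> y $ i = y' $ i"
    if "complex_of_real (x $ i) + \<beta> * complex_of_real (y $ i) = complex_of_real (x' $ i) + \<beta> * complex_of_real (y' $ i)" for i
    using that \<open>Im \<beta> \<noteq> 0\<close> by (auto simp: complex_eq_iff)
  then show ?thesis by (auto simp: vec_eq_iff cvec_def)
qed

lemma complexify_reflection:
  assumes "norm b = 1"
  shows "complexify (reflection_matrix b) *v u = u - (2 * (\<Sum>i\<in>UNIV. complex_of_real (b $ i) * u $ i)) *s cvec b"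
proof -
  define x where "x = (\<chi> i. Re (u $ i))"
  define y where "y = (\<chi> i. Im (u $ i))"
  have u: "u = cvec x + \<i> *s cvec y"
    by (auto simp: x_def y_def cvec_def vec_eq_iff complex_eq_iff)
  have "complexify (reflection_matrix b) *v u =
      cvec (x - (2 * (x \<bullet> b)) *\<^sub>R b) + \<i> *s cvec (y - (2 * (y \<bullet> b)) *\<^sub>R b)"
    unfolding u by (simp add: matrix_vector_right_distrib vector_scalar_commute complexify_cvec
      reflection_matrix_unit assms)
  also have "\<dots> = u - (2 * (complex_of_real (x \<bullet> b) + \<i> * complex_of_real (y \<bullet> b))) *s cvec b"
    by (simp add: u vec_eq_iff cvec_def algebra_simps)
  also have "complex_of_real (x \<bullet> b) + \<i> * complex_of_real (y \<bullet> b) = (\<Sum>i\<in>UNIV. complex_of_real (b $ i) * u $ i)"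
    unfolding u by (simp add: inner_vec_def cvec_def algebra_simps sum.distrib sum_distrib_left)
  finally show ?thesis .
qed

locale irreducible_roots = simple_roots W z D for W :: "(real^'n^'n) set" and z D +
  assumes irreducible: "irreducible_action W" and nontrivial: "W \<noteq> {mat 1}"
begin

text \<open>A nonzero fixed vector spans an invariant line. By irreducibility the line is all of
  \<open>V\<close>, and then \<open>W\<close> acts trivially.\<close>

lemma fixed_zero:
  assumes fixed: "\<And>A. A \<in> W \<Longrightarrow> A *v x = x"
  shows "x = 0"
proof (rule ccontr)
  assume x: "x \<noteq> 0"
  define U where "U = vec.span {cvec x}"
  have inv: "complexify A *v u = u" if Au: "A \<in> W" "u \<in> U" for A u
  proof -
    obtain c where "u = c *s cvec x" using Au(2) unfolding U_def vec.span_singleton by blast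
    then show ?thesis using fixed[OF Au(1)] by (simp add: vector_scalar_commute complexify_cvec)
  qed
  have "vec.subspace U" by (simp add: U_def)
  then have "U = {0} \<or> U = UNIV" using irreducible inv by (auto simp: irreducible_action_def)
  moreover have "cvec x \<in> U" by (simp add: U_def vec.span_base)
  moreover have "cvec x \<noteq> 0" using x by (auto simp: cvec_def vec_eq_iff)
  ultimately have "U = UNIV" by auto
  have "W \<subseteq> {mat 1}"
  proof
    fix A assume A: "A \<in> W"
    have "A *v y = y" for y
      using inv[OF A, of "cvec y"] \<open>U = UNIV\<close> by (simp add: complexify_cvec cvec_eq_iff)
    then show "A \<in> {mat 1}" by (simp add: matrix_eq)
  qed
  then show False using nontrivial one_W by blast
qed

lemma orthogonal_D_zero:
  assumes "\<And>a. a \<in> D \<Longrightarrow> a \<bullet> x = 0"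
  shows "x = 0"
proof (rule fixed_zero)
  fix A assume "A \<in> W"
  then obtain as where "set as \<subseteq> D" "A = rprod as" by (rule W_simple_rprod)
  then show "A *v x = x"
    by (induction as arbitrary: A)
      (auto simp: root_mult D_roots assms inner_commute simp flip: matrix_vector_mul_assoc)
qed

text \<open>The orthogonal complement \<open>U\<close> of \<open>D1\<close> is invariant:
  reflections in \<open>D1\<close> fix it pointwise, the others move vectors along roots orthogonal
  to \<open>D1\<close>. So \<open>U\<close> is zero or everything.\<close>

lemma D_connected:
  assumes "D1 \<subseteq> D" and orth: "\<And>a b. a \<in> D1 \<Longrightarrow> b \<in> D - D1 \<Longrightarrow> a \<bullet> b = 0"
  shows "D1 = {} \<or> D1 = D"
proof -
  define cd where "cd a u = (\<Sum>i\<in>UNIV. complex_of_real (a $ i) * u $ i)" for a :: "real^'n" and u :: "complex^'n"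
  have cd_lin: "cd a (u - c *s v) = cd a u - c * cd a v" "cd a (u + v) = cd a u + cd a v" "cd a (c *s v) = c * cd a v"
    "cd a 0 = 0" for a u v c
    by (simp_all add: cd_def algebra_simps sum_subtractf sum_distrib_left sum.distrib)
  have cd_cvec: "cd a (cvec b) = complex_of_real (a \<bullet> b)" for a b
    by (simp add: cd_def cvec_def inner_vec_def)
  define U where "U = {u. \<forall>a\<in>D1. cd a u = 0}"
  have "vec.subspace U" by (auto simp: U_def vec.subspace_def cd_lin)
  moreover have "complexify A *v u \<in> U" if "A \<in> W" "u \<in> U" for A u
  proof -
    obtain as where "set as \<subseteq> D" "A = rprod as" using \<open>A \<in> W\<close> by (rule W_simple_rprod)
    then show ?thesis
    proof (induction as arbitrary: A)
      case Nil
      then show ?case using that by (simp add: complexify_one)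
    next
      case (Cons b as)
      define w where "w = complexify (rprod as) *v u"
      have w: "w \<in> U" using Cons by (simp add: w_def)
      have b: "b \<in> D" using Cons by simp
      have "complexify A *v u = w - (2 * cd b w) *s cvec b"
        using b by (simp add: Cons.prems complexify_mult w_def complexify_reflection root_norm D_roots cd_def
          flip: matrix_vector_mul_assoc)
      moreover have "cd a (w - (2 * cd b w) *s cvec b) = 0" if "a \<in> D1" for a
        using that w b orth[of a b] by (cases "b \<in> D1") (auto simp: cd_lin cd_cvec U_def)
      ultimately show ?case by (simp add: U_def)
    qed
  qed
  ultimately have U: "U = {0} \<or> U = UNIV" using irreducible by (auto simp: irreducible_action_def)
  show ?thesis
  proof (cases "U = UNIV")
    case True
    have False if "a \<in> D1" for a
    proof -
      have "cvec a \<in> U" using True by simp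
      then have "a \<bullet> a = 0" using that by (auto simp: U_def cd_cvec)
      then show False using that assms root_nonzero[OF D_roots[of a]] by auto
    qed
    then show ?thesis by auto
  next
    case False
    have False if "b \<in> D - D1" for b
    proof -
      have "cvec b \<in> U" using that orth by (auto simp: U_def cd_cvec)
      then have "cvec b = 0" using False U by blast
      also have "0 = cvec 0" by (simp add: cvec_def vec_eq_iff)
      finally have "cvec b = cvec 0" .
      then show False using that root_nonzero[OF D_roots[of b]] by (simp add: cvec_eq_iff)
    qed
    then show ?thesis using assms by auto
  qed
qed

lemma independent_D: "independent D"
  unfolding independent_explicit_finite_subsets
proof (intro allI ballI impI)
  fix S c d
  assume S: "S \<subseteq> D" "finite S" "(\<Sum>v\<in>S. c v *\<^sub>R v) = 0" and d: "d \<in> S"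
  define c' where "c' v = (if v \<in> S then c v else 0)" for v
  have "(\<Sum>v\<in>D. c' v *\<^sub>R v) = (\<Sum>v\<in>S. c v *\<^sub>R v)"
    unfolding c'_def using S(1) finite_D by (intro sum.mono_neutral_cong_right) auto
  then have "c' d = 0" using S d by (intro indep[of c' d]) auto
  then show "c d = 0" using d by (simp add: c'_def)
qed

lemma span_D: "span D = UNIV"
proof (rule ccontr)
  assume "span D \<noteq> UNIV"
  then have "\<exists>a. a \<noteq> 0 \<and> (\<forall>x\<in>span D. a \<bullet> x = 0)"
    using span_not_univ_subset_hyperplane[of D] by auto
  then obtain a where "a \<noteq> 0" "\<And>x. x \<in> span D \<Longrightarrow> a \<bullet> x = 0"
    by blast
  moreover have "a = 0" using calculation(2)[OF span_base] by (intro orthogonal_D_zero) (simp add: inner_commute)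
  ultimately show False by simp
qed

lemma card_D: "card D = CARD('n)"
  using basis_card_eq_dim[of D UNIV] independent_D span_D by (simp add: dim_UNIV)


subsection \<open>The Coxeter graph\<close>

text \<open>An edge has label at least 3. With \<open>t = - 2 (a \<bullet> b)\<close>, reflecting
  \<open>b\<close> first in \<open>a\<close> and then in \<open>b\<close> gives the positive root
  \<open>t a + (t^2 - 1) b\<close>, so \<open>t^2 \<ge> 1\<close>.\<close>

lemma edge_inner:
  assumes a: "a \<in> D" and b: "b \<in> D" and ab: "a \<noteq> b" "a \<bullet> b \<noteq> 0"
  shows "a \<bullet> b \<le> - (1 / 2)"
proof -
  define t where "t = - (2 * (a \<bullet> b))"
  have t: "t > 0" using obtuse[OF a b ab(1)] ab(2) by (simp add: t_def)
  define r where "r = reflection_matrix a *v b"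
  have r: "r = b + t *\<^sub>R a" using a by (simp add: r_def root_mult D_roots t_def inner_commute)
  have "r \<in> pos z" unfolding r_def using a b ab D_pos by (intro reflection_pos) auto
  moreover have "r \<noteq> b" using t a by (auto simp: r root_nonzero D_roots)
  ultimately have "reflection_matrix b *v r \<in> pos z" using b by (intro reflection_pos)
  moreover have "reflection_matrix b *v r = t *\<^sub>R a + (t^2 - 1) *\<^sub>R b"
  proof -
    have "r \<bullet> b = 1 - t * t / 2" using b by (simp add: r inner_add_left root_inner D_roots) (simp add: t_def)
    then have "2 * (r \<bullet> b) = 1 - (t^2 - 1)" by (simp add: power2_eq_square)
    then have "reflection_matrix b *v r = r - (1 - (t^2 - 1)) *\<^sub>R b"
      using b by (simp add: root_mult D_roots)
    then show ?thesis by (simp only: scaleR_diff_left[of 1 "t^2 - 1"] r scaleR_one) simp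
  qed
  ultimately obtain c where c: "\<forall>d\<in>D. c d \<ge> 0" "t *\<^sub>R a + (t^2 - 1) *\<^sub>R b = (\<Sum>d\<in>D. c d *\<^sub>R d)"
    by (metis pos_combination)
  have *: "(\<Sum>d\<in>D. (c d - ((if d = a then t else 0) + (if d = b then t^2 - 1 else 0))) *\<^sub>R d) = 0"
    using a b finite_D
    by (simp add: scaleR_diff_left scaleR_add_left sum_subtractf sum.distrib c(2)[symmetric]
        if_distrib[of "\<lambda>c. c *\<^sub>R _"] cong: if_cong)
  have "c b - ((if b = a then t else 0) + (if b = b then t^2 - 1 else 0)) = 0" using indep[OF * b] .
  then have "t^2 \<ge> 1" using c(1) b ab by auto
  then have "t \<ge> 1" using t power2_le_imp_le[of 1 t] by simp
  then show ?thesis by (simp add: t_def)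
qed

text \<open>If every vertex of \<open>S\<close> had two neighbours in \<open>S\<close>, the sum of \<open>S\<close> would have norm \<open>\<le> 0\<close>.\<close>

lemma ex_leaf:
  assumes S: "S \<subseteq> D" "S \<noteq> {}"
  shows "\<exists>a\<in>S. card {b \<in> S - {a}. a \<bullet> b \<noteq> 0} \<le> 1"
proof (rule ccontr)
  assume "\<not> ?thesis"
  then have two: "card {b \<in> S - {a}. a \<bullet> b \<noteq> 0} \<ge> 2" if "a \<in> S" for a using that by force
  have fin: "finite S" using S finite_D finite_subset by blast
  have "a \<bullet> \<Sum>S \<le> 0" if a: "a \<in> S" for a
  proof -
    let ?N = "{b \<in> S - {a}. a \<bullet> b \<noteq> 0}"
    have "a \<bullet> \<Sum>S = a \<bullet> a + (\<Sum>b\<in>S-{a}. a \<bullet> b)"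
      unfolding inner_sum_right by (rule sum.remove[OF fin a])
    also have "a \<bullet> a = 1" using a S by (auto simp: root_inner D_roots)
    also have "(\<Sum>b\<in>S-{a}. a \<bullet> b) = (\<Sum>b\<in>?N. a \<bullet> b)"
      using fin by (intro sum.mono_neutral_right) auto
    also have "\<dots> \<le> (\<Sum>b\<in>?N. - (1/2))" using a S by (intro sum_mono edge_inner) auto
    also have "\<dots> \<le> - 1" using two[OF a] by simp
    finally show ?thesis by simp
  qed
  then have "\<Sum>S \<bullet> \<Sum>S \<le> 0" by (simp add: inner_sum_left sum_nonpos)
  then have "\<Sum>S = 0" by (metis antisym inner_eq_zero_iff inner_ge_zero)
  moreover have "(\<Sum>d\<in>D. (if d \<in> S then 1 else 0) *\<^sub>R d) = \<Sum>S"
    using S finite_D by (intro sum.mono_neutral_cong_right) auto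
  ultimately have "(\<Sum>d\<in>D. (if d \<in> S then 1 else 0) *\<^sub>R d) = 0" by simp
  from indep[OF this] S show False by (metis all_not_in_conv subsetD zero_neq_one)
qed

text \<open>A vertex with at most one neighbour is removed, the rest is coloured, and the vertex
  gets the colour that its neighbour does not have.\<close>

lemma bipartite:
  "S \<subseteq> D \<Longrightarrow> \<exists>S1\<subseteq>S. (\<forall>a\<in>S1. \<forall>b\<in>S1. a \<noteq> b \<longrightarrow> a \<bullet> b = 0) \<and>
     (\<forall>a\<in>S-S1. \<forall>b\<in>S-S1. a \<noteq> b \<longrightarrow> a \<bullet> b = 0)"
proof (induction "card S" arbitrary: S)
  case 0
  have "finite S" by (rule finite_subset[OF 0(2) finite_D])
  then have "S = {}" using 0(1) by simp
  then show ?case by simp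
next
  case (Suc n)
  have fin: "finite S" by (rule finite_subset[OF Suc(3) finite_D])
  have "S \<noteq> {}" using Suc(2) by auto
  from ex_leaf[OF Suc(3) this]
  obtain a where a: "a \<in> S" "card {b \<in> S - {a}. a \<bullet> b \<noteq> 0} \<le> 1" by (elim bexE)
  have "n = card (S - {a})" "S - {a} \<subseteq> D" using Suc(2,3) a(1) fin by auto
  from Suc(1)[OF this] obtain S1 where S1: "S1 \<subseteq> S - {a}" "\<forall>b\<in>S1. \<forall>c\<in>S1. b \<noteq> c \<longrightarrow> b \<bullet> c = 0"
    "\<forall>b\<in>S - {a} - S1. \<forall>c\<in>S - {a} - S1. b \<noteq> c \<longrightarrow> b \<bullet> c = 0" by (elim exE conjE)
  have unique: "b = c" if "b \<in> S - {a}" "c \<in> S - {a}" "a \<bullet> b \<noteq> 0" "a \<bullet> c \<noteq> 0" for b c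
  proof -
    have "finite {b \<in> S - {a}. a \<bullet> b \<noteq> 0}" using fin by simp
    then have "\<forall>b\<in>{b \<in> S - {a}. a \<bullet> b \<noteq> 0}. \<forall>c\<in>{b \<in> S - {a}. a \<bullet> b \<noteq> 0}. b = c"
      using a(2) by (simp only: card_le_Suc0_iff_eq One_nat_def)
    then show ?thesis using that by blast
  qed
  show ?case
  proof (cases "\<exists>b\<in>S1. a \<bullet> b \<noteq> 0")
    case True
    then obtain b where b: "b \<in> S1" "a \<bullet> b \<noteq> 0" by blast
    have ac: "a \<bullet> c = 0" if "c \<in> S - {a} - S1" for c using unique[of b c] b S1(1) that by blast
    show ?thesis
    proof (intro exI[of _ S1] conjI ballI impI)
      fix x y assume "x \<in> S - S1" "y \<in> S - S1" "x \<noteq> y"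
      then consider "x = a" "y \<in> S - {a} - S1" | "y = a" "x \<in> S - {a} - S1" | "x \<in> S - {a} - S1" "y \<in> S - {a} - S1" "x \<noteq> y"
        by blast
      then show "x \<bullet> y = 0" by cases (use ac S1(3) inner_commute[of x a] in simp_all)
    next
      show "S1 \<subseteq> S" using S1(1) by blast
    qed (use S1(2) in blast)
  next
    case False
    show ?thesis
    proof (intro exI[of _ "insert a S1"] conjI ballI impI)
      fix x y assume "x \<in> insert a S1" "y \<in> insert a S1" "x \<noteq> y"
      then consider "x = a" "y \<in> S1" | "y = a" "x \<in> S1" | "x \<in> S1" "y \<in> S1" "x \<noteq> y" by blast
      then show "x \<bullet> y = 0" by cases (use False S1(2) inner_commute[of x a] in simp_all)
    next
      fix x y assume "x \<in> S - insert a S1" "y \<in> S - insert a S1" "x \<noteq> y"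
      then show "x \<bullet> y = 0" using S1(3) by blast
    next
      show "insert a S1 \<subseteq> S" using S1(1) a(1) by blast
    qed
  qed
qed

end


subsection \<open>Perron-Frobenius for symmetric matrices\<close>

text \<open>For small \<open>t\<close> of sign opposite to \<open>b\<close> the linear term
  dominates; \<open>e\<close> is small enough for that.\<close>

lemma quadratic_nonneg_linear_zero:
  fixes b c :: real
  assumes "\<And>t. t * b + t^2 * c \<ge> 0"
  shows "b = 0"
proof (rule ccontr)
  assume b: "b \<noteq> 0"
  define e where "e = \<bar>b\<bar> / (2 * (\<bar>c\<bar> + 1))"
  have e: "e > 0" using b by (simp add: e_def)
  have ec: "e * \<bar>c\<bar> < \<bar>b\<bar>"
  proof -
    have "e * \<bar>c\<bar> \<le> e * (2 * (\<bar>c\<bar> + 1)) / 2" using e by (simp add: algebra_simps)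
    also have "\<dots> = \<bar>b\<bar> / 2" by (simp add: e_def)
    finally show ?thesis using b by simp
  qed
  have "(- sgn b * e) * b + (- sgn b * e)^2 * c = e * (e * c - \<bar>b\<bar>)"
    using b by (auto simp: sgn_if power2_eq_square algebra_simps abs_if)
  moreover have "e * (e * c - \<bar>b\<bar>) < 0"
    using e ec by (intro mult_pos_neg) (smt (verit, best) mult_left_mono)+
  ultimately show False using assms[of "- sgn b * e"] by simp
qed

text \<open>\<open>u\<close> maximizes the quadratic form \<open>Q\<close> on the unit sphere; as
  the entries of \<open>M\<close> are nonnegative, passing to absolute values does not lower
  \<open>Q\<close>. The form \<open>\<rho> (w \<bullet> w) - Q w\<close> is nonnegative and zero at
  \<open>u\<close>, so its derivative there is zero, which is the eigenvalue equation.\<close>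

lemma symmetric_max_eigenvector:
  fixes M :: "real^'n^'n"
  assumes sym: "transpose M = M" and nonneg: "\<And>i j. M $ i $ j \<ge> 0"
  obtains u \<rho> where "u \<noteq> 0" "\<And>i. u $ i \<ge> 0" "M *v u = \<rho> *\<^sub>R u" "\<rho> \<ge> 0"
proof -
  define Q where "Q u = u \<bullet> (M *v u)" for u
  have "continuous_on (sphere 0 1) Q" unfolding Q_def
    by (intro continuous_intros linear_continuous_on linear_linear[THEN iffD2] matrix_vector_mul_linear)
  moreover have "sphere (0::real^'n) 1 \<noteq> {}" by (simp add: sphere_eq_empty)
  ultimately obtain u0 where u0: "norm u0 = 1" "\<And>w. norm w = 1 \<Longrightarrow> Q w \<le> Q u0"
    using continuous_attains_sup[OF compact_sphere, of "0::real^'n" 1 Q] by auto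
  define u where "u = (\<chi> i. \<bar>u0 $ i\<bar>)"
  have nu: "norm u = 1" using u0 by (simp add: u_def norm_vec_def L2_set_def)
  have Q_sum: "Q w = (\<Sum>i\<in>UNIV. \<Sum>j\<in>UNIV. w $ i * (M $ i $ j * w $ j))" for w
    by (simp add: Q_def inner_vec_def matrix_vector_mult_def sum_distrib_left)
  have "Q u0 \<le> Q u"
    unfolding Q_sum u_def
  proof (intro sum_mono, simp)
    fix i j
    have "u0 $ i * (M $ i $ j * u0 $ j) \<le> \<bar>u0 $ i * (M $ i $ j * u0 $ j)\<bar>" by simp
    then show "u0 $ i * (M $ i $ j * u0 $ j) \<le> \<bar>u0 $ i\<bar> * (M $ i $ j * \<bar>u0 $ j\<bar>)"
      using nonneg[of i j] by (simp add: abs_mult)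
  qed
  then have max: "Q w \<le> Q u" if "norm w = 1" for w using u0(2)[OF that] by simp
  define \<rho> where "\<rho> = Q u"
  have P: "\<rho> * (w \<bullet> w) - Q w \<ge> 0" for w
  proof (cases "w = 0")
    case False
    have "Q ((1 / norm w) *\<^sub>R w) \<le> \<rho>" unfolding \<rho>_def using False by (intro max) simp
    then have "(1 / norm w)^2 * Q w \<le> \<rho>"
      by (simp add: Q_def matrix_vector_mult_scaleR power2_eq_square)
    then have "Q w \<le> \<rho> * (norm w)^2" using False by (simp add: field_simps)
    then show ?thesis by (simp add: power2_norm_eq_inner)
  qed (simp add: Q_def)
  have symm: "x \<bullet> (M *v y) = y \<bullet> (M *v x)" for x y
    using sym by (metis dot_lmul_matrix inner_commute transpose_matrix_vector)
  have "(\<rho> *\<^sub>R u - M *v u) \<bullet> w = 0" for w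
  proof -
    have "t * (2 * ((\<rho> *\<^sub>R u - M *v u) \<bullet> w)) + t^2 * (\<rho> * (w \<bullet> w) - Q w) \<ge> 0" for t
    proof -
      have "\<rho> * ((u + t *\<^sub>R w) \<bullet> (u + t *\<^sub>R w)) - Q (u + t *\<^sub>R w) =
         (\<rho> * (u \<bullet> u) - Q u) + t * (2 * ((\<rho> *\<^sub>R u - M *v u) \<bullet> w)) + t^2 * (\<rho> * (w \<bullet> w) - Q w)"
        using symm[of u w] by (simp add: Q_def matrix_vector_right_distrib matrix_vector_mult_scaleR inner_add_left inner_add_right
            inner_diff_left inner_diff_right power2_eq_square algebra_simps inner_commute[of w u] inner_commute[of "M *v u" w])
      moreover have "\<rho> * (u \<bullet> u) - Q u = 0" using nu by (simp add: \<rho>_def norm_eq_1)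
      ultimately show ?thesis using P[of "u + t *\<^sub>R w"] by simp
    qed
    from quadratic_nonneg_linear_zero[OF this] show ?thesis by simp
  qed
  from this[of "\<rho> *\<^sub>R u - M *v u"] have "M *v u = \<rho> *\<^sub>R u" by simp
  moreover have "u \<noteq> 0" using nu by auto
  moreover have "\<rho> \<ge> 0" unfolding \<rho>_def Q_sum u_def by (intro sum_nonneg) (auto intro!: mult_nonneg_nonneg nonneg)
  ultimately show thesis using that[of u \<rho>] by (simp add: u_def)
qed


subsection \<open>The Coxeter element\<close>

context irreducible_roots
begin

lemma ex_dual_vector:
  assumes "bij_betw e (UNIV :: 'n set) D"
  obtains x where "\<And>i. x \<bullet> e i = g i"
proof -
  define f where "f x = (\<chi> i. x \<bullet> e i)" for x :: "real^'n"
  have "linear f" by (rule linearI) (auto simp: f_def vec_eq_iff inner_add_left)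
  moreover have "inj f"
    unfolding linear_injective_0[OF \<open>linear f\<close>]
  proof (intro allI impI)
    fix x assume "f x = 0"
    then have "x \<bullet> e i = 0" for i by (simp add: f_def vec_eq_iff)
    moreover have "D = range e" using assms by (simp add: bij_betw_def)
    ultimately show "x = 0" by (intro orthogonal_D_zero) (auto simp: inner_commute)
  qed
  ultimately have "surj f" by (rule linear_inj_imp_surj)
  then obtain x where "(\<chi> i. g i) = f x" by (meson surjD)
  then have "x \<bullet> e i = g i" for i by (simp add: f_def vec_eq_iff)
  then show thesis by (rule that)
qed

lemma rprod_orthogonal:
  assumes "set as \<subseteq> D" "distinct as" "\<And>a b. a \<in> set as \<Longrightarrow> b \<in> set as \<Longrightarrow> a \<noteq> b \<Longrightarrow> a \<bullet> b = 0"
  shows "rprod as *v x = x - (\<Sum>a\<in>set as. (2 * (x \<bullet> a)) *\<^sub>R a)"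
  using assms
proof (induction as)
  case (Cons a as)
  have "(\<Sum>b\<in>set as. (2 * (x \<bullet> b)) *\<^sub>R b) \<bullet> a = 0"
    unfolding inner_sum_left using Cons.prems by (intro sum.neutral) auto
  then show ?case using Cons
    by (simp add: root_mult D_roots inner_diff_left flip: matrix_vector_mul_assoc)
qed auto

text \<open>If the word fixes \<open>x\<close>, its tail sends \<open>x\<close> to the reflection of
  \<open>x\<close> in the first letter \<open>a\<close>. So \<open>2 (x \<bullet> a) a\<close> lies
  in the span of the remaining simple roots, and independence gives
  \<open>x \<bullet> a = 0\<close>. Thus a Coxeter element fixes only 0.\<close>

lemma rprod_fixed:
  assumes "set as \<subseteq> D" "distinct as" "rprod as *v x = x"
  shows "\<forall>a\<in>set as. x \<bullet> a = 0"
  using assms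
proof (induction as)
  case (Cons a as)
  have diff_span: "x - rprod bs *v x \<in> span (set bs)" if "set bs \<subseteq> D" for bs
    using that
  proof (induction bs)
    case (Cons b bs)
    have "x - rprod bs *v x \<in> span (set (b # bs))"
      using Cons span_mono[of "set bs" "set (b # bs)"] by auto
    moreover have "(2 * ((rprod bs *v x) \<bullet> b)) *\<^sub>R b \<in> span (set (b # bs))"
      by (intro span_mul span_base) simp
    ultimately have "(x - rprod bs *v x) + (2 * ((rprod bs *v x) \<bullet> b)) *\<^sub>R b \<in> span (set (b # bs))"
      by (rule span_add)
    then show ?case using Cons.prems
      by (simp add: root_mult D_roots diff_diff_eq2 diff_add_eq flip: matrix_vector_mul_assoc)
  qed (simp add: span_0)
  have aD: "a \<in> D" and inv: "reflection_matrix a ** reflection_matrix a = mat 1"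
    using Cons.prems by (auto simp: reflection_matrix_involution root_norm D_roots)
  have "reflection_matrix a *v (reflection_matrix a *v (rprod as *v x)) = reflection_matrix a *v x"
    using Cons.prems by (simp add: matrix_vector_mul_assoc)
  then have as_x: "rprod as *v x = reflection_matrix a *v x"
    by (simp add: matrix_vector_mul_assoc inv matrix_mul_assoc)
  then have eq: "x - rprod as *v x = (2 * (x \<bullet> a)) *\<^sub>R a" using aD by (simp add: root_mult D_roots)
  have "x \<bullet> a = 0"
  proof (rule ccontr)
    assume nz: "x \<bullet> a \<noteq> 0"
    have "(2 * (x \<bullet> a)) *\<^sub>R a \<in> span (set as)" using diff_span[of as] Cons.prems eq by auto
    then have "(1 / (2 * (x \<bullet> a))) *\<^sub>R ((2 * (x \<bullet> a)) *\<^sub>R a) \<in> span (set as)" by (rule span_mul)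
    then have "a \<in> span (set as)" using nz by simp
    moreover have "set as \<subseteq> D - {a}" using Cons.prems by auto
    ultimately have "a \<in> span (D - {a})" using span_mono by blast
    then show False using independent_D aD by (auto simp: dependent_def)
  qed
  moreover from this have "rprod as *v x = x" using as_x aD by (simp add: root_mult D_roots)
  then have "\<forall>a\<in>set as. x \<bullet> a = 0" using Cons by auto
  ultimately show ?case by simp
qed simp

text \<open>The reflections of one colour class commute, so the product over a class is given by a
  single sum, and on the span of \<open>x\<close> and \<open>y\<close> it depends only on
  \<open>\<rho>\<close>.\<close>

lemma ex_coxeter_element:
  obtains as v \<mu> where "set as = D" "distinct as" "complexify (rprod as) *v v = \<mu> *s v"
    "\<And>A. A \<in> W \<Longrightarrow> complexify A *v v = v \<Longrightarrow> A = mat 1"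
proof -
  have "\<exists>e. bij_betw e (UNIV :: 'n set) D"
    using finite_D card_D by (intro finite_same_card_bij) auto
  then obtain e where e: "bij_betw e (UNIV :: 'n set) D" by blast
  have eD: "e i \<in> D" for i using e by (auto simp: bij_betw_def)
  have D_range: "D = range e" using e by (simp add: bij_betw_def)
  have e_eq: "e i = e j \<longleftrightarrow> i = j" for i j using e by (auto simp: bij_betw_def inj_def)
  \<comment> \<open>\<open>M\<close> is 2 minus twice the Gram matrix of the simple roots: the
    adjacency matrix of the Coxeter graph, weighted by \<open>2 cos (\<pi> / label)\<close>.\<close>
  define M where "M = (\<chi> i j. if i = j then 0 else - (2 * (e i \<bullet> e j)))"
  have "transpose M = M" by (simp add: M_def transpose_def vec_eq_iff inner_commute)
  moreover have "M $ i $ j \<ge> 0" for i j using obtuse[OF eD eD, of i j] by (simp add: M_def e_eq)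
  ultimately obtain u \<rho> where u: "u \<noteq> 0" "\<And>i. u $ i \<ge> 0" "M *v u = \<rho> *\<^sub>R u" "\<rho> \<ge> 0"
    using symmetric_max_eigenvector by metis
  have Mu: "(\<Sum>j\<in>UNIV. M $ i $ j * u $ j) = \<rho> * u $ i" for i
    using u(3) by (simp add: vec_eq_iff matrix_vector_mult_def)
  have gram: "(\<Sum>j\<in>UNIV. u $ j *\<^sub>R e j) \<bullet> e i = (1 - \<rho> / 2) * u $ i" for i
  proof -
    have "(\<Sum>j\<in>UNIV. u $ j *\<^sub>R e j) \<bullet> e i = (\<Sum>j\<in>UNIV. (if j = i then u $ j else 0) - M $ i $ j * u $ j / 2)"
      unfolding inner_sum_left
      by (intro sum.cong) (auto simp: M_def root_inner D_roots eD inner_commute)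
    also have "\<dots> = u $ i - (\<Sum>j\<in>UNIV. M $ i $ j * u $ j) / 2"
      by (simp add: sum_subtractf sum_divide_distrib)
    finally show ?thesis unfolding Mu by (simp add: algebra_simps)
  qed
  \<comment> \<open>At a zero of \<open>u\<close> the eigenvalue equation is a vanishing sum of
    nonnegative terms. So no edge joins zeros to nonzeros, and connectedness makes \<open>u\<close>
    strictly positive.\<close>
  have zero_set: "{i. u $ i = 0} = {}"
  proof -
    define Z where "Z = {i. u $ i = 0}"
    have orth: "e i \<bullet> e j = 0" if "i \<in> Z" "j \<notin> Z" for i j
    proof -
      have "(\<Sum>j\<in>UNIV. M $ i $ j * u $ j) = 0" using Mu that by (simp add: Z_def)
      then have "M $ i $ j * u $ j = 0"
        using obtuse[OF eD eD] u(2) by (subst (asm) sum_nonneg_eq_0_iff) (auto simp: M_def e_eq)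
      then show ?thesis using that by (auto simp: Z_def M_def split: if_splits)
    qed
    have "e ` Z = {} \<or> e ` Z = D"
      by (rule D_connected) (auto simp: eD D_range intro!: orth)
    moreover have "e ` Z \<noteq> D"
    proof
      assume "e ` Z = D"
      then have "Z = UNIV" using inj_image_eq_iff[OF bij_betw_imp_inj_on[OF e]] by (simp add: D_range)
      then show False using u(1) by (auto simp: Z_def vec_eq_iff)
    qed
    ultimately show ?thesis by (simp add: Z_def)
  qed
  then have upos: "u $ i > 0" for i using u(2)[of i] by (auto simp: less_le)
  \<comment> \<open>Positive definiteness of the inner product, tested on
    \<open>\<Sum> u_j e_j\<close>.\<close>
  have \<rho>2: "\<rho> < 2"
  proof -
    define s where "s = (\<Sum>j\<in>UNIV. u $ j *\<^sub>R e j)"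
    have "s \<noteq> 0"
    proof
      assume "s = 0"
      have "(\<Sum>d\<in>D. (u $ the_inv e d) *\<^sub>R d) = (\<Sum>j\<in>UNIV. (u $ the_inv e (e j)) *\<^sub>R e j)"
        by (rule sum.reindex_bij_betw[OF e, symmetric])
      then have "(\<Sum>d\<in>D. (u $ the_inv e d) *\<^sub>R d) = 0"
        using \<open>s = 0\<close> by (simp add: the_inv_f_f bij_betw_imp_inj_on[OF e] s_def)
      from indep[OF this eD] have "u $ i = 0" for i by (simp add: the_inv_f_f bij_betw_imp_inj_on[OF e])
      then show False using upos less_irrefl by metis
    qed
    then have "0 < s \<bullet> s" by simp
    also have "s \<bullet> s = (\<Sum>i\<in>UNIV. u $ i * (s \<bullet> e i))"
      by (subst (2) s_def) (simp add: inner_sum_right)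
    also have "\<dots> = (1 - \<rho> / 2) * (\<Sum>i\<in>UNIV. u $ i * u $ i)"
      unfolding s_def gram by (simp add: sum_distrib_left algebra_simps)
    finally have "1 - \<rho> / 2 > 0" using sum_nonneg[of UNIV "\<lambda>i. u $ i * u $ i"] by (auto simp: zero_less_mult_iff)
    then show ?thesis by simp
  qed
  obtain D1 where D1: "D1 \<subseteq> D" "\<forall>a\<in>D1. \<forall>b\<in>D1. a \<noteq> b \<longrightarrow> a \<bullet> b = 0"
    "\<forall>a\<in>D-D1. \<forall>b\<in>D-D1. a \<noteq> b \<longrightarrow> a \<bullet> b = 0"
    using bipartite[OF order_refl] by blast
  obtain x where x: "\<And>i. x \<bullet> e i = (if e i \<in> D1 then u $ i else 0)"
    by (rule ex_dual_vector[OF e, of "\<lambda>i. if e i \<in> D1 then u $ i else 0"]) blast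
  obtain y where y: "\<And>i. y \<bullet> e i = (if e i \<in> D1 then 0 else u $ i)"
    by (rule ex_dual_vector[OF e, of "\<lambda>i. if e i \<in> D1 then 0 else u $ i"]) blast
  obtain as1 where as1: "set as1 = D1" "distinct as1" using finite_distinct_list D1 finite_D finite_subset by metis
  obtain as2 where as2: "set as2 = D - D1" "distinct as2" using finite_distinct_list finite_D by blast
  have ext: "w = w'" if "\<And>i. w \<bullet> e i = w' \<bullet> e i" for w w'
  proof -
    have "w - w' = 0" using that
      by (intro orthogonal_D_zero) (auto simp: D_range inner_diff_right inner_commute)
    then show ?thesis by simp
  qed
  have r_sum: "rprod as *v w = w - (\<Sum>j | e j \<in> set as. (2 * (w \<bullet> e j)) *\<^sub>R e j)"
    if "set as \<subseteq> D" "distinct as" "\<forall>a\<in>set as. \<forall>b\<in>set as. a \<noteq> b \<longrightarrow> a \<bullet> b = 0" for as w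
  proof -
    have "set as = e ` {j. e j \<in> set as}" using that D_range by auto
    then have "(\<Sum>a\<in>set as. (2 * (w \<bullet> a)) *\<^sub>R a) = (\<Sum>j | e j \<in> set as. (2 * (w \<bullet> e j)) *\<^sub>R e j)"
      by (metis (no_types, lifting) e_eq inj_onI sum.reindex_cong)
    then show ?thesis using rprod_orthogonal[of as w] that by simp
  qed
  \<comment> \<open>\<open>P\<close> is a colour class. For \<open>i\<close> in it only the term
    \<open>j = i\<close> survives; for \<open>i\<close> outside it all neighbours of
    \<open>i\<close> are in \<open>P\<close>, and the eigenvalue equation gives the sum.\<close>
  have part: "(\<Sum>j | P j. 2 * (u $ j * (e j \<bullet> e i))) = (if P i then 2 * u $ i else - \<rho> * u $ i)"
    if P: "\<And>i j. i \<noteq> j \<Longrightarrow> P i \<longleftrightarrow> P j \<Longrightarrow> e i \<bullet> e j = 0" for P i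
  proof (cases "P i")
    case True
    have "(\<Sum>j | P j. 2 * (u $ j * (e j \<bullet> e i))) = (\<Sum>j | P j. if j = i then 2 * u $ i else 0)"
      by (intro sum.cong refl) (auto simp: root_inner D_roots eD True intro: P)
    then show ?thesis using True by simp
  next
    case False
    have "(\<Sum>j | P j. 2 * (u $ j * (e j \<bullet> e i))) = (\<Sum>j | P j. - (M $ i $ j * u $ j))"
      using False by (intro sum.cong refl) (auto simp: M_def inner_commute)
    also have "\<dots> = (\<Sum>j\<in>UNIV. - (M $ i $ j * u $ j))"
      using False P[of i] by (intro sum.mono_neutral_left) (auto simp: M_def)
    finally show ?thesis using False by (simp add: sum_negf Mu)
  qed
  define P where "P i \<longleftrightarrow> e i \<in> D1" for i
  have orthP: "e i \<bullet> e j = 0" if "i \<noteq> j" "P i \<longleftrightarrow> P j" for i j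
    using D1(2,3) that eD e_eq unfolding P_def by (metis DiffI)
  have r1x: "rprod as1 *v x = - x + \<rho> *\<^sub>R y"
  proof (rule ext)
    fix i
    have "(rprod as1 *v x) \<bullet> e i = x \<bullet> e i - (\<Sum>j | P j. 2 * (u $ j * (e j \<bullet> e i)))"
      using D1 as1 by (simp add: r_sum inner_diff_left inner_sum_left x P_def mult.assoc)
    then show "(rprod as1 *v x) \<bullet> e i = (- x + \<rho> *\<^sub>R y) \<bullet> e i"
      using part[of P i, OF orthP] by (simp add: x y inner_add_left inner_diff_left P_def)
  qed
  have r1y: "rprod as1 *v y = y"
    using D1 as1 by (simp add: r_sum y)
  have r2y: "rprod as2 *v y = - y + \<rho> *\<^sub>R x"
  proof (rule ext)
    fix i
    have "(rprod as2 *v y) \<bullet> e i = y \<bullet> e i - (\<Sum>j | \<not> P j. 2 * (u $ j * (e j \<bullet> e i)))"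
      using D1 as2 eD by (simp add: r_sum inner_diff_left inner_sum_left y P_def mult.assoc)
    then show "(rprod as2 *v y) \<bullet> e i = (- y + \<rho> *\<^sub>R x) \<bullet> e i"
      using part[of "\<lambda>i. \<not> P i" i] orthP by (simp add: x y inner_add_left inner_diff_left P_def)
  qed
  have r2x: "rprod as2 *v x = x"
    using D1 as2 by (simp add: r_sum x)
  define c where "c = rprod (as1 @ as2)"
  have cx: "c *v x = - x + \<rho> *\<^sub>R y"
    by (simp add: c_def r2x r1x flip: matrix_vector_mul_assoc)
  have cy: "c *v y = (- \<rho>) *\<^sub>R x + (\<rho>^2 - 1) *\<^sub>R y"
    by (simp add: c_def r2y r1x r1y matrix_vector_right_distrib matrix_vector_mult_diff_distrib scaleR_diff_right matrix_vector_mult_scaleR vec.neg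
        scaleR_diff_left scaleR_add_right power2_eq_square flip: matrix_vector_mul_assoc)
  \<comment> \<open>A root of \<open>\<beta>^2 + \<rho> \<beta> + 1\<close>, nonreal because
    \<open>\<rho> < 2\<close>. This is the condition for \<open>x + \<beta> y\<close> to be an
    eigenvector, given \<open>cx\<close> and \<open>cy\<close>.\<close>
  define \<beta> where "\<beta> = Complex (- \<rho> / 2) (sqrt (4 - \<rho>^2) / 2)"
  have \<rho>4: "\<rho>^2 < 4" using \<rho>2 u(4) power_strict_mono[of \<rho> 2 2] by simp
  have Im\<beta>: "Im \<beta> \<noteq> 0" using \<rho>4 by (simp add: \<beta>_def)
  have \<beta>: "1 + complex_of_real \<rho> * \<beta> + \<beta>^2 = 0"
  proof -
    have "(sqrt (4 - \<rho>^2) / 2)^2 = (4 - \<rho>^2) / 4" using \<rho>4 by (simp add: power_divide)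
    then show ?thesis by (simp add: complex_eq_iff \<beta>_def Re_power2 Im_power2) (simp add: power2_eq_square field_simps)
  qed
  define v where "v = cvec x + \<beta> *s cvec y"
  define \<mu> where "\<mu> = - 1 - \<beta> * complex_of_real \<rho>"
  have "complexify c *v v = cvec (c *v x) + \<beta> *s cvec (c *v y)"
    by (simp add: v_def matrix_vector_right_distrib vector_scalar_commute complexify_cvec)
  also have "\<dots> = \<mu> *s v"
  proof -
    have "(- x1 + r * y1) + \<beta> * ((- r) * x1 + (r^2 - 1) * y1) = (- 1 - \<beta> * r) * (x1 + \<beta> * y1) + (r * (1 + r * \<beta> + \<beta>^2)) * y1" for x1 y1 r
      by (simp add: power2_eq_square algebra_simps)
    from this[of _ "complex_of_real \<rho>"] \<beta> have
      "(- x1 + complex_of_real \<rho> * y1) + \<beta> * ((- complex_of_real \<rho>) * x1 + ((complex_of_real \<rho>)^2 - 1) * y1) = \<mu> * (x1 + \<beta> * y1)" for x1 y1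
      by (simp add: \<mu>_def)
    then show ?thesis by (simp add: cx cy v_def cvec_def vec_eq_iff distrib_left mult.assoc)
  qed
  finally have cv: "complexify (rprod (as1 @ as2)) *v v = \<mu> *s v" by (simp add: c_def)
  show thesis
  proof (rule that[OF _ _ cv])
    show "set (as1 @ as2) = D" "distinct (as1 @ as2)" using as1 as2 D1 by auto
  next
    fix A assume A: "A \<in> W" "complexify A *v v = v"
    then have "cvec (A *v x) + \<beta> *s cvec (A *v y) = cvec x + \<beta> *s cvec y"
      by (simp add: v_def matrix_vector_right_distrib vector_scalar_commute complexify_cvec)
    then have "A *v x = x \<and> A *v y = y" using cvec_split[OF Im\<beta>] by blast
    then have fixed: "A *v (x + y) = x + y" by (simp add: matrix_vector_right_distrib)
    have xy: "d \<bullet> (x + y) > 0" if "d \<in> D" for d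
      using that x y upos by (auto simp: D_range inner_add_right inner_commute)
    have pos: "b \<bullet> (x + y) > 0" if b: "b \<in> pos z" for b
    proof -
      obtain k where k: "\<forall>d\<in>D. k d \<ge> 0" "b = (\<Sum>d\<in>D. k d *\<^sub>R d)" using b by (rule pos_combination)
      have "b \<noteq> 0" using b by (auto simp: pos_def)
      then obtain d where d: "d \<in> D" "k d \<noteq> 0" using k(2) by (metis (no_types, lifting) scale_zero_left sum.neutral)
      show ?thesis unfolding k(2) inner_sum_left
        using finite_D d k(1) xy
        by (intro sum_pos2[of _ d]) (auto intro!: mult_nonneg_nonneg simp: less_imp_le less_le)
    qed
    have "b \<bullet> (x + y) \<noteq> 0" if "b \<in> roots W" for b
      using pos_or_neg[OF that] pos[of b] pos[of "- b"] by auto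
    then show "A = mat 1" using regular_stabilizer_trivial A(1) fixed by blast
  qed
qed


subsection \<open>Orbits of the Coxeter element on the roots\<close>

text \<open>Each letter \<open>a\<close> adds at most one inversion, namely the root that the tail
  of the word maps to \<open>a\<close>.\<close>

lemma card_inversions:
  assumes "set as \<subseteq> D"
  shows "card {b \<in> pos z. rprod as *v b \<notin> pos z} \<le> length as"
  using assms
proof (induction as)
  case (Cons a as)
  let ?I = "\<lambda>as. {b \<in> pos z. rprod as *v b \<notin> pos z}"
  let ?J = "{b. rprod as *v b = a}"
  obtain B where B: "B ** rprod as = mat 1" using inverse_W[OF rprod_D_W[of as]] Cons by auto
  have "?J \<subseteq> {B *v a}" by (auto simp: matrix_vector_mul_assoc B)
  then have J: "finite ?J" "card ?J \<le> 1" using finite_subset card_mono[of "{B *v a}" ?J] by auto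
  have finI: "finite (?I as)" using finite_roots by (auto simp: pos_def)
  have "?I (a # as) \<subseteq> ?I as \<union> ?J"
    using reflection_pos Cons.prems by (auto simp flip: matrix_vector_mul_assoc)
  then have "card (?I (a # as)) \<le> card (?I as \<union> ?J)" using finI J by (intro card_mono) auto
  also have "\<dots> \<le> card (?I as) + card ?J" by (rule card_Un_le)
  finally show ?case using Cons J by auto
qed auto

text \<open>Every root is one of fewer than \<open>h\<close> iterates of an element of
  \<open>K\<close>, the set of inversions of the Coxeter element, and \<open>K\<close> has at most
  one element per letter.\<close>

lemma card_roots_le:
  assumes as: "set as = D" "distinct as" and h: "h > 0" "((*v) (rprod as) ^^ h) = id"
  shows "card (roots W) \<le> CARD('n) * h"
proof -
  define f where "f = (*v) (rprod as)"
  define K where "K = {b \<in> pos z. f b \<notin> pos z}"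
  have fh: "f ^^ h = id" using h by (simp add: f_def)
  have period: "f ^^ (k + h * j) = f ^^ k" for k j
    by (induction j) (auto simp: funpow_add fh mult_Suc_right add.assoc[symmetric])
  have f_roots: "f b \<in> roots W" if "b \<in> roots W" for b
    unfolding f_def using as that by (intro root_image rprod_D_W) auto
  have fk_roots: "(f ^^ k) b \<in> roots W" if "b \<in> roots W" for b k
    using that f_roots by (induction k) auto
  have f_sum: "f (sum g A) = (\<Sum>a\<in>A. f (g a))" for g :: "nat \<Rightarrow> real^'n" and A
    unfolding f_def by (rule linear_sum[OF matrix_vector_mul_linear])
  \<comment> \<open>The sum of \<open>h\<close> consecutive iterates is fixed by \<open>f\<close>,
    hence 0, so they cannot all lie on one side of the hyperplane orthogonal to \<open>z\<close>. An
    orbit avoiding \<open>K\<close> would remain positive once positive.\<close>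
  have meets: "\<exists>k. (f ^^ k) b \<in> K" if b: "b \<in> roots W" for b
  proof (rule ccontr)
    assume no: "\<nexists>k. (f ^^ k) b \<in> K"
    have sum0: "(\<Sum>k<h. (f ^^ k) b) = 0"
    proof -
      have "f (\<Sum>k<h. (f ^^ k) b) = (\<Sum>k<h. (f ^^ Suc k) b)" by (simp add: f_sum)
      also have "\<dots> = (\<Sum>k<h. (f ^^ k) b)"
        using sum.lessThan_Suc_shift[of "\<lambda>k. (f ^^ k) b" h] by (simp add: fh)
      finally have "\<forall>a\<in>set as. (\<Sum>k<h. (f ^^ k) b) \<bullet> a = 0"
        unfolding f_def using as by (intro rprod_fixed) auto
      then show ?thesis using as by (intro orthogonal_D_zero) (auto simp: inner_commute)
    qed
    have step: "(f ^^ Suc k) b \<in> pos z" if "(f ^^ k) b \<in> pos z" for k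
      using no that by (auto simp: K_def)
    have up: "(f ^^ (k + j)) b \<in> pos z" if "(f ^^ k) b \<in> pos z" for k j
      using that step by (induction j) auto
    show False
    proof (cases "\<exists>k. (f ^^ k) b \<in> pos z")
      case True
      then obtain k0 where k0: "(f ^^ k0) b \<in> pos z" by blast
      have "(f ^^ k) b \<in> pos z" for k
      proof -
        \<comment> \<open>Adding \<open>h * k0\<close> leaves the iterate unchanged but moves its
          index past \<open>k0\<close>.\<close>
        have "k + h * k0 = k0 + (k + h * k0 - k0)" using h by (cases h) auto
        then show ?thesis using up[OF k0, of "k + h * k0 - k0"] period[of k k0] by simp
      qed
      then have "(\<Sum>k<h. (f ^^ k) b \<bullet> z) > 0" using h by (intro sum_pos) (auto simp: pos_def)
      then show False using sum0 by (simp flip: inner_sum_left)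
    next
      case False
      then have "- ((f ^^ k) b) \<in> pos z" for k using pos_or_neg fk_roots b by blast
      then have "(\<Sum>k<h. (- ((f ^^ k) b)) \<bullet> z) > 0" using h by (intro sum_pos) (auto simp: pos_def)
      then show False using sum0 by (simp add: sum_negf flip: inner_sum_left)
    qed
  qed
  have "roots W \<subseteq> (\<lambda>(b, m). (f ^^ m) b) ` (K \<times> {..<h})"
  proof
    fix b assume "b \<in> roots W"
    then obtain k where k: "(f ^^ k) b \<in> K" using meets by blast
    \<comment> \<open>\<open>m\<close> more steps complete \<open>h * k\<close> in all and so undo
      the first \<open>k\<close>.\<close>
    define m where "m = h * k - k"
    have mk: "m + k = h * k" using h by (cases h) (auto simp: m_def)
    have "(f ^^ (m mod h)) ((f ^^ k) b) = (f ^^ (m mod h + h * (m div h))) ((f ^^ k) b)" by (simp only: period)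
    also have "\<dots> = (f ^^ (m + k)) b" by (simp add: funpow_add)
    also have "\<dots> = b" using period[of 0 k] by (simp add: mk)
    finally show "b \<in> (\<lambda>(b, m). (f ^^ m) b) ` (K \<times> {..<h})"
      using k h by (intro image_eqI[of _ _ "((f ^^ k) b, m mod h)"]) auto
  qed
  moreover have finK: "finite K" using finite_roots by (auto simp: K_def pos_def)
  ultimately have "card (roots W) \<le> card ((\<lambda>(b, m). (f ^^ m) b) ` (K \<times> {..<h}))" by (intro card_mono) auto
  also have "\<dots> \<le> card (K \<times> {..<h})" using finK by (intro card_image_le) auto
  also have "\<dots> = card K * h" by (simp add: card_cartesian_product)
  also have "card K \<le> length as" unfolding K_def f_def using as by (intro card_inversions) auto
  also have "length as = CARD('n)" using as card_D distinct_card by metis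
  finally show ?thesis by simp
qed

end


subsection \<open>Composition with matrices\<close>

lemma compose_matrix_add [simp]: "compose_matrix (f + g) A = compose_matrix f A + compose_matrix g A"
  and compose_matrix_mult [simp]: "compose_matrix (f * g) A = compose_matrix f A * compose_matrix g A"
  and compose_matrix_Const [simp]: "compose_matrix (Const c) A = Const c"
  and compose_matrix_sum [simp]: "compose_matrix (sum h I) A = (\<Sum>i\<in>I. compose_matrix (h i) A)"
  by (simp_all add: compose_matrix_def)

lemma compose_matrix_Var:
  "compose_matrix (Var i) A = (\<Sum>j\<in>UNIV. Const (complex_of_real (A $ i $ j)) * Var j)"
  by (simp add: compose_matrix_def)

lemma compose_matrix_diff [simp]: "compose_matrix (f - g) A = compose_matrix f A - compose_matrix g A"
  using compose_matrix_add[of "f - g" g A] by simp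

lemma ev_compose_matrix:
  "ev (compose_matrix f A) (vec_nth u) = ev f (vec_nth (complexify A *v u))"
proof -
  have "(\<lambda>i. \<Sum>j\<in>UNIV. complex_of_real (A $ i $ j) * u $ j) = vec_nth (complexify A *v u)"
    by (simp add: fun_eq_iff complexify_def matrix_vector_mult_def)
  then show ?thesis by (simp add: compose_matrix_def ev_substitute)
qed

lemma compose_matrix_one: "compose_matrix f (mat 1) = f"
proof (induction f rule: cpoly_induct)
  case (Var i)
  have "Const (complex_of_real (mat 1 $ i $ j)) * Var j = (if j = i then Var i else 0)" for j
    by (simp add: mat_def)
  then show ?case unfolding compose_matrix_Var by simp
qed auto

lemma compose_compose_matrix:
  "compose_matrix (compose_matrix f A) B = compose_matrix f (A ** B)"
proof (induction f rule: cpoly_induct)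
  case (Var i)
  have "compose_matrix (compose_matrix (Var i) A) B =
     (\<Sum>j\<in>UNIV. \<Sum>k\<in>UNIV. Const (complex_of_real (A $ i $ j)) * (Const (complex_of_real (B $ j $ k)) * Var k))"
    by (simp add: compose_matrix_Var sum_distrib_left)
  also have "\<dots> = (\<Sum>k\<in>UNIV. \<Sum>j\<in>UNIV. Const (complex_of_real (A $ i $ j)) * (Const (complex_of_real (B $ j $ k)) * Var k))"
    by (rule sum.swap)
  also have "\<dots> = compose_matrix (Var i) (A ** B)"
    by (simp add: compose_matrix_Var matrix_matrix_mult_def Const_sum Const_mult sum_distrib_right mult.assoc)
  finally show ?case .
qed auto

lemma partial_compose_matrix:
  "partial i (compose_matrix f A) =
    (\<Sum>j\<in>UNIV. Const (complex_of_real (A $ j $ i)) * compose_matrix (partial j f) A)"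
proof (induction f rule: cpoly_induct)
  case (Const c)
  have "compose_matrix 0 A = (0 :: 'a cpoly)" using compose_matrix_Const[of 0 A] by simp
  then show ?case by simp
next
  case (Var v)
  have "compose_matrix (partial j (Var v)) A = (if j = v then 1 else 0)" for j
    using compose_matrix_Const[of 0 A] compose_matrix_Const[of 1 A] by simp
  then have "(\<Sum>j\<in>UNIV. Const (complex_of_real (A $ j $ i)) * compose_matrix (partial j (Var v)) A) =
     Const (complex_of_real (A $ v $ i))"
    by (simp add: if_distrib[of "\<lambda>x. _ * x"] cong: if_cong)
  moreover have "partial i (compose_matrix (Var v) A) = Const (complex_of_real (A $ v $ i))"
    by (simp add: compose_matrix_Var if_distrib[of "\<lambda>x. _ * x"] cong: if_cong)
  ultimately show ?case by simp
next
  case (add f g)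
  then show ?case by (simp add: distrib_left sum.distrib)
next
  case (mult f g)
  have "(\<Sum>j\<in>UNIV. Const (complex_of_real (A $ j $ i)) * compose_matrix (partial j (f * g)) A) =
     (\<Sum>j\<in>UNIV. Const (complex_of_real (A $ j $ i)) * compose_matrix (partial j f) A) * compose_matrix g A +
     compose_matrix f A * (\<Sum>j\<in>UNIV. Const (complex_of_real (A $ j $ i)) * compose_matrix (partial j g) A)"
    unfolding sum_distrib_left sum_distrib_right sum.distrib[symmetric]
    by (intro sum.cong refl) (simp add: distrib_left mult.assoc mult.left_commute)
  then show ?case using mult by simp
qed

lemma vanishes_compose_matrix:
  "vanishes k f (vec_nth (complexify A *v u)) \<Longrightarrow> vanishes k (compose_matrix f A) (vec_nth u)"
proof (induction k arbitrary: f)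
  case (Suc k)
  then show ?case
    unfolding vanishes.simps partial_compose_matrix
    by (auto simp: ev_compose_matrix intro!: vanishes_sum vanishes_mult_left)
qed auto


subsection \<open>Determinants\<close>

lemma tendsto_det:
  fixes M :: "'a \<Rightarrow> complex^'n^'n"
  assumes "\<And>i j. ((\<lambda>t. M t $ i $ j) \<longlongrightarrow> L $ i $ j) F"
  shows "((\<lambda>t. det (M t)) \<longlongrightarrow> det L) F"
  unfolding det_def by (intro tendsto_sum tendsto_mult tendsto_const tendsto_prod assms)

text \<open>An orthogonal matrix carrying a basis vector to \<open>a\<close> conjugates
  \<open>1 + c a a\<^sup>T\<close> to a diagonal matrix with one entry \<open>1 + c\<close> and all
  others 1.\<close>

lemma det_rank_one_update:
  fixes a :: "real^'n"
  assumes "norm a = 1"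
  shows "det (\<chi> i j. (if i = j then 1 else 0) + c * complex_of_real (a $ i * a $ j)) = 1 + c"
proof -
  define K where "K b = (\<chi> i j. (if i = j then 1 else 0) + c * complex_of_real (b $ i * b $ j))" for b :: "real^'n"
  obtain R k where R: "orthogonal_matrix R" "R *v axis k 1 = a"
    using orthogonal_matrix_exists_basis[OF assms] by metis
  have aR: "a $ i = R $ i $ k" for i
    using R(2) by (auto simp: matrix_vector_mult_basis column_def)
  have RR: "complexify R ** complexify (transpose R) = mat 1"
    using R(1) by (simp add: orthogonal_matrix_def complexify_one flip: complexify_mult)
  define E where "E = (\<chi> i j. if i = k \<and> j = k then c else 0)"
  have K_axis: "K (axis k 1) = mat 1 + E" by (simp add: vec_eq_iff K_def E_def mat_def axis_def)
  have "complexify R ** E ** complexify (transpose R) = (\<chi> i j. c * complex_of_real (a $ i * a $ j))"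
  proof -
    have 1: "(complexify R ** E) $ i $ j = (if j = k then complexify R $ i $ k * c else 0)" for i j
      by (cases "j = k") (simp_all add: matrix_matrix_mult_def E_def if_distrib[of "\<lambda>x. _ * x"] cong: if_cong)
    have "(complexify R ** E ** complexify (transpose R)) $ i $ j =
        (\<Sum>l\<in>UNIV. if l = k then complexify R $ i $ k * c * complexify (transpose R) $ k $ j else 0)" for i j
      unfolding matrix_matrix_mult_def[of "complexify R ** E"] vec_lambda_beta
      by (intro sum.cong refl) (simp add: 1)
    then show ?thesis by (simp add: vec_eq_iff aR complexify_def transpose_def)
  qed
  moreover have "(X + Y) ** Z = X ** Z + Y ** Z" for X Y Z :: "complex^'n^'n"
    by (simp add: vec_eq_iff matrix_matrix_mult_def distrib_right sum.distrib)
  ultimately have "K a = complexify R ** K (axis k 1) ** complexify (transpose R)"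
    unfolding K_axis by (simp add: matrix_add_ldistrib RR) (simp add: vec_eq_iff K_def mat_def)
  then have "det (K a) = det (K (axis k 1)) * (det (complexify R) * det (complexify (transpose R)))"
    by (simp add: det_mul)
  also have "det (complexify R) * det (complexify (transpose R)) = 1"
    by (simp add: RR flip: det_mul)
  also have "det (K (axis k 1)) = (\<Prod>i\<in>UNIV. K (axis k 1) $ i $ i)"
    by (rule det_diagonal) (auto simp: K_def axis_def)
  also have "\<dots> = (\<Prod>i\<in>UNIV. if i = k then 1 + c else 1)"
    by (intro prod.cong) (auto simp: K_def axis_def)
  finally show ?thesis by (simp add: K_def)
qed

lemma ex_poly_det_ev:
  "\<exists>P. \<forall>t. poly P t = det (\<chi> i j :: 'n::finite. ev (F i j) (\<lambda>i. x i + t * y i))"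
proof -
  define Q where "Q i j = (SOME P. \<forall>t. poly P t = ev (F i j) (\<lambda>i. x i + t * y i))" for i j
  have Q: "poly (Q i j) t = ev (F i j) (\<lambda>i. x i + t * y i)" for i j t
    unfolding Q_def using someI_ex[OF ex_poly_ev_line[of "F i j" x y]] by blast
  show ?thesis
    by (rule exI[of _ "\<Sum>\<pi> | \<pi> permutes UNIV. of_int (sign \<pi>) * (\<Prod>i\<in>UNIV. Q i (\<pi> i))"])
      (simp add: det_def poly_sum poly_prod Q)
qed

text \<open>A multiple \<open>e\<close> of the new vector is added; each of the finitely many
  hyperplanes excludes at most one value of \<open>e\<close>.\<close>

lemma ex_generic_vector:
  fixes S :: "(real^'n) set"
  assumes "finite S" "0 \<notin> S"
  shows "\<exists>x. \<forall>a\<in>S. a \<bullet> x \<noteq> 0"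
  using assms
proof (induction S)
  case (insert a S)
  then obtain x where x: "\<forall>b\<in>S. b \<bullet> x \<noteq> 0" by auto
  have "finite {- (b \<bullet> x) / (b \<bullet> a) | b. b \<in> insert a S}" using insert by auto
  then obtain e where e: "e \<notin> {- (b \<bullet> x) / (b \<bullet> a) | b. b \<in> insert a S}"
    using ex_new_if_finite[OF infinite_UNIV_char_0] by blast
  have "b \<bullet> (x + e *\<^sub>R a) \<noteq> 0" if b: "b \<in> insert a S" for b
  proof (cases "b \<bullet> a = 0")
    case True
    then have "b \<noteq> a" using insert by auto
    then show ?thesis using True x b by (simp add: inner_add_right)
  next
    case False
    have "e \<noteq> - (b \<bullet> x) / (b \<bullet> a)" using e b by blast
    then show ?thesis using False by (simp add: inner_add_right field_simps)
  qed
  then show ?case by blast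
qed auto

lemma vec_line: "vec_nth (x + t *s y) = (\<lambda>i. x $ i + t * y $ i)"
  by auto


subsection \<open>Invariants with prescribed jets\<close>

context refl_group
begin

lemma symmetrization_invariant: "(\<Sum>A\<in>W. compose_matrix r A) \<in> invariants W"
  unfolding invariants_def
proof (intro CollectI ballI)
  fix B assume B: "B \<in> W"
  obtain C where C: "C \<in> W" "C ** B = mat 1" "B ** C = mat 1" using inverse_W[OF B] .
  have "compose_matrix (\<Sum>A\<in>W. compose_matrix r A) B = (\<Sum>A\<in>W. compose_matrix r (A ** B))"
    by (simp add: compose_compose_matrix)
  also have "\<dots> = (\<Sum>A\<in>W. compose_matrix r A)"
    by (rule sum.reindex_bij_witness[of _ "\<lambda>A. A ** C" "\<lambda>A. A ** B"])
      (auto simp: B C mult_W simp flip: matrix_mul_assoc)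
  finally show "compose_matrix (\<Sum>A\<in>W. compose_matrix r A) B = (\<Sum>A\<in>W. compose_matrix r A)" .
qed

text \<open>\<open>E * r\<close> is symmetrized, with \<open>E\<close> a bump at \<open>v\<close>
  that is flat at the other points of the orbit. Group elements moving \<open>v\<close> contribute
  nothing up to order 3; those fixing it contribute their copy of \<open>r\<close>.\<close>

lemma ex_invariant_jet:
  "\<exists>f\<in>invariants W. vanishes 3 (f - (\<Sum>A | A \<in> W \<and> complexify A *v v = v. compose_matrix r A)) (vec_nth v)"
proof -
  let ?T = "{A \<in> W. complexify A *v v = v}"
  let ?B = "(\<lambda>A. vec_nth (complexify A *v v)) ` (W - ?T)"
  have "vec_nth v \<notin> ?B" by (auto simp: vec_eq_iff fun_eq_iff)
  moreover have "finite ?B" using finite_W by auto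
  ultimately obtain E where E: "vanishes 3 (E - 1) (vec_nth v)" "\<forall>u\<in>?B. vanishes 3 E u"
    using ex_bump by blast
  define f where "f = (\<Sum>A\<in>W. compose_matrix (E * r) A)"
  have "f = (\<Sum>A\<in>?T. compose_matrix (E * r) A) + (\<Sum>A\<in>W - ?T. compose_matrix (E * r) A)"
    unfolding f_def using finite_W by (subst sum.subset_diff[of ?T]) (auto simp: add.commute)
  then have "f - (\<Sum>A\<in>?T. compose_matrix r A) =
      (\<Sum>A\<in>?T. compose_matrix ((E - 1) * r) A) + (\<Sum>A\<in>W - ?T. compose_matrix (E * r) A)"
    by (simp add: left_diff_distrib sum_subtractf)
  also have "vanishes 3 \<dots> (vec_nth v)"
  proof (intro vanishes_add vanishes_sum vanishes_compose_matrix)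
    fix A assume "A \<in> ?T"
    then show "vanishes 3 ((E - 1) * r) (vec_nth (complexify A *v v))"
      using E(1) by (auto intro: vanishes_mult_right)
  next
    fix A assume "A \<in> W - ?T"
    then show "vanishes 3 (E * r) (vec_nth (complexify A *v v))"
      using E(2) by (auto intro: vanishes_mult_right)
  qed
  finally show ?thesis using symmetrization_invariant[of "E * r"] unfolding f_def by blast
qed

end

text \<open>The chain rule without its coefficients: polynomials whose gradient is a combination of
  those of the \<open>p k\<close> are closed under the ring operations.\<close>

lemma image_substitute_gradient:
  fixes p :: "'v \<Rightarrow> 'u cpoly"
  assumes "f \<in> substitute p ` cpolys_in I" "finite I"
  shows "\<exists>C. \<forall>j. partial j f = (\<Sum>k\<in>I. C k * partial j (p k))"
proof -
  define X where "X f \<longleftrightarrow> (\<exists>C. \<forall>j. partial j f = (\<Sum>k\<in>I. C k * partial j (p k)))" for f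
  have X_Const: "X (Const c)" for c
    unfolding X_def by (rule exI[of _ "\<lambda>_. 0"]) simp
  have X_add: "X (f + g)" if fg: "X f" "X g" for f g
  proof -
    obtain C C' where "\<forall>j. partial j f = (\<Sum>k\<in>I. C k * partial j (p k))"
      "\<forall>j. partial j g = (\<Sum>k\<in>I. C' k * partial j (p k))" using fg by (auto simp: X_def)
    then show ?thesis unfolding X_def
      by (intro exI[of _ "\<lambda>k. C k + C' k"]) (simp add: distrib_right sum.distrib)
  qed
  have X_mult: "X (f * g)" if fg: "X f" "X g" for f g
  proof -
    obtain C C' where "\<forall>j. partial j f = (\<Sum>k\<in>I. C k * partial j (p k))"
      "\<forall>j. partial j g = (\<Sum>k\<in>I. C' k * partial j (p k))" using fg by (auto simp: X_def)
    then show ?thesis unfolding X_def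
      by (intro exI[of _ "\<lambda>k. g * C k + f * C' k"])
        (simp add: distrib_right sum.distrib mult.assoc mult.commute[of _ g] flip: sum_distrib_left)
  qed
  have X_0: "X 0" and X_1: "X 1" using X_Const[of 0] X_Const[of 1] by simp_all
  have X_sum: "(\<And>a. a \<in> A \<Longrightarrow> X (h a)) \<Longrightarrow> X (sum h A)" for h and A :: "('v \<Rightarrow>\<^sub>0 nat) set"
    by (induction A rule: infinite_finite_induct) (auto intro: X_add X_0)
  have X_prod: "(\<And>a. a \<in> A \<Longrightarrow> X (h a)) \<Longrightarrow> X (prod h A)" for h and A :: "'v set"
    by (induction A rule: infinite_finite_induct) (auto intro: X_mult X_1)
  have X_power: "X f \<Longrightarrow> X (f ^ n)" for f n
    by (induction n) (auto intro: X_mult X_1)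
  have X_p: "X (p k)" if "k \<in> I" for k
    unfolding X_def using that assms(2)
    by (intro exI[of _ "\<lambda>k'. if k' = k then 1 else 0"]) (simp add: if_distrib[of "\<lambda>x. x * _"] cong: if_cong)
  obtain Q where Q: "f = substitute p Q" "\<And>e. e \<in> Poly_Mapping.keys Q \<Longrightarrow> Poly_Mapping.keys e \<subseteq> I"
    using assms(1) by (auto simp: cpolys_in_def)
  have "X f" unfolding Q(1) substitute_def
    by (intro X_sum X_mult X_Const X_prod X_power X_p) (use Q(2) in blast)
  then show ?thesis by (simp add: X_def)
qed


subsection \<open>The Jacobian of the basic invariants\<close>

text \<open>\<open>\<kappa>\<close> relabels the invariants by the coordinate type, so that the
  Jacobian is a square matrix with a determinant.\<close>

locale reflection_invariants = refl_group W for W :: "(real^'n^'n) set" +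
  fixes p :: "nat \<Rightarrow> 'n cpoly" and w m :: "nat \<Rightarrow> nat" and \<kappa> :: "'n \<Rightarrow> nat"
  assumes basic: "basic_invariants W p w"
    and w_eq: "i \<in> {1..CARD('n)} \<Longrightarrow> w i = m i + 1"
    and \<kappa>: "bij_betw \<kappa> UNIV {1..CARD('n)}"
begin

lemma \<kappa>_range: "\<kappa> i \<in> {1..CARD('n)}"
  using \<kappa> by (auto simp: bij_betw_def)

lemma p_homogeneous: "homogeneous (m (\<kappa> i) + 1) (p (\<kappa> i))"
proof -
  have "homogeneous (w (\<kappa> i)) (p (\<kappa> i))"
    using basic \<kappa>_range[of i] by (simp add: basic_invariants_def)
  then show ?thesis by (simp only: w_eq[OF \<kappa>_range])
qed

lemma p_invariant: "compose_matrix (p (\<kappa> i)) A = p (\<kappa> i)" if "A \<in> W"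
proof -
  have "Var (\<kappa> i) \<in> cpolys_in {1..CARD('n)}"
    using \<kappa>_range[of i] by (auto simp: cpolys_in_def Var_def)
  then have "substitute p (Var (\<kappa> i)) \<in> invariants W"
    using basic unfolding basic_invariants_def by blast
  then show ?thesis using that by (simp add: invariants_def)
qed

definition jac :: "complex^'n \<Rightarrow> complex^'n^'n" where
  "jac u = (\<chi> i j. ev (partial j (p (\<kappa> i))) (vec_nth u))"

text \<open>Hence the Jacobian determinant of any such family of invariants is a polynomial multiple
  of that of the basic ones.\<close>

lemma gradient_matrix:
  assumes "\<And>i. f i \<in> invariants W"
  obtains C where "\<And>u. (\<chi> i j. ev (partial j (f i)) (vec_nth u)) = (\<chi> i k. ev (C i k) (vec_nth u)) ** jac u"
proof -
  have "\<exists>C. \<forall>j. partial j (f i) = (\<Sum>k\<in>{1..CARD('n)}. C k * partial j (p k))" for i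
    using assms[of i] basic by (intro image_substitute_gradient) (auto simp: basic_invariants_def)
  then have "\<forall>i. \<exists>C. \<forall>j. partial j (f i) = (\<Sum>k\<in>{1..CARD('n)}. C k * partial j (p k))" by blast
  from choice[OF this] obtain C
    where C: "\<And>i j. partial j (f i) = (\<Sum>k\<in>{1..CARD('n)}. C i k * partial j (p k))" by blast
  have "partial j (f i) = (\<Sum>k\<in>UNIV. C i (\<kappa> k) * partial j (p (\<kappa> k)))" for i j
    unfolding C by (rule sum.reindex_bij_betw[OF \<kappa>, symmetric])
  then show thesis
    by (intro that[of "\<lambda>i k. C i (\<kappa> k)"]) (simp add: vec_eq_iff matrix_matrix_mult_def jac_def)
qed

text \<open>With trivial stabilizer there are invariants agreeing with the coordinate functions to
  third order at \<open>v\<close>. Their Jacobian matrix there is the identity, and it factors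
  through \<open>jac v\<close>.\<close>

lemma jac_nonzero:
  assumes "\<And>A. A \<in> W \<Longrightarrow> complexify A *v v = v \<Longrightarrow> A = mat 1"
  shows "det (jac v) \<noteq> 0"
proof -
  have T: "{A \<in> W. complexify A *v v = v} = {mat 1}"
  proof (intro equalityI subsetI)
    fix A assume "A \<in> {A \<in> W. complexify A *v v = v}"
    then show "A \<in> {mat 1}" using assms[of A] by simp
  qed (simp add: one_W complexify_one)
  have "\<forall>i. \<exists>f. f \<in> invariants W \<and> vanishes 3 (f - Var i) (vec_nth v)"
  proof
    fix i
    show "\<exists>f. f \<in> invariants W \<and> vanishes 3 (f - Var i) (vec_nth v)"
      using ex_invariant_jet[where v = v and r = "Var i"] unfolding T by (auto simp: compose_matrix_one)
  qed
  from choice[OF this] obtain f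
    where f: "\<And>i. f i \<in> invariants W" "\<And>i. vanishes 3 (f i - Var i) (vec_nth v)" by blast
  obtain C where C: "\<And>u. (\<chi> i j. ev (partial j (f i)) (vec_nth u)) = (\<chi> i k. ev (C i k) (vec_nth u)) ** jac u"
    using gradient_matrix[of f] f(1) by blast
  have "ev (partial j (f i)) (vec_nth v) = (if i = j then 1 else 0)" for i j
  proof -
    have "ev (partial j (f i - Var i)) (vec_nth v) = 0"
      using f(2)[of i] unfolding numeral_3_eq_3 vanishes.simps by blast
    then show ?thesis by (simp split: if_splits)
  qed
  then have "mat 1 = (\<chi> i k. ev (C i k) (vec_nth v)) ** jac v"
    unfolding C[symmetric] by (simp add: mat_def)
  from arg_cong[OF this, of det] show ?thesis by (auto simp: det_mul)
qed

lemma jac_homogeneous: "det (jac (t *s u)) = t ^ (\<Sum>i\<in>UNIV. m (\<kappa> i)) * det (jac u)"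
proof -
  have "ev (partial j (p (\<kappa> i))) (vec_nth (t *s u)) = t ^ m (\<kappa> i) * ev (partial j (p (\<kappa> i))) (vec_nth u)" for i j
  proof -
    have "vec_nth (t *s u) = (\<lambda>i. t * u $ i)" by auto
    then show ?thesis
      using ev_homogeneous[OF homogeneous_partial[OF p_homogeneous], of j i t "vec_nth u"] by simp
  qed
  then have "jac (t *s u) = (\<chi> i. t ^ m (\<kappa> i) *s jac u $ i)"
    by (simp add: jac_def vec_eq_iff)
  then show ?thesis by (simp add: det_rows_mul power_sum)
qed

text \<open>
  Invariants whose gradients at \<open>q + t y\<close> are, up to \<open>o(t)\<close>, the rows of twice
  \<open>1 - a a\<^sup>T + t (y \<bullet> a) a a\<^sup>T\<close> have a Jacobian with a simple zero at \<open>t = 0\<close>; it is a multiple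
  of the Jacobian of the basic invariants.
\<close>

lemma jac_simple_zero:
  assumes a: "a \<in> roots W" and qa: "q \<bullet> a = 0"
    and only: "\<And>b. b \<in> roots W \<Longrightarrow> q \<bullet> b = 0 \<Longrightarrow> b = a \<or> b = - a"
    and ya: "y \<bullet> a \<noteq> 0"
    and sq: "\<And>t. det (jac (cvec q + t *s cvec y)) = t ^ 2 * poly j t"
  shows False
proof -
  let ?a = "\<lambda>i. complex_of_real (a $ i)"
  let ?s = "reflection_matrix a"
  have aa: "(\<Sum>i\<in>UNIV. ?a i * ?a i) = 1"
    using root_inner[OF a] by (simp add: inner_vec_def flip: of_real_mult of_real_sum)
  have s_entry: "?s $ i $ k = (if i = k then 1 else 0) - 2 * (a $ i * a $ k)" for i k
  proof -
    have "?s $ i $ k = (?s *v axis k 1) $ i" by (simp add: matrix_vector_mult_basis column_def)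
    also have "\<dots> = axis k 1 $ i - 2 * a $ k * a $ i" by (simp add: root_mult[OF a] inner_axis')
    finally show ?thesis by (simp add: axis_def mult.commute)
  qed
  have stab: "{A \<in> W. complexify A *v cvec q = cvec q} = {mat 1, ?s}"
  proof (intro equalityI subsetI)
    fix A assume "A \<in> {A \<in> W. complexify A *v cvec q = cvec q}"
    then have A: "A \<in> W" "A *v q = q" by (auto simp: complexify_cvec cvec_eq_iff)
    have "(A *v a) \<bullet> q = 0" using W_orthogonal[OF A(1), of a q] A qa by (simp add: inner_commute)
    then consider "A *v a = a" | "A *v a = - a" using only[OF root_image[OF A(1) a]] by (auto simp: inner_commute)
    \<comment> \<open>Such an element fixes \<open>q + e a\<close>, which is regular for generic
      \<open>e\<close>, since only the hyperplane of \<open>a\<close> passes through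
      \<open>q\<close>.\<close>
    moreover have triv: "B = mat 1" if B: "B \<in> W" "B *v q = q" "B *v a = a" for B
    proof -
      have "finite ((\<lambda>b. - (q \<bullet> b) / (a \<bullet> b)) ` roots W \<union> {0})" using finite_roots by auto
      then obtain e where e: "e \<notin> (\<lambda>b. - (q \<bullet> b) / (a \<bullet> b)) ` roots W \<union> {0}"
        using ex_new_if_finite[OF infinite_UNIV_char_0] by blast
      have "b \<bullet> (q + e *\<^sub>R a) \<noteq> 0" if b: "b \<in> roots W" for b
      proof (cases "a \<bullet> b = 0")
        case True
        then have "q \<bullet> b \<noteq> 0" using only[OF b] root_inner[OF a] by auto
        then show ?thesis using True by (simp add: inner_add_right inner_commute)
      next
        case False
        have "e \<noteq> - (q \<bullet> b) / (a \<bullet> b)" using e b by blast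
        then have "e * (a \<bullet> b) + q \<bullet> b \<noteq> 0" using False by (simp add: field_simps eq_neg_iff_add_eq_0)
        then show ?thesis by (simp add: inner_add_right inner_commute add.commute)
      qed
      moreover have "B *v (q + e *\<^sub>R a) = q + e *\<^sub>R a"
        by (simp add: B matrix_vector_right_distrib matrix_vector_mult_scaleR)
      ultimately show ?thesis using regular_stabilizer_trivial B(1) by blast
    qed
    ultimately show "A \<in> {mat 1, ?s}"
    proof cases
      case 1
      then show ?thesis using triv A by simp
    next
      case 2
      have sa: "?s *v a = - a" and sq: "?s *v q = q" using a qa by (simp_all add: root_mult root_inner scaleR_2)
      have "A ** ?s = mat 1"
        using A a 2 by (intro triv mult_W root_reflection) (simp_all add: sa sq vec.neg flip: matrix_vector_mul_assoc)
      then have "A ** (?s ** ?s) = ?s" by (simp add: matrix_mul_assoc)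
      then show ?thesis using a by (simp add: reflection_matrix_involution root_norm)
    qed
  next
    fix A assume "A \<in> {mat 1, ?s}"
    then show "A \<in> {A \<in> W. complexify A *v cvec q = cvec q}"
      using a one_W root_reflection qa by (auto simp: complexify_one complexify_cvec root_mult)
  qed
  have s_ne: "?s \<noteq> mat 1"
  proof
    assume "?s = mat 1"
    then have "?s *v a = a" by simp
    then have "(?s *v a) \<bullet> a = a \<bullet> a" by simp
    then show False using a by (simp add: root_mult root_inner inner_diff_left)
  qed
  define L where "L = (\<Sum>k\<in>UNIV. Const (?a k) * Var k)"
  have compose_Var: "compose_matrix (Var i) ?s = Var i - Const (2 * ?a i) * L" for i
  proof -
    have "compose_matrix (Var i) ?s = (\<Sum>k\<in>UNIV. (if k = i then Var i else 0) - Const (2 * ?a i) * (Const (?a k) * Var k))"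
      unfolding compose_matrix_Var
    proof (intro sum.cong refl)
      fix k
      have "Const (complex_of_real (?s $ i $ k)) = (Const (if i = k then 1 else 0) - Const (2 * ?a i) * Const (?a k) :: 'n cpoly)"
        by (cases "i = k") (simp_all add: s_entry Const_diff Const_uminus Const_mult mult.assoc)
      then show "Const (complex_of_real (?s $ i $ k)) * Var k =
          (if k = i then Var i else 0) - Const (2 * ?a i) * (Const (?a k) * Var k)"
        by (cases "i = k") (simp_all add: left_diff_distrib mult.assoc)
    qed
    also have "\<dots> = Var i - Const (2 * ?a i) * L"
      by (simp add: sum_subtractf L_def sum_distrib_left)
    finally show ?thesis .
  qed
  have compose_lin: "compose_matrix (\<Sum>k\<in>UNIV. Const (g k) * Var k) ?s =
      (\<Sum>k\<in>UNIV. Const (g k) * Var k) - Const (2 * (\<Sum>k\<in>UNIV. g k * ?a k)) * L" for g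
  proof -
    have "(\<Sum>k\<in>UNIV. Const (g k) * (Const (2 * ?a k) * L)) = Const (\<Sum>k\<in>UNIV. g k * (2 * ?a k)) * L"
      by (simp add: Const_sum Const_mult sum_distrib_right mult.assoc)
    also have "(\<Sum>k\<in>UNIV. g k * (2 * ?a k)) = 2 * (\<Sum>k\<in>UNIV. g k * ?a k)"
      by (simp add: sum_distrib_left mult.left_commute)
    finally show ?thesis by (simp add: compose_Var right_diff_distrib sum_subtractf)
  qed
  have compose_L: "compose_matrix L ?s = - L"
  proof -
    have "Const 2 = (2 :: 'n cpoly)" by (simp add: Const_def)
    then show ?thesis unfolding L_def by (subst compose_lin) (simp add: aa L_def)
  qed
  define b where "b i k = (if i = k then 1 else 0) - ?a i * ?a k" for i k
  have ba: "(\<Sum>k\<in>UNIV. b i k * ?a k) = 0" for i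
  proof -
    have "(\<Sum>k\<in>UNIV. b i k * ?a k) = (\<Sum>k\<in>UNIV. (if k = i then ?a i else 0) - ?a i * (?a k * ?a k))"
      by (intro sum.cong) (auto simp: b_def left_diff_distrib)
    then show ?thesis by (simp add: sum_subtractf aa flip: sum_distrib_left)
  qed
  \<comment> \<open>The linear part is row \<open>i\<close> of the projection
    \<open>1 - a a\<^sup>T\<close>, unchanged by \<open>?s\<close> because the projection kills
    \<open>a\<close>; the square is unchanged because \<open>?s\<close> negates \<open>L\<close>.
    The \<open>1/2\<close> cancels the 2 from differentiating the square.\<close>
  define r where "r i = (\<Sum>k\<in>UNIV. Const (b i k) * Var k) + Const (?a i / 2) * (L * L)" for i
  have r_inv: "compose_matrix (r i) ?s = r i" for i
    by (simp only: r_def compose_matrix_add compose_matrix_mult compose_matrix_Const compose_lin compose_L ba) simp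
  \<comment> \<open>The stabilizer of \<open>q\<close> has two elements and both preserve
    \<open>r i\<close>, so the sum over it counts \<open>r i\<close> twice.\<close>
  have "\<forall>i. \<exists>f. f \<in> invariants W \<and> vanishes 3 (f - (r i + r i)) (vec_nth (cvec q))"
  proof
    fix i
    have "(\<Sum>A\<in>{mat 1, ?s}. compose_matrix (r i) A) = r i + r i"
      using s_ne[symmetric] by (simp add: compose_matrix_one r_inv)
    then show "\<exists>f. f \<in> invariants W \<and> vanishes 3 (f - (r i + r i)) (vec_nth (cvec q))"
      using ex_invariant_jet[where v = "cvec q" and r = "r i"] unfolding stab by auto
  qed
  from choice[OF this] obtain f where f: "\<And>i. f i \<in> invariants W"
    "\<And>i. vanishes 3 (f i - (r i + r i)) (vec_nth (cvec q))" by blast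
  obtain C where C: "\<And>u. (\<chi> i j. ev (partial j (f i)) (vec_nth u)) = (\<chi> i k. ev (C i k) (vec_nth u)) ** jac u"
    using gradient_matrix[of f] f(1) by blast
  define \<tau> where "\<tau> = complex_of_real (y \<bullet> a)"
  have \<tau>: "\<tau> \<noteq> 0" using ya by (simp add: \<tau>_def)
  let ?u = "\<lambda>t. vec_nth (cvec q + t *s cvec y)"
  have L_line: "ev L (?u t) = t * \<tau>" for t
  proof -
    have "ev L (?u t) = complex_of_real (q \<bullet> a) + t * complex_of_real (y \<bullet> a)"
      by (simp add: L_def cvec_def inner_vec_def algebra_simps sum.distrib sum_distrib_left)
    then show ?thesis by (simp add: qa \<tau>_def)
  qed
  have partial_r: "ev (partial j (r i)) (?u t) = b i j + t * \<tau> * (?a i * ?a j)" for i j t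
  proof -
    have pL: "partial j L = Const (?a j)"
      by (simp add: L_def if_distrib[of "\<lambda>x. _ * x"] cong: if_cong)
    have "partial j (\<Sum>k\<in>UNIV. Const (b i k) * Var k) = Const (b i j)"
      by (simp add: if_distrib[of "\<lambda>x. _ * x"] cong: if_cong)
    then have "partial j (r i) = Const (b i j) + Const (?a i / 2) * (Const (?a j) * L + L * Const (?a j))"
      unfolding r_def by (simp add: pL)
    then show ?thesis by (simp only: ev_add ev_mult ev_Const L_line) (simp add: field_simps)
  qed
  define E where "E i j t = ev (partial j (f i - (r i + r i))) (?u t)" for i j t
  \<comment> \<open>A derivative of a remainder of order 3 has order 2 and is \<open>o(t)\<close> on
    the line; this absorbs the simple pole of \<open>Q\<close> below.\<close>
  have E0: "((\<lambda>t. E i j t / t) \<longlongrightarrow> 0) (at 0)" for i j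
  proof -
    have "vanishes 2 (partial j (f i - (r i + r i))) (vec_nth (cvec q))"
      using f(2)[of i] by (simp add: numeral_2_eq_2 numeral_3_eq_3)
    from tendsto_vanishes_quotient[OF this, of "vec_nth (cvec y)"] show ?thesis
      by (simp add: E_def vec_line)
  qed
  have E1: "((\<lambda>t. E i j t) \<longlongrightarrow> 0) (at 0)" for i j
  proof -
    have "((\<lambda>t. E i j t / t * t) \<longlongrightarrow> 0 * 0) (at 0)"
      by (intro tendsto_mult E0 tendsto_ident_at)
    moreover have "\<forall>\<^sub>F t in at 0. E i j t / t * t = E i j t"
      by (auto simp: eventually_at_filter)
    ultimately show ?thesis by (simp add: tendsto_cong)
  qed
  \<comment> \<open>The inverse of \<open>1 - a a\<^sup>T + t \<tau> a a\<^sup>T\<close> for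
    \<open>t \<noteq> 0\<close>, so that \<open>Q t ** G t\<close> tends to twice the
    identity.\<close>
  define Q where "Q t = (\<chi> i j. (if i = j then 1 else 0) + (1 / (t * \<tau>) - 1) * complex_of_real (a $ i * a $ j))" for t
  define G where "G t = (\<chi> i j. ev (partial j (f i)) (?u t))" for t
  have QG: "(Q t ** G t) $ i $ j = (if i = j then 2 else 0) + (\<Sum>k\<in>UNIV. b i k * E k j t + ?a i * ?a k / \<tau> * (E k j t / t))"
    if t: "t \<noteq> 0" for t i j
  proof -
    have Qe: "Q t $ i $ k = b i k + ?a i * ?a k / (t * \<tau>)" for i k
      by (simp add: Q_def b_def algebra_simps)
    have Ge: "G t $ k $ j = 2 * (b k j + t * \<tau> * (?a k * ?a j)) + E k j t" for k j
      using partial_r[of j k t] by (simp add: G_def E_def)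
    have bb: "(\<Sum>k\<in>UNIV. b i k * b k j) = b i j"
    proof -
      have "b i k * b k j = (if k = j then b i k else 0) - b i k * ?a k * ?a j" for k
        by (simp add: b_def[of k j] right_diff_distrib mult.assoc)
      then have "(\<Sum>k\<in>UNIV. b i k * b k j) = b i j - (\<Sum>k\<in>UNIV. b i k * ?a k) * ?a j"
        by (simp add: sum_subtractf sum_distrib_right)
      then show ?thesis by (simp add: ba)
    qed
    have b_sym: "b k j = b j k" for k by (cases "k = j") (simp_all add: b_def mult.commute)
    have ab: "(\<Sum>k\<in>UNIV. ?a k * b k j) = 0"
      using ba[of j] by (simp only: b_sym mult.commute[of "?a _"])
    have expand: "(B + A * K / (t * \<tau>)) * (2 * (C + t * \<tau> * (K * J)) + e) =
        2 * (B * C) + 2 * t * \<tau> * J * (B * K) + 2 * A / (t * \<tau>) * (K * C) + 2 * A * J * (K * K) +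
        (B * e + A * K / \<tau> * (e / t))" for A B C J K e :: complex
      using t \<tau> by (simp add: field_simps)
    have "(Q t ** G t) $ i $ j = (\<Sum>k\<in>UNIV. 2 * (b i k * b k j) + 2 * t * \<tau> * ?a j * (b i k * ?a k) +
        2 * ?a i / (t * \<tau>) * (?a k * b k j) + 2 * ?a i * ?a j * (?a k * ?a k) +
        (b i k * E k j t + ?a i * ?a k / \<tau> * (E k j t / t)))"
      unfolding matrix_matrix_mult_def vec_lambda_beta Qe Ge expand ..
    also have "\<dots> = 2 * b i j + 2 * t * \<tau> * ?a j * 0 + 2 * ?a i / (t * \<tau>) * 0 + 2 * ?a i * ?a j * 1 +
        (\<Sum>k\<in>UNIV. b i k * E k j t + ?a i * ?a k / \<tau> * (E k j t / t))"
      by (simp only: sum.distrib bb ba ab aa flip: sum_distrib_left)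
    finally show ?thesis by (simp add: b_def)
  qed
  have lim1: "((\<lambda>t. det (Q t ** G t)) \<longlongrightarrow> det (\<chi> i j :: 'n. if i = j then 2 else 0)) (at 0)"
  proof (rule tendsto_det)
    fix i j
    have "((\<lambda>t. (if i = j then 2 else 0) + (\<Sum>k\<in>UNIV. b i k * E k j t + ?a i * ?a k / \<tau> * (E k j t / t))) \<longlongrightarrow>
        (if i = j then 2 else 0) + (\<Sum>k\<in>(UNIV :: 'n set). b i k * 0 + ?a i * ?a k / \<tau> * 0)) (at 0)"
      by (intro tendsto_add tendsto_const tendsto_sum tendsto_mult_left E0 E1)
    moreover have "\<forall>\<^sub>F t in at 0. (if i = j then 2 else 0) + (\<Sum>k\<in>UNIV. b i k * E k j t + ?a i * ?a k / \<tau> * (E k j t / t)) =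
        (Q t ** G t) $ i $ j"
      using QG by (auto simp: eventually_at_filter)
    ultimately show "((\<lambda>t. (Q t ** G t) $ i $ j) \<longlongrightarrow> (\<chi> i j :: 'n. if i = j then 2 else 0) $ i $ j) (at 0)"
      by (simp add: tendsto_cong)
  qed
  obtain P where P: "\<And>t. poly P t = det (\<chi> i k. ev (C i k) (\<lambda>i. cvec q $ i + t * cvec y $ i))"
    using ex_poly_det_ev[of C "vec_nth (cvec q)" "vec_nth (cvec y)"] by blast
  \<comment> \<open>\<open>det (Q t)\<close> is \<open>1 / (t \<tau>)\<close> and removes only one
    of the two factors \<open>t\<close> of a double zero. The determinant would tend to 0, against
    \<open>lim1\<close>.\<close>
  have det_QG: "det (Q t ** G t) = poly P t * poly j t * t / \<tau>" if t: "t \<noteq> 0" for t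
  proof -
    have "det (Q t) = 1 + (1 / (t * \<tau>) - 1)"
      unfolding Q_def using a by (intro det_rank_one_update root_norm)
    moreover have "G t = (\<chi> i k. ev (C i k) (?u t)) ** jac (cvec q + t *s cvec y)"
      unfolding G_def by (rule C)
    then have "det (G t) = poly P t * (t ^ 2 * poly j t)"
      by (simp only: det_mul sq P vec_line)
    ultimately show ?thesis using t \<tau> by (simp add: det_mul power2_eq_square field_simps)
  qed
  have "((\<lambda>t. poly P t * poly j t * t / \<tau>) \<longlongrightarrow> poly P 0 * poly j 0 * 0 / \<tau>) (at 0)"
    by (intro tendsto_divide tendsto_mult tendsto_const tendsto_ident_at \<tau> isCont_tendsto_compose[OF poly_isCont])
  moreover have "\<forall>\<^sub>F t in at 0. poly P t * poly j t * t / \<tau> = det (Q t ** G t)"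
    using det_QG by (auto simp: eventually_at_filter)
  ultimately have "((\<lambda>t. det (Q t ** G t)) \<longlongrightarrow> 0) (at 0)" by (simp add: tendsto_cong)
  with lim1 have "det (\<chi> i j :: 'n. if i = j then 2 else (0::complex)) = 0"
    by (rule LIM_unique)
  moreover have "det (\<chi> i j :: 'n. if i = j then 2 else (0::complex)) = 2 ^ CARD('n)"
    by (subst det_diagonal) auto
  ultimately show False by simp
qed

text \<open>On a generic line \<open>x + t y\<close> the Jacobian determinant is a polynomial of
  degree at least \<open>?M\<close>. Its zeros are simple and lie where the line meets reflecting
  hyperplanes, one parameter per hyperplane; the roots number two per hyperplane.\<close>

lemma sum_exponents_le: "2 * (\<Sum>i\<in>UNIV. m (\<kappa> i)) \<le> card (roots W)"
proof -
  let ?M = "\<Sum>i\<in>UNIV. m (\<kappa> i)"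
  have "0 \<notin> roots W" using root_nonzero by blast
  from ex_generic_vector[OF finite_roots this]
  obtain y where y: "\<And>a. a \<in> roots W \<Longrightarrow> a \<bullet> y \<noteq> 0" by blast
  \<comment> \<open>\<open>x\<close> is orthogonal to such a vector exactly when the line meets the
    hyperplanes of \<open>a\<close> and \<open>b\<close> at the same parameter.\<close>
  define S where "S = {(b \<bullet> y) *\<^sub>R a - (a \<bullet> y) *\<^sub>R b | a b. a \<in> roots W \<and> b \<in> roots W \<and> b \<noteq> a \<and> b \<noteq> - a}"
  have "S \<subseteq> (\<lambda>(a, b). (b \<bullet> y) *\<^sub>R a - (a \<bullet> y) *\<^sub>R b) ` (roots W \<times> roots W)" by (auto simp: S_def)
  then have "finite S" using finite_roots by (auto intro: finite_subset)
  moreover have "0 \<notin> S"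
  proof
    assume "0 \<in> S"
    then obtain a b where ab: "a \<in> roots W" "b \<in> roots W" "b \<noteq> a" "b \<noteq> - a" "(a \<bullet> y) *\<^sub>R b = (b \<bullet> y) *\<^sub>R a"
      by (auto simp: S_def)
    from arg_cong[OF ab(5), of "\<lambda>v. (1 / (a \<bullet> y)) *\<^sub>R v"]
    have "b = ((b \<bullet> y) / (a \<bullet> y)) *\<^sub>R a" using y[OF ab(1)] by simp
    from proportional_roots[OF ab(1,2) this] show False using ab(3,4) by blast
  qed
  ultimately have "\<exists>x. \<forall>s\<in>S. s \<bullet> x \<noteq> 0" by (rule ex_generic_vector)
  then obtain x where x: "\<And>s. s \<in> S \<Longrightarrow> s \<bullet> x \<noteq> 0" by blast
  have "\<exists>Q. \<forall>t. poly Q t = det (jac (cvec x + t *s cvec y))"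
    unfolding jac_def vec_line by (rule ex_poly_det_ev)
  then obtain Q where Q: "\<And>t. poly Q t = det (jac (cvec x + t *s cvec y))" by blast
  \<comment> \<open>The line seen from infinity, with parameter \<open>1 / t\<close>. By homogeneity
    \<open>Q' 0\<close> is the coefficient of \<open>t ^ ?M\<close> in \<open>Q\<close>, and it is
    nonzero as \<open>y\<close> is regular.\<close>
  have "\<exists>Q. \<forall>t. poly Q t = det (jac (cvec y + t *s cvec x))"
    unfolding jac_def vec_line by (rule ex_poly_det_ev)
  then obtain Q' where Q': "\<And>t. poly Q' t = det (jac (cvec y + t *s cvec x))" by blast
  have Q'0: "poly Q' 0 \<noteq> 0"
  proof -
    have "det (jac (cvec y)) \<noteq> 0"
    proof (rule jac_nonzero)
      fix A assume "A \<in> W" "complexify A *v cvec y = cvec y"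
      then show "A = mat 1" using regular_stabilizer_trivial[OF y] by (simp add: complexify_cvec cvec_eq_iff)
    qed
    then show ?thesis by (simp add: Q')
  qed
  have QQ': "poly Q' s = s ^ ?M * poly Q (inverse s)" if "s \<noteq> 0" for s
  proof -
    have "cvec y + s *s cvec x = s *s (cvec x + inverse s *s cvec y)"
      using that by (simp add: vec_eq_iff algebra_simps)
    then show ?thesis by (simp only: Q Q' jac_homogeneous)
  qed
  have deg: "?M \<le> degree Q"
  proof (rule ccontr)
    assume "\<not> ?M \<le> degree Q"
    then have d: "?M = Suc (?M - degree Q - 1) + degree Q" by simp
    have *: "poly Q' s = s * (s ^ (?M - degree Q - 1) * poly (reflect_poly Q) s)" if "s \<noteq> 0" for s
      unfolding QQ'[OF that] poly_reflect_poly_nz[OF that] by (subst d) (simp only: power_add power_Suc mult.assoc)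
    have "((\<lambda>s. s * (s ^ (?M - degree Q - 1) * poly (reflect_poly Q) s)) \<longlongrightarrow>
        0 * (0 ^ (?M - degree Q - 1) * poly (reflect_poly Q) 0)) (at 0)"
      by (intro tendsto_mult tendsto_ident_at tendsto_power isCont_tendsto_compose[OF poly_isCont])
    moreover have "\<forall>\<^sub>F s in at 0. s * (s ^ (?M - degree Q - 1) * poly (reflect_poly Q) s) = poly Q' s"
      using * by (auto simp: eventually_at_filter)
    ultimately have "((\<lambda>s. poly Q' s) \<longlongrightarrow> 0) (at 0)" by (simp add: tendsto_cong)
    moreover have "((\<lambda>s. poly Q' s) \<longlongrightarrow> poly Q' 0) (at 0)"
      using poly_isCont[where p = Q' and x = 0] by (simp add: isCont_def)
    ultimately show False using Q'0 LIM_unique by blast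
  qed
  have "Q \<noteq> 0"
  proof
    assume "Q = 0"
    then have "poly Q' s = 0" if "s \<noteq> 0" for s using QQ'[OF that] that by simp
    then have "((\<lambda>s. poly Q' s) \<longlongrightarrow> 0) (at 0)"
      by (intro tendsto_eventually) (auto simp: eventually_at_filter)
    moreover have "((\<lambda>s. poly Q' s) \<longlongrightarrow> poly Q' 0) (at 0)"
      using poly_isCont[where p = Q' and x = 0] by (simp add: isCont_def)
    ultimately show False using Q'0 LIM_unique by blast
  qed
  define g where "g a = complex_of_real (- (x \<bullet> a) / (y \<bullet> a))" for a
  define \<Phi> where "\<Phi> = {a \<in> roots W. a \<bullet> y > 0}"
  \<comment> \<open>At a zero some nontrivial \<open>A\<close> fixes the point. For nonreal
    \<open>t\<close> it would fix the regular vector \<open>y\<close>; so \<open>t\<close> is real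
    and the point lies on a hyperplane, on only one by the choice of \<open>x\<close>. A double zero
    then contradicts \<open>jac_simple_zero\<close>.\<close>
  have root: "\<exists>a\<in>\<Phi>. t = g a \<and> Polynomial.order t Q = 1" if t: "poly Q t = 0" for t
  proof -
    have "\<not> (\<forall>A. A \<in> W \<longrightarrow> complexify A *v (cvec x + t *s cvec y) = cvec x + t *s cvec y \<longrightarrow> A = mat 1)"
      using jac_nonzero t by (auto simp: Q)
    then obtain A where A: "A \<in> W" "complexify A *v (cvec x + t *s cvec y) = cvec x + t *s cvec y" "A \<noteq> mat 1" by blast
    then have A2: "cvec (A *v x) + t *s cvec (A *v y) = cvec x + t *s cvec y"
      by (simp add: matrix_vector_right_distrib vector_scalar_commute complexify_cvec)
    have "Im t = 0"
    proof (rule ccontr)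
      assume "Im t \<noteq> 0"
      then have "A *v y = y" using A2 cvec_split by blast
      then show False using regular_stabilizer_trivial y A by blast
    qed
    then obtain s where s: "t = complex_of_real s" by (metis complex_is_Real_iff Reals_cases)
    define q where "q = x + s *\<^sub>R y"
    have line: "cvec x + (complex_of_real s + t') *s cvec y = cvec q + t' *s cvec y" for t'
      by (simp add: q_def cvec_def vec_eq_iff algebra_simps)
    have "A *v q = q"
      using A2 line[of 0] by (simp add: s matrix_vector_right_distrib matrix_vector_mult_scaleR q_def)
        (simp add: cvec_def vec_eq_iff flip: of_real_mult of_real_add)
    then obtain a0 where a0: "a0 \<in> roots W" "a0 \<bullet> q = 0"
      using regular_stabilizer_trivial A by blast
    define a where "a = (if a0 \<bullet> y > 0 then a0 else - a0)"
    have a: "a \<in> roots W" "a \<bullet> q = 0" "a \<bullet> y > 0"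
      using a0 root_uminus y[OF a0(1)] by (auto simp: a_def)
    have "x \<bullet> a + s * (y \<bullet> a) = 0" using a(2) by (simp add: q_def inner_add_right inner_commute)
    then have "s = - (x \<bullet> a) / (y \<bullet> a)" using a(3) by (simp add: field_simps inner_commute)
    then have "t = g a" by (simp add: g_def s)
    moreover have "Polynomial.order t Q = 1"
    proof (rule ccontr)
      assume "Polynomial.order t Q \<noteq> 1"
      then have "Polynomial.order t Q \<ge> 2" using t \<open>Q \<noteq> 0\<close> order_root[of Q t] by simp
      then have "[:- t, 1:] ^ 2 dvd Q" using order_1[of t Q] power_le_dvd by blast
      then obtain j where j: "Q = [:- t, 1:] ^ 2 * j" by (auto elim: dvdE)
      show False
      proof (rule jac_simple_zero[OF a(1), of q y "pcompose j [:t, 1:]"])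
        show "q \<bullet> a = 0" "y \<bullet> a \<noteq> 0" using a by (simp_all add: inner_commute)
      next
        fix t'
        have "det (jac (cvec q + t' *s cvec y)) = poly Q (t + t')" by (simp only: Q s line)
        also have "\<dots> = t' ^ 2 * poly (pcompose j [:t, 1:]) t'"
          by (simp add: j poly_pcompose add.commute)
        finally show "det (jac (cvec q + t' *s cvec y)) = t' ^ 2 * poly (pcompose j [:t, 1:]) t'" .
      next
        fix b assume b: "b \<in> roots W" "q \<bullet> b = 0"
        show "b = a \<or> b = - a"
        proof (rule ccontr)
          assume "\<not> (b = a \<or> b = - a)"
          then have "(b \<bullet> y) *\<^sub>R a - (a \<bullet> y) *\<^sub>R b \<in> S" using a(1) b(1) by (auto simp: S_def)
          then have "((b \<bullet> y) *\<^sub>R a - (a \<bullet> y) *\<^sub>R b) \<bullet> x \<noteq> 0" by (rule x)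
          moreover have "a \<bullet> x = - (s * (a \<bullet> y))" "b \<bullet> x = - (s * (b \<bullet> y))"
            using a(2) b(2) by (simp_all add: q_def inner_add_right inner_add_left inner_commute)
          ultimately show False by (simp add: inner_diff_left)
        qed
      qed
    qed
    ultimately show ?thesis using a by (auto simp: \<Phi>_def)
  qed
  have fin\<Phi>: "finite \<Phi>" using finite_roots by (simp add: \<Phi>_def)
  \<comment> \<open>Over the complex numbers the degree counts zeros with multiplicity, and all
    multiplicities are 1.\<close>
  have "?M \<le> size (proots Q)" using deg by (simp add: size_proots_complex)
  also have "\<dots> = (\<Sum>t\<in>{t. poly Q t = 0}. Polynomial.order t Q)"
    using \<open>Q \<noteq> 0\<close> by (simp add: size_multiset_overloaded_eq)
  also have "\<dots> = card {t. poly Q t = 0}" using root by simp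
  also have "\<dots> \<le> card (g ` \<Phi>)" using root fin\<Phi> by (intro card_mono) auto
  also have "\<dots> \<le> card \<Phi>" using fin\<Phi> by (rule card_image_le)
  finally have M\<Phi>: "?M \<le> card \<Phi>" .
  have "card (\<Phi> \<union> uminus ` \<Phi>) = card \<Phi> + card (uminus ` \<Phi>)"
    using fin\<Phi> by (intro card_Un_disjoint) (auto simp: \<Phi>_def)
  also have "card (uminus ` \<Phi>) = card \<Phi>" by (intro card_image) (auto simp: inj_on_def)
  finally have "2 * card \<Phi> = card (\<Phi> \<union> uminus ` \<Phi>)" by simp
  also have "\<dots> \<le> card (roots W)"
    using finite_roots root_uminus by (intro card_mono) (auto simp: \<Phi>_def)
  finally show ?thesis using M\<Phi> by linarith
qed

end


subsection \<open>Basic invariants at a Coxeter eigenvector\<close>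

text \<open>From here on the word for the Coxeter element is forgotten; only its eigenvector, the
  absence of fixed vectors and the root count are kept.\<close>

locale coxeter_invariants =
  irreducible_roots W z D + reflection_invariants W p w m \<kappa>
  for W :: "(real^'n^'n) set" and z D and p :: "nat \<Rightarrow> 'n cpoly" and w m \<kappa> +
  fixes c :: "real^'n^'n" and v :: "complex^'n" and \<mu> :: complex
  assumes c_W: "c \<in> W" and cv: "complexify c *v v = \<mu> *s v"
    and v_free: "A \<in> W \<Longrightarrow> complexify A *v v = v \<Longrightarrow> A = mat 1"
    and c_fixed: "c *v x = x \<Longrightarrow> x = 0"
    and c_orbits: "h > 0 \<Longrightarrow> ((*v) c ^^ h) = id \<Longrightarrow> card (roots W) \<le> CARD('n) * h"
begin

section \<open>The eigenvalue and its order\<close>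

lemma v_nonzero: "v \<noteq> 0"
proof
  assume v: "v = 0"
  have "W \<subseteq> {mat 1}"
  proof
    fix A assume "A \<in> W"
    then show "A \<in> {mat 1}" using v_free[of A] by (simp add: v)
  qed
  then show False using nontrivial one_W by blast
qed

lemma det_jac_v: "det (jac v) \<noteq> 0"
  by (rule jac_nonzero) (rule v_free)

lemma ex_power: "\<exists>B\<in>W. (*v) B = (*v) c ^^ k \<and> complexify B *v v = \<mu> ^ k *s v"
proof (induction k)
  case 0
  show ?case using one_W by (intro bexI[of _ "mat 1"]) (auto simp: complexify_one)
next
  case (Suc k)
  then obtain B where B: "B \<in> W" "(*v) B = (*v) c ^^ k" "complexify B *v v = \<mu> ^ k *s v" by blast
  have "(*v) (c ** B) = (*v) c ^^ Suc k"
    by (simp add: fun_eq_iff B(2) flip: matrix_vector_mul_assoc)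
  moreover have "complexify (c ** B) *v v = \<mu> ^ Suc k *s v"
    by (simp add: complexify_mult B(3) vector_scalar_commute cv mult.commute flip: matrix_vector_mul_assoc)
  ultimately show ?case using mult_W[OF c_W B(1)] by blast
qed

lemma ex_root_of_unity: "\<exists>k>0. \<mu> ^ k = 1"
proof -
  have "\<forall>k. \<exists>B. B \<in> W \<and> complexify B *v v = \<mu> ^ k *s v" using ex_power by blast
  from choice[OF this] obtain B where B: "\<And>k. B k \<in> W" "\<And>k. complexify (B k) *v v = \<mu> ^ k *s v" by blast
  have "\<not> inj B"
    using finite_imageD[of B UNIV] finite_subset[OF _ finite_W, of "range B"] B(1) by blast
  then obtain i j where "i \<noteq> j" "B i = B j" by (auto simp: inj_def)
  then obtain i j where ij: "i < j" "B i = B j" by (metis linorder_neqE_nat)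
  have "\<mu> ^ i *s v = \<mu> ^ j *s v" unfolding B(2)[symmetric] ij(2) ..
  then have eq: "\<mu> ^ i = \<mu> ^ j" using v_nonzero unfolding vector_mul_rcancel by blast
  have "\<mu> \<noteq> 0"
  proof
    assume "\<mu> = 0"
    then have z: "complexify c *v v = 0" using cv by simp
    obtain C where C: "C ** c = mat 1" using inverse_W[OF c_W] by blast
    have "v = complexify (C ** c) *v v" by (simp add: C complexify_one)
    also have "\<dots> = 0" by (simp add: complexify_mult z flip: matrix_vector_mul_assoc)
    finally show False using v_nonzero by simp
  qed
  moreover have "\<mu> ^ i * \<mu> ^ (j - i) = \<mu> ^ j" using ij(1) by (simp flip: power_add)
  then have "\<mu> ^ i * \<mu> ^ (j - i) = \<mu> ^ i" using eq by simp
  ultimately have "\<mu> ^ (j - i) = 1" by simp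
  then show ?thesis using ij(1) by (intro exI[of _ "j - i"]) simp
qed

definition h :: nat where
  "h = (LEAST k. k > 0 \<and> \<mu> ^ k = 1)"

lemma h_pos: "h > 0" and \<mu>_h: "\<mu> ^ h = 1"
  using LeastI_ex[OF ex_root_of_unity] by (simp_all add: h_def)

lemma h_dvd:
  assumes "\<mu> ^ k = 1"
  shows "h dvd k"
proof (rule ccontr)
  assume "\<not> h dvd k"
  then have pos: "k mod h > 0" by (simp add: dvd_eq_mod_eq_0)
  have "\<mu> ^ k = \<mu> ^ (h * (k div h) + k mod h)" by simp
  also have "\<dots> = \<mu> ^ (k mod h)" unfolding power_add power_mult \<mu>_h by simp
  finally have "\<mu> ^ (k mod h) = 1" using assms by simp
  then have "h \<le> k mod h" using pos unfolding h_def by (intro Least_le) simp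
  then show False using mod_less_divisor[OF h_pos, of k] by simp
qed

text \<open>The \<open>h\<close>-th power of \<open>c\<close> fixes \<open>v\<close> and is
  therefore the identity.\<close>

lemma card_roots_h: "card (roots W) \<le> CARD('n) * h"
proof (rule c_orbits[OF h_pos])
  obtain B where B: "B \<in> W" "(*v) B = (*v) c ^^ h" "complexify B *v v = \<mu> ^ h *s v"
    using ex_power by blast
  then have "B = mat 1" using v_free by (simp add: \<mu>_h)
  then show "(*v) c ^^ h = id" using B(2) by (auto simp: fun_eq_iff)
qed

text \<open>Differentiating \<open>p (c x) = p x\<close> at \<open>v\<close> and using homogeneity.
  Equivalently, the gradient is an eigenvector of \<open>c\<close> for \<open>\<mu> ^ m\<close>, as
  \<open>c\<close> is orthogonal.\<close>

lemma gradient_eigenvector: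
  "jac v $ i $ n = \<mu> ^ m (\<kappa> i) * (\<Sum>j\<in>UNIV. complex_of_real (c $ j $ n) * jac v $ i $ j)"
proof -
  have "jac v $ i $ n = ev (partial n (compose_matrix (p (\<kappa> i)) c)) (vec_nth v)"
    by (simp add: jac_def p_invariant[OF c_W])
  also have "\<dots> = (\<Sum>j\<in>UNIV. complex_of_real (c $ j $ n) * ev (partial j (p (\<kappa> i))) (vec_nth (\<mu> *s v)))"
    by (simp add: partial_compose_matrix ev_compose_matrix cv)
  also have "\<dots> = (\<Sum>j\<in>UNIV. complex_of_real (c $ j $ n) * (\<mu> ^ m (\<kappa> i) * jac v $ i $ j))"
  proof -
    have "vec_nth (\<mu> *s v) = (\<lambda>i. \<mu> * v $ i)" by auto
    then show ?thesis
      using ev_homogeneous[OF homogeneous_partial[OF p_homogeneous], of _ i \<mu> "vec_nth v"]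
      by (simp add: jac_def)
  qed
  finally show ?thesis by (simp add: sum_distrib_left mult.left_commute)
qed

section \<open>The Gram matrix of the gradients and the pairing of the exponents\<close>

lemma c_orthogonal: "(\<Sum>n\<in>UNIV. c $ j $ n * c $ l $ n) = (if j = l then 1 else 0)"
proof -
  have "orthogonal_transformation ((*v) c)"
    by (simp add: orthogonal_transformation_def W_orthogonal[OF c_W])
  then have "orthogonal_matrix c" by (simp add: orthogonal_transformation_matrix)
  then have "(c ** transpose c) $ j $ l = mat 1 $ j $ l" by (simp add: orthogonal_matrix_def)
  then show ?thesis by (simp add: matrix_matrix_mult_def transpose_def mat_def)
qed

definition gram :: "complex^'n^'n" where
  "gram = jac v ** transpose (jac v)"

lemma gram_eq: "gram $ i $ k = (\<Sum>n\<in>UNIV. jac v $ i $ n * jac v $ k $ n)"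
  by (simp add: gram_def matrix_matrix_mult_def transpose_def)

text \<open>The orthogonal matrix \<open>c\<close> preserves the bilinear product, while the
  gradients scale by powers of \<open>\<mu>\<close>; so a nonzero entry forces
  \<open>?e = 1\<close>.\<close>

lemma gram_nonzero_dvd:
  assumes "gram $ i $ k \<noteq> 0"
  shows "h dvd m (\<kappa> i) + m (\<kappa> k)"
proof (rule h_dvd)
  let ?c = "\<lambda>j n. complex_of_real (c $ j $ n)"
  let ?g = "\<lambda>i j. jac v $ i $ j"
  let ?e = "\<mu> ^ (m (\<kappa> i) + m (\<kappa> k))"
  have "gram $ i $ k = (\<Sum>n\<in>UNIV. ?e * ((\<Sum>j\<in>UNIV. ?c j n * ?g i j) * (\<Sum>l\<in>UNIV. ?c l n * ?g k l)))"
    unfolding gram_eq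
  proof (intro sum.cong refl)
    fix n
    show "?g i n * ?g k n = ?e * ((\<Sum>j\<in>UNIV. ?c j n * ?g i j) * (\<Sum>l\<in>UNIV. ?c l n * ?g k l))"
      unfolding gradient_eigenvector[of i n] gradient_eigenvector[of k n] power_add
      by (simp only: mult_ac)
  qed
  also have "\<dots> = ?e * (\<Sum>n\<in>UNIV. \<Sum>j\<in>UNIV. \<Sum>l\<in>UNIV. (?c j n * ?g i j) * (?c l n * ?g k l))"
    unfolding sum_product by (rule sum_distrib_left[symmetric])
  also have "(\<Sum>n\<in>UNIV. \<Sum>j\<in>UNIV. \<Sum>l\<in>UNIV. (?c j n * ?g i j) * (?c l n * ?g k l)) =
      (\<Sum>j\<in>UNIV. \<Sum>n\<in>UNIV. \<Sum>l\<in>UNIV. (?c j n * ?g i j) * (?c l n * ?g k l))" by (rule sum.swap)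
  also have "\<dots> = (\<Sum>j\<in>UNIV. \<Sum>l\<in>UNIV. \<Sum>n\<in>UNIV. (?c j n * ?g i j) * (?c l n * ?g k l))"
    by (intro sum.cong refl sum.swap)
  also have "\<dots> = (\<Sum>j\<in>UNIV. \<Sum>l\<in>UNIV. (if l = j then ?g i j * ?g k j else 0))"
  proof (intro sum.cong refl)
    fix j l
    have "(\<Sum>n\<in>UNIV. (?c j n * ?g i j) * (?c l n * ?g k l)) =
        complex_of_real (\<Sum>n\<in>UNIV. c $ j $ n * c $ l $ n) * (?g i j * ?g k l)"
      unfolding of_real_sum of_real_mult sum_distrib_right by (intro sum.cong refl) (simp only: mult_ac)
    then show "(\<Sum>n\<in>UNIV. (?c j n * ?g i j) * (?c l n * ?g k l)) = (if l = j then ?g i j * ?g k j else 0)"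
      unfolding c_orthogonal by (auto split: if_splits)
  qed
  also have "\<dots> = gram $ i $ k" by (simp add: gram_eq)
  finally show "?e = 1" using assms by simp
qed

text \<open>Exponent 0 would make row \<open>i\<close> of \<open>jac v\<close> a fixed vector of
  \<open>c\<close>, so its real and imaginary parts and then \<open>det (jac v)\<close> would be
  zero. Positivity turns divisibility by \<open>h\<close> into the bound
  \<open>h \<le> m i + m k\<close>.\<close>

lemma exponent_pos: "m (\<kappa> i) > 0"
proof (rule ccontr)
  assume "\<not> m (\<kappa> i) > 0"
  then have m0: "m (\<kappa> i) = 0" by simp
  let ?g = "jac v $ i"
  have fix_T: "?g $ n = (\<Sum>j\<in>UNIV. complex_of_real (c $ j $ n) * ?g $ j)" for n
    using gradient_eigenvector[of i n] m0 by simp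
  have fixed: "(\<Sum>n\<in>UNIV. complex_of_real (c $ l $ n) * ?g $ n) = ?g $ l" for l
  proof -
    have "(\<Sum>n\<in>UNIV. complex_of_real (c $ l $ n) * ?g $ n) =
        (\<Sum>n\<in>UNIV. \<Sum>j\<in>UNIV. complex_of_real (c $ j $ n * c $ l $ n) * ?g $ j)"
      by (subst fix_T) (simp add: sum_distrib_left mult_ac)
    also have "\<dots> = (\<Sum>j\<in>UNIV. \<Sum>n\<in>UNIV. complex_of_real (c $ j $ n * c $ l $ n) * ?g $ j)" by (rule sum.swap)
    also have "\<dots> = (\<Sum>j\<in>UNIV. complex_of_real (\<Sum>n\<in>UNIV. c $ j $ n * c $ l $ n) * ?g $ j)"
      by (simp add: sum_distrib_right)
    also have "\<dots> = (\<Sum>j\<in>UNIV. if j = l then ?g $ l else 0)"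
      unfolding c_orthogonal by (intro sum.cong refl) auto
    finally show ?thesis by simp
  qed
  have "c *v (\<chi> n. Re (?g $ n)) = (\<chi> n. Re (?g $ n))"
    using fixed by (simp add: vec_eq_iff matrix_vector_mult_def complex_eq_iff)
  then have "(\<chi> n. Re (?g $ n)) = 0" by (rule c_fixed)
  moreover have "c *v (\<chi> n. Im (?g $ n)) = (\<chi> n. Im (?g $ n))"
    using fixed by (simp add: vec_eq_iff matrix_vector_mult_def complex_eq_iff)
  then have "(\<chi> n. Im (?g $ n)) = 0" by (rule c_fixed)
  ultimately have "?g = 0" by (simp add: vec_eq_iff complex_eq_iff)
  then have "det (jac v) = 0" by (intro det_zero_row) (simp add: row_def vec_eq_iff)
  then show False using det_jac_v by simp
qed

lemma ex_pairing:
  obtains \<sigma> where "\<sigma> permutes UNIV" "\<And>i. gram $ i $ \<sigma> i \<noteq> 0"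
proof -
  have "det gram \<noteq> 0" by (simp add: gram_def det_mul det_transpose det_jac_v)
  then obtain \<sigma> where \<sigma>: "\<sigma> permutes UNIV" "of_int (sign \<sigma>) * (\<Prod>i\<in>UNIV. gram $ i $ \<sigma> i) \<noteq> 0"
    unfolding det_def by (elim sum.not_neutral_contains_not_neutral) auto
  then have "gram $ i $ \<sigma> i \<noteq> 0" for i by (auto simp: prod_zero_iff)
  then show thesis using \<sigma>(1) by (rule that[rotated])
qed

lemma pairing_sum:
  assumes \<sigma>: "\<sigma> permutes UNIV" "\<And>i. gram $ i $ \<sigma> i \<noteq> 0"
  shows "m (\<kappa> i) + m (\<kappa> (\<sigma> i)) = h"
proof (rule ccontr)
  assume ne: "m (\<kappa> i) + m (\<kappa> (\<sigma> i)) \<noteq> h"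
  have ge: "h \<le> m (\<kappa> i) + m (\<kappa> (\<sigma> i))" for i
    using gram_nonzero_dvd[OF \<sigma>(2)] exponent_pos[of i] by (intro dvd_imp_le) auto
  have "(\<Sum>i\<in>(UNIV :: 'n set). h) < (\<Sum>i\<in>UNIV. m (\<kappa> i) + m (\<kappa> (\<sigma> i)))"
  proof (rule sum_strict_mono_ex1)
    show "\<exists>i\<in>UNIV. h < m (\<kappa> i) + m (\<kappa> (\<sigma> i))"
      using ge[of i] ne by (intro bexI[of _ i]) auto
  qed (use ge in auto)
  also have "\<dots> = 2 * (\<Sum>i\<in>UNIV. m (\<kappa> i))"
    using sum.permute[OF \<sigma>(1), of "\<lambda>i. m (\<kappa> i)"] by (simp add: sum.distrib comp_def)
  also have "\<dots> \<le> CARD('n) * h" using sum_exponents_le card_roots_h by linarith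
  finally show False by simp
qed

lemma exponent_less: "m (\<kappa> i) < h"
proof -
  obtain \<sigma> where \<sigma>: "\<sigma> permutes UNIV" "\<And>i. gram $ i $ \<sigma> i \<noteq> 0" using ex_pairing by blast
  show ?thesis using pairing_sum[OF \<sigma>, of i] exponent_pos[of "\<sigma> i"] by linarith
qed

text \<open>Invariance and homogeneity at \<open>v\<close> give \<open>\<mu> ^ degree = 1\<close>,
  so \<open>h\<close> divides the degree, which is positive and at most \<open>h\<close>.\<close>

lemma degree_nonvanishing:
  assumes "ev (p (\<kappa> k)) (vec_nth v) \<noteq> 0"
  shows "m (\<kappa> k) + 1 = h"
proof -
  have "vec_nth (\<mu> *s v) = (\<lambda>i. \<mu> * v $ i)" by auto
  then have "ev (p (\<kappa> k)) (vec_nth v) = \<mu> ^ (m (\<kappa> k) + 1) * ev (p (\<kappa> k)) (vec_nth v)"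
    using ev_compose_matrix[of "p (\<kappa> k)" c v] ev_homogeneous[OF p_homogeneous, of k \<mu> "vec_nth v"]
    by (simp add: p_invariant[OF c_W] cv)
  then have "\<mu> ^ (m (\<kappa> k) + 1) = 1" using assms by simp
  then have "h dvd m (\<kappa> k) + 1" by (rule h_dvd)
  then have "h \<le> m (\<kappa> k) + 1" by (intro dvd_imp_le) simp_all
  then show ?thesis using exponent_less[of k] by simp
qed

text \<open>If all \<open>p k\<close> were zero at \<open>v\<close>, Euler's formula would put
  \<open>v\<close> in the kernel of the invertible \<open>jac v\<close>. This makes \<open>h\<close>
  one of the degrees.\<close>

lemma ex_nonvanishing: "\<exists>k. ev (p (\<kappa> k)) (vec_nth v) \<noteq> 0"
proof (rule ccontr)
  assume "\<not> ?thesis"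
  then have "jac v *v v = 0"
    using euler_homogeneous[OF p_homogeneous, of "vec_nth v"]
    by (simp add: vec_eq_iff matrix_vector_mult_def jac_def mult.commute)
  moreover obtain B where B: "B ** jac v = mat 1"
    using det_jac_v invertible_det_nz[of "jac v"] by (auto simp: invertible_def)
  ultimately have "v = 0" by (metis matrix_vector_mul_assoc matrix_vector_mul_lid matrix_vector_mult_0_right)
  then show False using v_nonzero by simp
qed

text \<open>On the line through \<open>v\<close> each \<open>p k\<close> is either zero or
  \<open>t ^ h\<close> times its value at \<open>v\<close>. The base point 0 is written out to match
  \<open>ex_poly_ev_line\<close>.\<close>

lemma ideal_scaling:
  assumes "f \<in> ideal_generated (CARD('n)) p"
  shows "\<exists>P. \<forall>t. ev f (\<lambda>i. 0 + t * v $ i) = t ^ h * poly P t"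
proof -
  obtain q where q: "f = (\<Sum>i=1..CARD('n). q i * p i)"
    using assms by (auto simp: ideal_generated_def)
  have p_scale: "ev (p i) (\<lambda>i. 0 + t * v $ i) = t ^ h * ev (p i) (vec_nth v)"
    if "i \<in> {1..CARD('n)}" for i t
  proof -
    obtain k where k: "i = \<kappa> k" using \<kappa> \<open>i \<in> _\<close> by (metis bij_betw_imp_surj_on imageE)
    have "ev (p i) (\<lambda>i. 0 + t * v $ i) = t ^ (m (\<kappa> k) + 1) * ev (p i) (vec_nth v)"
      using ev_homogeneous[OF p_homogeneous, of k t "vec_nth v"] by (simp add: k)
    then show ?thesis using degree_nonvanishing[of k]
      by (cases "ev (p (\<kappa> k)) (vec_nth v) = 0") (simp_all only: k mult_zero_right simp_thms)
  qed
  have "\<forall>i. \<exists>P. \<forall>t. poly P t = ev (q i) (\<lambda>i. 0 + t * v $ i)" by (intro allI ex_poly_ev_line)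
  from choice[OF this] obtain P where P: "\<And>i t. poly (P i) t = ev (q i) (\<lambda>i. 0 + t * v $ i)" by blast
  show ?thesis
  proof (intro exI allI)
    fix t
    have "ev f (\<lambda>i. 0 + t * v $ i) =
        (\<Sum>i=1..CARD('n). poly (P i) t * (t ^ h * ev (p i) (vec_nth v)))"
      unfolding q ev_sum ev_mult P by (intro sum.cong refl) (simp only: p_scale)
    also have "\<dots> = t ^ h * poly (\<Sum>i=1..CARD('n). P i * [:ev (p i) (vec_nth v):]) t"
      by (simp add: poly_sum sum_distrib_left mult_ac)
    finally show "ev f (\<lambda>i. 0 + t * v $ i) = t ^ h * poly (\<Sum>i=1..CARD('n). P i * [:ev (p i) (vec_nth v):]) t" .
  qed
qed

lemma ideal_times_forms_scaling:
  assumes "F \<in> ideal_times_forms (ideal_generated (CARD('n)) p)"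
  shows "\<exists>P. \<forall>t. ev (F $ n) (\<lambda>i. 0 + t * v $ i) = t ^ h * poly P t"
proof -
  obtain N f \<omega> where F: "F = (\<Sum>k<N. f k *s \<omega> k)"
    and f: "\<And>k. k < (N::nat) \<Longrightarrow> f k \<in> ideal_generated (CARD('n)) p"
    using assms by (auto simp: ideal_times_forms_def)
  have "\<forall>k. \<exists>P. k < N \<longrightarrow> (\<forall>t. ev (f k) (\<lambda>i. 0 + t * v $ i) = t ^ h * poly P t)"
    using ideal_scaling[OF f] by blast
  from choice[OF this] obtain P
    where P: "\<And>k t. k < N \<Longrightarrow> ev (f k) (\<lambda>i. 0 + t * v $ i) = t ^ h * poly (P k) t" by blast
  have "\<forall>k. \<exists>Q. \<forall>t. poly Q t = ev (\<omega> k $ n) (\<lambda>i. 0 + t * v $ i)" by (intro allI ex_poly_ev_line)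
  from choice[OF this] obtain Q where Q: "\<And>k t. poly (Q k) t = ev (\<omega> k $ n) (\<lambda>i. 0 + t * v $ i)" by blast
  show ?thesis
  proof (intro exI allI)
    fix t
    have "ev (F $ n) (\<lambda>i. 0 + t * v $ i) = (\<Sum>k<N. t ^ h * poly (P k) t * poly (Q k) t)"
      unfolding F sum_component vector_smult_component ev_sum ev_mult Q
      by (intro sum.cong refl) (simp only: P lessThan_iff)
    also have "\<dots> = t ^ h * poly (\<Sum>k<N. P k * Q k) t"
      by (simp add: poly_sum sum_distrib_left mult.assoc)
    finally show "ev (F $ n) (\<lambda>i. 0 + t * v $ i) = t ^ h * poly (\<Sum>k<N. P k * Q k) t" .
  qed
qed

text \<open>
  The components of \<open>Hess (p i) (\<eta> j)\<close> have degree \<open>h - 1\<close>, and among the \<open>p k\<close> only those of degree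
  \<open>h\<close> can be nonzero at \<open>v\<close>; so a form in \<open>F \<Omega>\<close> of this degree is zero at \<open>v\<close>. But by Euler's formula
  the value at \<open>v\<close>, contracted with \<open>v\<close>, is \<open>m i\<close> times the Gram entry.
\<close>

lemma Hess_not_in_ideal:
  assumes sum: "m (\<kappa> i) + m (\<kappa> j) = h" and gram: "gram $ i $ j \<noteq> 0"
  shows "Hess (p (\<kappa> i)) (dual_field (p (\<kappa> j))) \<notin> ideal_times_forms (ideal_generated (CARD('n)) p)"
proof
  let ?H = "Hess (p (\<kappa> i)) (dual_field (p (\<kappa> j)))"
  assume mem: "?H \<in> ideal_times_forms (ideal_generated (CARD('n)) p)"
  have H: "?H $ n = (\<Sum>k\<in>UNIV. partial k (p (\<kappa> j)) * partial k (partial n (p (\<kappa> i))))" for n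
    by (simp add: Hess_def apply_field_def dual_field_def)
  have hom_j: "homogeneous (m (\<kappa> j)) (partial k (p (\<kappa> j)))" for k
    using homogeneous_partial[OF p_homogeneous, of j k] by simp
  have hom_i: "homogeneous (m (\<kappa> i)) (partial k (p (\<kappa> i)))" for k
    using homogeneous_partial[OF p_homogeneous, of i k] by simp
  \<comment> \<open>The degree is \<open>m j + (m i - 1) = h - 1\<close>; positivity of the exponent
    makes the truncated subtraction exact.\<close>
  have H_scale: "ev (?H $ n) (\<lambda>i. t * v $ i) = t ^ (h - 1) * ev (?H $ n) (vec_nth v)" for n t
  proof -
    have "m (\<kappa> j) + (m (\<kappa> i) - 1) = h - 1" using sum exponent_pos[of i] by simp
    then have "t ^ (h - 1) = t ^ m (\<kappa> j) * t ^ (m (\<kappa> i) - 1)" by (simp flip: power_add)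
    then show ?thesis unfolding H
      by (simp add: ev_homogeneous[OF hom_j] ev_homogeneous[OF homogeneous_partial[OF hom_i]]
          sum_distrib_left mult_ac)
  qed
  have H0: "ev (?H $ n) (vec_nth v) = 0" for n
  proof -
    obtain P where P: "\<And>t. ev (?H $ n) (\<lambda>i. 0 + t * v $ i) = t ^ h * poly P t"
      using ideal_times_forms_scaling[OF mem] by blast
    \<comment> \<open>Homogeneity of degree \<open>h - 1\<close> meets divisibility by
      \<open>t ^ h\<close>: after cancelling, one factor \<open>t\<close> is left, and
      \<open>t\<close> tends to 0.\<close>
    have "t * poly P t = ev (?H $ n) (vec_nth v)" if "t \<noteq> 0" for t
    proof -
      have "t ^ (h - 1) * ev (?H $ n) (vec_nth v) = t ^ (h - 1) * (t * poly P t)"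
        using P[of t] H_scale[of n t] h_pos by (cases h) simp_all
      then show ?thesis using that by simp
    qed
    then have "((\<lambda>t. t * poly P t) \<longlongrightarrow> ev (?H $ n) (vec_nth v)) (at 0)"
      by (intro tendsto_eventually) (auto simp: eventually_at_filter)
    moreover have "((\<lambda>t. t * poly P t) \<longlongrightarrow> 0 * poly P 0) (at 0)"
      by (intro tendsto_mult tendsto_ident_at isCont_tendsto_compose[OF poly_isCont])
    ultimately show ?thesis using LIM_unique by fastforce
  qed
  have "0 = (\<Sum>n\<in>UNIV. v $ n * ev (?H $ n) (vec_nth v))" by (simp add: H0)
  \<comment> \<open>The two derivatives are exchanged so that Euler's formula can be applied to
    \<open>partial k\<close> of the invariant, which has degree \<open>m i\<close>.\<close>
  also have "\<dots> = (\<Sum>n\<in>UNIV. \<Sum>k\<in>UNIV. jac v $ j $ k * (v $ n * ev (partial n (partial k (p (\<kappa> i)))) (vec_nth v)))"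
    unfolding H
    by (intro sum.cong refl) (simp add: sum_distrib_left jac_def partial_commute mult_ac)
  also have "\<dots> = (\<Sum>k\<in>UNIV. \<Sum>n\<in>UNIV. jac v $ j $ k * (v $ n * ev (partial n (partial k (p (\<kappa> i)))) (vec_nth v)))"
    by (rule sum.swap)
  also have "\<dots> = (\<Sum>k\<in>UNIV. jac v $ j $ k * (of_nat (m (\<kappa> i)) * jac v $ i $ k))"
    by (simp add: euler_homogeneous[OF hom_i] jac_def flip: sum_distrib_left)
  also have "\<dots> = of_nat (m (\<kappa> i)) * gram $ i $ j"
    by (simp add: gram_eq sum_distrib_left mult_ac)
  finally show False using gram exponent_pos[of i] by simp
qed

lemma hessian_rank:
  assumes mono: "\<And>i j. i \<in> {1..CARD('n)} \<Longrightarrow> j \<in> {1..CARD('n)} \<Longrightarrow> i \<le> j \<Longrightarrow> m i \<le> m j"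
    and j: "j \<in> {1..CARD('n)}"
  shows "\<exists>i\<in>{1..CARD('n)}. m i + m j = w (CARD('n)) \<and>
    Hess (p i) (dual_field (p j)) \<notin> ideal_times_forms (ideal_generated (CARD('n)) p)"
proof -
  \<comment> \<open>This invariant has degree \<open>h\<close> and no degree exceeds
    \<open>h\<close>; by monotonicity the last one equals \<open>h\<close>.\<close>
  obtain k where k: "ev (p (\<kappa> k)) (vec_nth v) \<noteq> 0" using ex_nonvanishing by blast
  have l: "CARD('n) \<in> {1..CARD('n)}" using zero_less_card_finite[where 'a = 'n] by simp
  then obtain l' where l': "CARD('n) = \<kappa> l'" using \<kappa> by (metis bij_betw_imp_surj_on imageE)
  have "m (\<kappa> k) \<le> m (CARD('n))" using \<kappa>_range[of k] l by (intro mono) auto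
  moreover have "m (CARD('n)) < h" unfolding l' by (rule exponent_less)
  ultimately have wl: "w (CARD('n)) = h" using degree_nonvanishing[OF k] w_eq[OF l] by linarith
  obtain j' where j': "j = \<kappa> j'" using \<kappa> j by (metis bij_betw_imp_surj_on imageE)
  obtain \<sigma> where \<sigma>: "\<sigma> permutes UNIV" "\<And>i. gram $ i $ \<sigma> i \<noteq> 0" using ex_pairing by blast
  have sum: "m (\<kappa> (\<sigma> j')) + m (\<kappa> j') = h" using pairing_sum[OF \<sigma>, of j'] by simp
  have "gram $ \<sigma> j' $ j' \<noteq> 0" using \<sigma>(2)[of j'] by (simp add: gram_eq mult.commute)
  from Hess_not_in_ideal[OF sum this] show ?thesis
    using \<kappa>_range sum by (intro bexI[of _ "\<kappa> (\<sigma> j')"]) (simp_all add: j' wl)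
qed

end

theorem theorem5p10:
  fixes W :: "(real^'n^'n) set"
    and p :: "nat \<Rightarrow> 'n cpoly"
    and w m :: "nat \<Rightarrow> nat"
  assumes "irreducible_reflection_group W"
    and "\<not> type_E 6 W" and "\<not> type_E 7 W" and "\<not> type_E 8 W"
    and "basic_invariants W p w"
    and "\<forall>i\<in>{1..CARD('n)}. w i = m i + 1"
    and "\<forall>i\<in>{1..CARD('n)}. \<forall>j\<in>{1..CARD('n)}. i \<le> j \<longrightarrow> m i \<le> m j"
  shows "\<forall>j\<in>{1..CARD('n)}. \<exists>i\<in>{1..CARD('n)}.
           m i + m j = w (CARD('n)) \<and>
           Hess (p i) (dual_field (p j)) \<notin> ideal_times_forms (ideal_generated (CARD('n)) p)"
proof -
  note irr = assms(1)[unfolded irreducible_reflection_group_def]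
  interpret refl_group W
    using irr by (intro refl_group.intro) blast+
  have "0 \<notin> roots W" using root_nonzero by blast
  from ex_generic_vector[OF finite_roots this]
  obtain z where z: "\<And>a. a \<in> roots W \<Longrightarrow> a \<bullet> z \<noteq> 0" by blast
  obtain D where "simple_roots W z D" using ex_simple_roots[OF z] .
  then interpret simple_roots W z D .
  interpret irreducible_roots W z D
    using irr by unfold_locales blast+
  obtain as v \<mu> where as: "set as = D" "distinct as" "complexify (rprod as) *v v = \<mu> *s v"
    "\<And>A. A \<in> W \<Longrightarrow> complexify A *v v = v \<Longrightarrow> A = mat 1" using ex_coxeter_element by blast
  have "\<exists>\<kappa>. bij_betw \<kappa> (UNIV :: 'n set) {1..CARD('n)}"
    by (intro finite_same_card_bij) auto
  then obtain \<kappa> where \<kappa>: "bij_betw \<kappa> (UNIV :: 'n set) {1..CARD('n)}" by blast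
  interpret coxeter_invariants W z D p w m \<kappa> "rprod as" v \<mu>
  proof unfold_locales
    fix x assume "rprod as *v x = x"
    then have "\<forall>a\<in>set as. x \<bullet> a = 0" using as(1,2) by (intro rprod_fixed) auto
    then show "x = 0" using as(1) by (intro orthogonal_D_zero) (simp add: inner_commute)
  next
    show "rprod as \<in> W" using as(1) by (intro rprod_D_W) simp
  next
    fix h :: nat assume "0 < h" "(*v) (rprod as) ^^ h = id"
    then show "card (roots W) \<le> CARD('n) * h" by (rule card_roots_le[OF as(1,2)])
  next
    show "basic_invariants W p w" by (rule assms(5))
  next
    fix i assume "i \<in> {1..CARD('n)}"
    then show "w i = m i + 1" using assms(6) by blast
  next
    show "bij_betw \<kappa> UNIV {1..CARD('n)}" by (rule \<kappa>)
  next
    show "complexify (rprod as) *v v = \<mu> *s v" by (rule as(3))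
  next
    fix A assume "A \<in> W" "complexify A *v v = v"
    then show "A = mat 1" by (rule as(4))
  qed
  show ?thesis
  proof
    fix j assume j: "j \<in> {1..CARD('n)}"
    show "\<exists>i\<in>{1..CARD('n)}. m i + m j = w (CARD('n)) \<and>
      Hess (p i) (dual_field (p j)) \<notin> ideal_times_forms (ideal_generated (CARD('n)) p)"
      by (rule hessian_rank[OF _ j]) (use assms(7) in blast)
  qed
qed

end
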